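(* Assume that $\mu_{B,1}\,\mu_{B,2}=\mu_{A,1}\,\mu_{A,2}$. Then for every $l\in(0,L)$ with $\mathcal G_{\rm hom}(l)\neq0$ the effective toughness is $$G^c_{\rm eff}(l)=\lambda\max\Big\{G^c_A,\ G^c_B\,\frac{\mu_{B,1}}{\mu_{A,1}}\Big\}+(1-\lambda)\max\Big\{G^c_A\,\frac{\mu_{A,1}}{\mu_{B,1}},\ G^c_B\Big\}.$$
   Context: Geometry. $L,H>0$, $\Omega=(0,L)\times(-H,H)$, $K_l=[0,l]\times\{0\}$ for $l\in(0,L]$; $\partial_D\Omega=\{0\}\times((-H,0)\cup(0,H))\ \cup\ \{L\}\times(-H,H)$; $g\in H^{1/2}(\partial_D\Omega)$ (on each of the three open segments); $\mathcal U_l=\{u\in H^1(\Omega\setminus K_l):u=g\text{ on }\partial_D\Omega\}$. Vertical layers. $\lambda\in(0,1)$, $n\in\mathbb N\setminus\{0\}$; $l_{n,k}=kL/n$ ($k=0,\dots,n$), $l_{n,k+\lambda}=(k+\lambda)L/n$ ($k=0,\dots,n-1$); $\Lambda_n$ is the set of all these points. $\boldsymbol C_A=\mathrm{diag}(\mu_{A,1},\mu_{A,2})$, $\boldsymbol C_B=\mathrm{diag}(\mu_{B,1},\mu_{B,2})$ with positive entries; toughnesses $G^c_A,G^c_B>0$. $\boldsymbol C_n(x)=\boldsymbol C_A$ if $x_1\in(l_{n,k},l_{n,k+\lambda})$, $\boldsymbol C_n(x)=\boldsymbol C_B$ if $x_1\in(l_{n,k+\lambda},l_{n,k+1})$. $G^c_n(l)=G^c_A$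 for $l\in[l_{n,k},l_{n,k+\lambda})$, $G^c_n(l)=G^c_B$ for $l\in[l_{n,k+\lambda},l_{n,k+1})$, $G^c_n(L)=G^c_A$. Energy and energy release. $\mathcal E_n(l)=\min\{\tfrac12\int_{\Omega\setminus K_l}\nabla u\,\boldsymbol C_n\nabla u^T\,dx:u\in\mathcal U_l\}$, which is of class $C^1$ in $(0,L)\setminus\Lambda_n$. $\mathcal G_n(l)=-\mathcal E_n'(l)$ for $l\in(0,L)\setminus\Lambda_n$, $\mathcal G_n(l)=\liminf_{s\to l^+}\mathcal G_n(s)$ for $l\in\Lambda_n\setminus\{L\}$ (possibly $+\infty$), $\mathcal G_n(L)=0$. Homogenized quantities. $\boldsymbol C_{\rm hom}=\mathrm{diag}(\mu_{{\rm hom},1},\mu_{{\rm hom},2})$ with $1/\mu_{{\rm hom},1}=\lambda/\mu_{A,1}+(1-\lambda)/\mu_{B,1}$, $\mu_{{\rm hom},2}=\lambda\mu_{A,2}+(1-\lambda)\mu_{B,2}$. $\mathcal E_{\rm hom}(l)=\min\{\tfrac12\int_{\Omega\setminus K_l}\nabla u\,\boldsymbol C_{\rm hom}\nabla u^T\,dx:u\in\mathcal U_l\}$, of class $C^1(0,L)$; $\mathcal G_{\rm hom}(l)=-\mathcal E_{\rm hom}'(l)$ for $l\in(0,L)$. Effective toughness. For $l\in(0,L)$ with $\mathcal G_{\rm hom}(l)\ne0$: $G^c_{\rm eff}(l)=\mathcal G_{\rm hom}(l)/\gamma(l)$, where $\gamma(l)=\inf\{\liminf_{n\to\infty}\mathcal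 G_n(l_n)/G^c_n(l_n):l_n\in[0,L],\ l_n\to l\}$ is the $\Gamma$-liminf of $\mathcal G_n/G^c_n$ at $l$ (and $G^c_{\rm eff}(l)=+\infty$ if $\gamma(l)=0$). *)

theory Defs
  imports "HOL-Analysis.Analysis"
begin

section \<open>Square-integrable functions, weak gradients, traces\<close>

definition L2_on :: "'a::euclidean_space set \<Rightarrow> ('a \<Rightarrow> 'b::euclidean_space) \<Rightarrow> bool" where
  "L2_on U f \<longleftrightarrow> f \<in> borel_measurable (lebesgue_on U)
     \<and> integrable (lebesgue_on U) (\<lambda>x. (norm (f x))\<^sup>2)"

definition partial_deriv :: "'a::euclidean_space \<Rightarrow> ('a \<Rightarrow> real) \<Rightarrow> 'a \<Rightarrow> real" where
  "partial_deriv b f x = frechet_derivative f (at x) b"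

primrec C_k :: "nat \<Rightarrow> ('a::euclidean_space \<Rightarrow> real) \<Rightarrow> bool" where
  "C_k 0 f \<longleftrightarrow> continuous_on UNIV f"
| "C_k (Suc k) f \<longleftrightarrow> (\<forall>x. f differentiable (at x)) \<and> (\<forall>b\<in>Basis. C_k k (partial_deriv b f))"

definition test_functions :: "'a::euclidean_space set \<Rightarrow> ('a \<Rightarrow> real) set" where
  "test_functions U = {\<phi>. (\<forall>k. C_k k \<phi>) \<and> (\<exists>K. compact K \<and> K \<subseteq> U \<and> (\<forall>x. x \<notin> K \<longrightarrow> \<phi> x = 0))}"

definition weak_gradient ::
    "'a::euclidean_space set \<Rightarrow> ('a \<Rightarrow> real) \<Rightarrow> ('a \<Rightarrow> 'a) \<Rightarrow> bool" where
  "weak_gradient U u G \<longleftrightarrow> L2_on U u \<and> L2_on U G \<and>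
     (\<forall>\<phi>\<in>test_functions U. \<forall>b\<in>Basis.
        (\<integral>x. u x * partial_deriv b \<phi> x \<partial>lebesgue_on U) = - (\<integral>x. (G x \<bullet> b) * \<phi> x \<partial>lebesgue_on U))"

definition H1 :: "'a::euclidean_space set \<Rightarrow> ('a \<Rightarrow> real) set" where
  "H1 U = {u. \<exists>G. weak_gradient U u G}"

text \<open>Gagliardo (Sobolev--Slobodeckij) form of the fractional space on an interval. The integrand
  takes the value 0 on the diagonal, a null set.\<close>

definition H_half :: "real set \<Rightarrow> (real \<Rightarrow> real) set" where
  "H_half J = {g. L2_on J g \<and>
     integrable (lebesgue_on (J \<times> J)) (\<lambda>(s, t). ((g s - g t) / (s - t))\<^sup>2)}"

text \<open>\<open>\<tau>\<close> is the trace of \<open>u\<close> on the side \<open>{a} \<times> J\<close> of the rectangle \<open>R\<close>. The trace operator is the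
  continuous extension to \<open>H1 R\<close> of the restriction map on the functions in \<open>H1 R\<close> that are
  continuous up to the boundary; these are dense because \<open>R\<close> is a Lipschitz domain.\<close>

definition has_trace ::
    "(real \<times> real) set \<Rightarrow> real \<Rightarrow> real set \<Rightarrow> (real \<times> real \<Rightarrow> real) \<Rightarrow> (real \<Rightarrow> real) \<Rightarrow> bool" where
  "has_trace R a J u \<tau> \<longleftrightarrow> L2_on J \<tau> \<and>
     (\<exists>G v V. weak_gradient R u G \<and>
        (\<forall>k::nat. continuous_on (closure R) (v k) \<and> weak_gradient R (v k) (V k)) \<and>
        (\<lambda>k. \<integral>x. (v k x - u x)\<^sup>2 \<partial>lebesgue_on R) \<longlonglongrightarrow> 0 \<and>
        (\<lambda>k. \<integral>x. (norm (V k x - G x))\<^sup>2 \<partial>lebesgue_on R) \<longlonglongrightarrow> 0 \<and>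
        (\<lambda>k. \<integral>t. (v k (a, t) - \<tau> t)\<^sup>2 \<partial>lebesgue_on J) \<longlonglongrightarrow> 0)"


section \<open>Cracked rectangle, admissible displacements, minimal energy\<close>

definition Omega :: "real \<Rightarrow> real \<Rightarrow> (real \<times> real) set" where
  "Omega L H = {0<..<L} \<times> {-H<..<H}"

definition crack :: "real \<Rightarrow> (real \<times> real) set" where
  "crack l = {0..l} \<times> {0}"

text \<open>\<open>H\<^sup>1\<^sup>/\<^sup>2\<close> on each of the three open segments of the Dirichlet part of the boundary.\<close>

definition boundary_datum :: "real \<Rightarrow> real \<Rightarrow> (real \<times> real \<Rightarrow> real) \<Rightarrow> bool" where
  "boundary_datum L H g \<longleftrightarrow>
     (\<lambda>t. g (0, t)) \<in> H_half {-H<..<0} \<and>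
     (\<lambda>t. g (0, t)) \<in> H_half {0<..<H} \<and>
     (\<lambda>t. g (L, t)) \<in> H_half {-H<..<H}"

text \<open>The cracked domain is not Lipschitz, so the traces are taken from its upper and lower halves;
  on the side \<open>{L} \<times> {-H<..<H}\<close> this disregards only the point \<open>(L, 0)\<close>.\<close>

definition admissible ::
    "real \<Rightarrow> real \<Rightarrow> (real \<times> real \<Rightarrow> real) \<Rightarrow> real \<Rightarrow> (real \<times> real \<Rightarrow> real) set" where
  "admissible L H g l = {u \<in> H1 (Omega L H - crack l).
     \<forall>J\<in>{{-H<..<0}, {0<..<H}}. \<forall>a\<in>{0, L}. has_trace ({0<..<L} \<times> J) a J u (\<lambda>t. g (a, t))}"

text \<open>A diagonal matrix is represented by the pair of its diagonal entries.\<close>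

definition diag_form :: "real \<times> real \<Rightarrow> real \<times> real \<Rightarrow> real" where
  "diag_form C \<xi> = fst C * (fst \<xi>)\<^sup>2 + snd C * (snd \<xi>)\<^sup>2"

text \<open>The gradient is determined only almost everywhere, so \<open>G\<close> runs over all its representatives;
  they give the same energy. The infimum is attained (strictly convex coercive energy on a nonempty
  closed affine set), so \<open>Inf\<close> is the minimum.\<close>

definition min_energy ::
    "real \<Rightarrow> real \<Rightarrow> (real \<times> real \<Rightarrow> real) \<Rightarrow> (real \<times> real \<Rightarrow> real \<times> real) \<Rightarrow> real \<Rightarrow> real" where
  "min_energy L H g C l =
     Inf {1/2 * (\<integral>x. diag_form (C x) (G x) \<partial>lebesgue_on (Omega L H - crack l)) | u G.
            u \<in> admissible L H g l \<and> weak_gradient (Omega L H - crack l) u G}"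


section \<open>Vertical layers\<close>

definition interfaces :: "real \<Rightarrow> real \<Rightarrow> nat \<Rightarrow> real set" where
  "interfaces L lam n = {real k * L / real n | k. k \<le> n} \<union> {(real k + lam) * L / real n | k. k < n}"

text \<open>On the interfaces, a null set, the value \<open>C\<^sub>B\<close> is immaterial.\<close>

definition C_layer ::
    "real \<Rightarrow> real \<Rightarrow> real \<times> real \<Rightarrow> real \<times> real \<Rightarrow> nat \<Rightarrow> real \<times> real \<Rightarrow> real \<times> real" where
  "C_layer L lam C\<^sub>A C\<^sub>B n x =
     (if \<exists>k<n. real k * L / real n < fst x \<and> fst x < (real k + lam) * L / real n then C\<^sub>A else C\<^sub>B)"

definition toughness :: "real \<Rightarrow> real \<Rightarrow> real \<Rightarrow> real \<Rightarrow> nat \<Rightarrow> real \<Rightarrow> real" where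
  "toughness L lam Gc\<^sub>A Gc\<^sub>B n l =
     (if l = L \<or> (\<exists>k<n. real k * L / real n \<le> l \<and> l < (real k + lam) * L / real n)
      then Gc\<^sub>A else Gc\<^sub>B)"

definition energy_n ::
    "real \<Rightarrow> real \<Rightarrow> (real \<times> real \<Rightarrow> real) \<Rightarrow> real \<Rightarrow> real \<times> real \<Rightarrow> real \<times> real \<Rightarrow> nat \<Rightarrow> real \<Rightarrow> real" where
  "energy_n L H g lam C\<^sub>A C\<^sub>B n l = min_energy L H g (C_layer L lam C\<^sub>A C\<^sub>B n) l"

definition release_n ::
    "real \<Rightarrow> real \<Rightarrow> (real \<times> real \<Rightarrow> real) \<Rightarrow> real \<Rightarrow> real \<times> real \<Rightarrow> real \<times> real \<Rightarrow> nat \<Rightarrow> real \<Rightarrow> ereal" where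
  "release_n L H g lam C\<^sub>A C\<^sub>B n l =
     (if l = L then 0
      else if l \<in> interfaces L lam n
        then Liminf (at_right l) (\<lambda>s. ereal (- deriv (energy_n L H g lam C\<^sub>A C\<^sub>B n) s))
      else ereal (- deriv (energy_n L H g lam C\<^sub>A C\<^sub>B n) l))"


section \<open>Homogenized quantities and effective toughness\<close>

definition C_hom :: "real \<Rightarrow> real \<times> real \<Rightarrow> real \<times> real \<Rightarrow> real \<times> real" where
  "C_hom lam C\<^sub>A C\<^sub>B =
     (1 / (lam / fst C\<^sub>A + (1 - lam) / fst C\<^sub>B), lam * snd C\<^sub>A + (1 - lam) * snd C\<^sub>B)"

definition energy_hom ::
    "real \<Rightarrow> real \<Rightarrow> (real \<times> real \<Rightarrow> real) \<Rightarrow> real \<Rightarrow> real \<times> real \<Rightarrow> real \<times> real \<Rightarrow> real \<Rightarrow> real" where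
  "energy_hom L H g lam C\<^sub>A C\<^sub>B l = min_energy L H g (\<lambda>_. C_hom lam C\<^sub>A C\<^sub>B) l"

definition release_hom ::
    "real \<Rightarrow> real \<Rightarrow> (real \<times> real \<Rightarrow> real) \<Rightarrow> real \<Rightarrow> real \<times> real \<Rightarrow> real \<times> real \<Rightarrow> real \<Rightarrow> real" where
  "release_hom L H g lam C\<^sub>A C\<^sub>B l = - deriv (energy_hom L H g lam C\<^sub>A C\<^sub>B) l"

definition gamma_liminf_ratio ::
    "real \<Rightarrow> real \<Rightarrow> (real \<times> real \<Rightarrow> real) \<Rightarrow> real \<Rightarrow> real \<times> real \<Rightarrow> real \<times> real \<Rightarrow> real \<Rightarrow> real
      \<Rightarrow> real \<Rightarrow> ereal" where
  "gamma_liminf_ratio L H g lam C\<^sub>A C\<^sub>B Gc\<^sub>A Gc\<^sub>B l =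
     Inf {liminf (\<lambda>n. release_n L H g lam C\<^sub>A C\<^sub>B n (s n) / ereal (toughness L lam Gc\<^sub>A Gc\<^sub>B n (s n))) | s.
            (\<forall>n::nat. s n \<in> {0..L}) \<and> s \<longlonglongrightarrow> l}"

definition effective_toughness ::
    "real \<Rightarrow> real \<Rightarrow> (real \<times> real \<Rightarrow> real) \<Rightarrow> real \<Rightarrow> real \<times> real \<Rightarrow> real \<times> real \<Rightarrow> real \<Rightarrow> real
      \<Rightarrow> real \<Rightarrow> ereal" where
  "effective_toughness L H g lam C\<^sub>A C\<^sub>B Gc\<^sub>A Gc\<^sub>B l =
     (let \<gamma> = gamma_liminf_ratio L H g lam C\<^sub>A C\<^sub>B Gc\<^sub>A Gc\<^sub>B l
      in if \<gamma> = 0 then \<infinity> else ereal (release_hom L H g lam C\<^sub>A C\<^sub>B l) / \<gamma>)"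

end

theory Submission
  imports Defs
begin

text \<open>
  The interfaces are vertical and the crack is horizontal, so the layers can be removed by a change
  of the horizontal coordinate. Under a stretch \<open>y = (f x\<^sub>1, x\<^sub>2)\<close> the constant density
  \<open>c (\<partial>\<^sub>1 u)\<^sup>2 + q (\<partial>\<^sub>2 u)\<^sup>2\<close> becomes the density with coefficients \<open>c / f'\<close> and \<open>q f'\<close>
  (\<open>energies_stretch\<close>): the product of the two coefficients is unchanged. When
  \<open>\<mu>\<^sub>A\<^sub>1 \<mu>\<^sub>A\<^sub>2 = \<mu>\<^sub>B\<^sub>1 \<mu>\<^sub>B\<^sub>2\<close>, this product is also \<open>c q\<close> for the homogenized coefficients, and the map
  \<open>f\<^sub>n\<close> with slope \<open>c / \<mu>\<^sub>A\<^sub>1\<close> in the layers of A and \<open>c / \<mu>\<^sub>B\<^sub>1\<close> in those of B transforms the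
  homogenized body into the layered one. The harmonic mean \<open>c\<close> is the value for which \<open>f\<^sub>n\<close> fixes the
  end points of every period. Hence the energy of the layered body at crack length \<open>s\<close> is exactly
  the homogenized energy at \<open>f\<^sub>n s\<close> (\<open>energy_n_eq\<close>), and \<open>f\<^sub>n\<close> is within \<open>L / n\<close> of the identity.

  The chain rule gives the energy release of the layered body as \<open>G (f\<^sub>n s)\<close> times the slope of
  \<open>f\<^sub>n\<close> at \<open>s\<close>, where \<open>G\<close> is the homogenized one; at an interface the lower limit from the right
  selects the slope on the right, which is also the layer whose toughness counts (\<open>release_n_eq\<close>).
  Since \<open>G\<close> is continuous and nonnegative, the \<open>\<Gamma>\<close>-lower limit at \<open>l\<close> is \<open>G l\<close> times the smaller of
  the two quotients slope/toughness, and the crack tip can be kept in the layer with the smaller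
  quotient (\<open>gamma_liminf_ratio_eq\<close>). The reciprocal of this minimum is the formula.

  Two analytic facts support this. The first is that \<open>H\<^sup>1\<close> functions and their traces can be composed
  with piecewise affine stretches. A test function composed with such a map is not smooth, but the
  map is the identity plus a finite sum of multiples of functions \<open>\<bar>x - a\<bar>\<close>, which have the smooth
  approximations \<open>sqrt ((x - a)\<^sup>2 + e\<^sup>2)\<close> (\<open>weak_gradient_stretch\<close>). The second is that the homogenized energy is \<open>C\<^sup>1\<close>. A stretch with two
  slopes moves the crack tip from a fixed \<open>l\<close> to \<open>t\<close>, so the energy at \<open>t\<close> is the infimum
  of \<open>c t \<bullet> p\<close>, where \<open>p\<close> runs over a fixed set of points of \<open>\<real>\<^sup>4\<close>, the Dirichlet integrals of the two
  partial derivatives to the left and to the right of \<open>l\<close>, and only the coefficients \<open>c t\<close> depend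
  on \<open>t\<close>. On the closure of that set the minimum is attained, at one point only by the parallelogram
  identity, and Danskin's theorem applies (\<open>min_value_C1\<close>). This takes place in \<open>\<real>\<^sup>4\<close>, so
  minimizing displacements never appear.

  The sign of \<open>G\<close> comes from the fact that a displacement admissible for a crack is admissible for
  every longer one (\<open>min_energy_antimono\<close>).
\<close>

section \<open>Calculus of smooth functions\<close>

lemma partial_deriv_eq:
  assumes "(f has_derivative D) (at x)"
  shows "partial_deriv b f x = D b"
  using frechet_derivative_at[OF assms] by (simp add: partial_deriv_def)

lemma has_derivative_frechet:
  assumes "f differentiable (at x)"
  shows "(f has_derivative frechet_derivative f (at x)) (at x)"
  using assms frechet_derivative_works by blast

lemma C_k_SucD: "C_k (Suc k) f \<Longrightarrow> C_k k f"
proof (induction k arbitrary: f)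
  case 0
  then show ?case
    by (auto simp: continuous_on_eq_continuous_at intro: differentiable_imp_continuous_within)
next
  case (Suc k)
  then show ?case by (metis C_k.simps(2))
qed

lemma C_k_const: "C_k k (\<lambda>x::'a::euclidean_space. c)"
proof (induction k arbitrary: c)
  case (Suc k)
  have "partial_deriv b (\<lambda>x::'a. c) = (\<lambda>x. 0)" for b
    by (rule ext, subst partial_deriv_eq[where D = "\<lambda>_. 0"]) auto
  with Suc show ?case by simp
qed simp

lemma C_k_add:
  "C_k k f \<Longrightarrow> C_k k g \<Longrightarrow> C_k k (\<lambda>x. f x + g x)"
proof (induction k arbitrary: f g)
  case (Suc k)
  have d: "f differentiable (at x)" "g differentiable (at x)" for x using Suc.prems by auto
  have "partial_deriv b (\<lambda>x. f x + g x) = (\<lambda>x. partial_deriv b f x + partial_deriv b g x)" for b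
    by (rule ext, subst partial_deriv_eq[OF has_derivative_add[OF d[THEN has_derivative_frechet]]])
       (simp add: partial_deriv_def)
  with Suc d show ?case by (auto intro: differentiable_add)
qed (auto intro: continuous_intros)

lemma C_k_mult:
  fixes f g :: "'a::euclidean_space \<Rightarrow> real"
  shows "C_k k f \<Longrightarrow> C_k k g \<Longrightarrow> C_k k (\<lambda>x. f x * g x)"
proof (induction k arbitrary: f g)
  case (Suc k)
  have d: "f differentiable (at x)" "g differentiable (at x)" for x using Suc.prems by auto
  have "partial_deriv b (\<lambda>x. f x * g x) = (\<lambda>x. f x * partial_deriv b g x + partial_deriv b f x * g x)" for b
    by (rule ext, subst partial_deriv_eq[OF has_derivative_mult[OF d[THEN has_derivative_frechet]]])
       (simp add: partial_deriv_def)
  with Suc.prems d C_k_SucD[OF Suc.prems(1)] C_k_SucD[OF Suc.prems(2)] show ?case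
    by (auto intro!: differentiable_mult C_k_add Suc.IH)
qed (auto intro: continuous_intros)

lemma C_k_linear:
  assumes "bounded_linear f"
  shows "C_k k f"
proof (cases k)
  case 0
  then show ?thesis using assms by (simp add: linear_continuous_on)
next
  case (Suc j)
  have "(f has_derivative f) (at x)" for x
    using assms by (simp add: bounded_linear_imp_has_derivative)
  then have "partial_deriv b f = (\<lambda>_. f b)" for b by (auto simp: partial_deriv_eq)
  moreover have "f differentiable (at x)" for x
    using assms bounded_linear_imp_differentiable by blast
  ultimately show ?thesis using Suc by (simp add: C_k_const)
qed

lemma C_k_real_SucI:
  fixes h :: "real \<Rightarrow> real"
  assumes "\<And>x. (h has_real_derivative h' x) (at x)" and "C_k k h'"
  shows "C_k (Suc k) h"
proof -
  have "partial_deriv 1 h = h'"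
    by (rule ext, subst partial_deriv_eq[OF assms(1)[unfolded has_field_derivative_def]]) simp
  with assms show ?thesis
    by (auto simp: differentiable_def has_field_derivative_def)
qed

lemma C_k_real_SucD:
  fixes h :: "real \<Rightarrow> real"
  assumes "C_k (Suc k) h" and "\<And>x. (h has_real_derivative h' x) (at x)"
  shows "C_k k h'"
proof -
  have "partial_deriv 1 h = h'"
    by (rule ext, subst partial_deriv_eq[OF assms(2)[unfolded has_field_derivative_def]]) simp
  with assms show ?thesis by auto
qed

lemma C_k_real_deriv:
  fixes h :: "real \<Rightarrow> real"
  assumes "C_k (Suc k) h"
  shows "(h has_real_derivative partial_deriv 1 h x) (at x)"
proof -
  have "h differentiable (at x)" using assms by simp
  then obtain D where D: "(h has_real_derivative D) (at x)"
    using real_differentiable_def by blast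
  then show ?thesis using partial_deriv_eq[OF D[unfolded has_field_derivative_def], of 1] by simp
qed

lemma has_derivative_stretched:
  fixes \<psi> :: "real \<times> real \<Rightarrow> real"
  assumes "\<psi> differentiable (at (h (fst x), snd x))" and "(h has_real_derivative h') (at (fst x))"
  shows "((\<lambda>x. \<psi> (h (fst x), snd x)) has_derivative
      (\<lambda>v. frechet_derivative \<psi> (at (h (fst x), snd x)) (h' * fst v, snd v))) (at x)"
proof -
  have a: "((\<lambda>x::real\<times>real. h (fst x)) has_derivative (\<lambda>v. h' * fst v)) (at x)"
    using has_derivative_compose[OF has_derivative_fst[OF has_derivative_ident] assms(2)[unfolded has_field_derivative_def]]
    by simp
  have "((\<lambda>x. (h (fst x), snd x)) has_derivative (\<lambda>v. (h' * fst v, snd v))) (at x)"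
    by (rule has_derivative_Pair[OF a]) (rule has_derivative_snd[OF has_derivative_ident])
  from has_derivative_compose[OF this has_derivative_frechet[OF assms(1)]]
  show ?thesis .
qed

lemma partial_deriv_stretched:
  fixes \<psi> :: "real \<times> real \<Rightarrow> real"
  assumes "\<psi> differentiable (at (h (fst x), snd x))" and "(h has_real_derivative h') (at (fst x))"
  shows "partial_deriv (1, 0) (\<lambda>x. \<psi> (h (fst x), snd x)) x = h' * partial_deriv (1, 0) \<psi> (h (fst x), snd x)"
    and "partial_deriv (0, 1) (\<lambda>x. \<psi> (h (fst x), snd x)) x = partial_deriv (0, 1) \<psi> (h (fst x), snd x)"
proof -
  have lin: "linear (frechet_derivative \<psi> (at (h (fst x), snd x)))"
    using assms(1) by (simp add: linear_frechet_derivative)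
  have "frechet_derivative \<psi> (at (h (fst x), snd x)) (h' *\<^sub>R (1, 0)) =
      h' * frechet_derivative \<psi> (at (h (fst x), snd x)) (1, 0)"
    using linear_scale[OF lin, of h' "(1, 0)"] by simp
  then show "partial_deriv (1, 0) (\<lambda>x. \<psi> (h (fst x), snd x)) x = h' * partial_deriv (1, 0) \<psi> (h (fst x), snd x)"
    and "partial_deriv (0, 1) (\<lambda>x. \<psi> (h (fst x), snd x)) x = partial_deriv (0, 1) \<psi> (h (fst x), snd x)"
    unfolding partial_deriv_eq[OF has_derivative_stretched[OF assms]] by (simp_all add: partial_deriv_def)
qed

lemma Basis_real2: "(Basis :: (real \<times> real) set) = {(1, 0), (0, 1)}"
  by (auto simp: Basis_prod_def)

lemma C_k_fst:
  fixes h :: "real \<Rightarrow> real"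
  shows "C_k k h \<Longrightarrow> C_k k (\<lambda>x::real\<times>real. h (fst x))"
proof (induction k arbitrary: h)
  case 0
  then show ?case
    by (auto intro!: continuous_intros continuous_on_compose2[of UNIV h])
next
  case (Suc k)
  have d: "((\<lambda>x::real\<times>real. h (fst x)) has_derivative (\<lambda>v. partial_deriv 1 h (fst x) * fst v)) (at x)" for x
    by (rule has_derivative_compose[OF has_derivative_fst[OF has_derivative_ident]
        C_k_real_deriv[OF Suc.prems, unfolded has_field_derivative_def]])
  have "partial_deriv (1, 0) (\<lambda>x::real\<times>real. h (fst x)) = (\<lambda>x. partial_deriv 1 h (fst x))"
    "partial_deriv (0, 1) (\<lambda>x::real\<times>real. h (fst x)) = (\<lambda>x. 0)"
    by (simp_all add: fun_eq_iff partial_deriv_eq[OF d])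
  moreover have "C_k k (\<lambda>x::real\<times>real. partial_deriv 1 h (fst x))"
    using Suc by simp
  moreover have "(\<lambda>x::real\<times>real. h (fst x)) differentiable (at x)" for x
    using d differentiable_def by blast
  ultimately show ?case by (simp add: Basis_real2 C_k_const)
qed

lemma C_k_stretched:
  fixes \<psi> :: "real \<times> real \<Rightarrow> real" and h :: "real \<Rightarrow> real"
  shows "C_k k \<psi> \<Longrightarrow> C_k k h \<Longrightarrow> C_k k (\<lambda>x. \<psi> (h (fst x), snd x))"
proof (induction k arbitrary: \<psi>)
  case 0
  then show ?case
    by (auto intro!: continuous_intros continuous_on_compose2[of UNIV \<psi>] continuous_on_compose2[of UNIV h])
next
  case (Suc k)
  note h = C_k_real_deriv[OF Suc.prems(2)]
  have \<psi>: "\<psi> differentiable (at x)" for x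
    using Suc.prems(1) unfolding C_k.simps by blast
  have "C_k k (\<lambda>x. partial_deriv 1 h (fst x) * partial_deriv (1, 0) \<psi> (h (fst x), snd x))"
    using Suc.prems(1) Basis_real2 C_k_SucD[OF Suc.prems(2)] Suc.prems(2)
    by (intro C_k_mult C_k_fst Suc.IH) auto
  moreover have "C_k k (\<lambda>x. partial_deriv (0, 1) \<psi> (h (fst x), snd x))"
    using Suc.prems(1) Basis_real2 C_k_SucD[OF Suc.prems(2)] by (intro Suc.IH) auto
  moreover have "(\<lambda>x. \<psi> (h (fst x), snd x)) differentiable (at x)" for x
    using has_derivative_stretched[OF \<psi> h] differentiable_def by blast
  moreover have "partial_deriv (1, 0) (\<lambda>x. \<psi> (h (fst x), snd x)) =
      (\<lambda>x. partial_deriv 1 h (fst x) * partial_deriv (1, 0) \<psi> (h (fst x), snd x))"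
    by (rule ext) (rule partial_deriv_stretched(1)[OF \<psi> h])
  moreover have "partial_deriv (0, 1) (\<lambda>x. \<psi> (h (fst x), snd x)) =
      (\<lambda>x. partial_deriv (0, 1) \<psi> (h (fst x), snd x))"
    by (rule ext) (rule partial_deriv_stretched(2)[OF \<psi> h])
  ultimately show ?case by (simp add: Basis_real2)
qed

lemma soft_abs_pos: "0 < e \<Longrightarrow> 0 < z\<^sup>2 + e\<^sup>2" for z e :: real
  by (simp add: add_nonneg_pos)

lemma abs_le_soft_abs: "\<bar>z\<bar> \<le> sqrt (z\<^sup>2 + e\<^sup>2)" for z e :: real
  by (metis le_add_same_cancel1 real_sqrt_abs real_sqrt_le_mono zero_le_power2)

lemma soft_abs_deriv:
  fixes e :: real
  assumes "0 < e"
  shows "((\<lambda>z. sqrt (z\<^sup>2 + e\<^sup>2)) has_real_derivative z / sqrt (z\<^sup>2 + e\<^sup>2)) (at z)"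
  using soft_abs_pos[OF assms, of z]
  by (auto intro!: derivative_eq_intros simp: field_simps)

text \<open>The function \<open>r = 1 / sqrt (z\<^sup>2 + e\<^sup>2)\<close> satisfies \<open>r' = - z r\<^sup>3\<close>, so each further
  derivative is a polynomial in \<open>z\<close> and \<open>r\<close>; this closes the induction on the order.\<close>

lemma soft_abs_smooth:
  fixes e :: real
  assumes "0 < e"
  shows "C_k k (\<lambda>z. sqrt (z\<^sup>2 + e\<^sup>2))"
proof -
  have id: "C_k k (\<lambda>z::real. z)" for k by (rule C_k_linear) (rule bounded_linear_ident)
  have inv: "C_k k (\<lambda>z. 1 / sqrt (z\<^sup>2 + e\<^sup>2))" for k
  proof (induction k)
    case 0
    have "sqrt (z\<^sup>2 + e\<^sup>2) \<noteq> 0" for z using soft_abs_pos[OF assms, of z] by (metis real_sqrt_eq_0_iff less_irrefl)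
    then show ?case unfolding C_k.simps by (intro continuous_intros ballI)
  next
    case (Suc k)
    let ?r = "\<lambda>z. 1 / sqrt (z\<^sup>2 + e\<^sup>2)"
    show ?case
    proof (rule C_k_real_SucI)
      fix z
      have p: "0 < z\<^sup>2 + e\<^sup>2" using soft_abs_pos[OF assms, of z] .
      show "(?r has_real_derivative (- 1) * (z * (?r z * (?r z * ?r z)))) (at z)"
        using p by (auto intro!: derivative_eq_intros soft_abs_deriv[OF assms] simp: field_simps)
      show "C_k k (\<lambda>z. (- 1) * (z * (?r z * (?r z * ?r z))))"
        by (intro C_k_mult Suc id C_k_const)
    qed
  qed
  show ?thesis
  proof (cases k)
    case 0
    then show ?thesis by (auto intro!: continuous_intros)
  next
    case (Suc j)
    have "C_k j (\<lambda>z. z * (1 / sqrt (z\<^sup>2 + e\<^sup>2)))" by (intro C_k_mult id inv)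
    then show ?thesis unfolding Suc using soft_abs_deriv[OF assms]
      by (intro C_k_real_SucI[where h' = "\<lambda>z. z * (1 / sqrt (z\<^sup>2 + e\<^sup>2))"]) auto
  qed
qed

lemma soft_abs_close:
  fixes e :: real
  assumes "0 < e"
  shows "\<bar>sqrt (z\<^sup>2 + e\<^sup>2) - \<bar>z\<bar>\<bar> \<le> e"
proof -
  have "\<bar>z\<bar> \<le> sqrt (z\<^sup>2 + e\<^sup>2)" by (rule abs_le_soft_abs)
  moreover have "sqrt (z\<^sup>2 + e\<^sup>2) \<le> \<bar>z\<bar> + e"
    using sqrt_add_le_add_sqrt[of "z\<^sup>2" "e\<^sup>2"] assms by simp
  ultimately show ?thesis by simp
qed

lemma soft_sgn_le_1:
  fixes e :: real
  assumes "0 < e"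
  shows "\<bar>z / sqrt (z\<^sup>2 + e\<^sup>2)\<bar> \<le> 1"
proof -
  have "\<bar>z\<bar> \<le> sqrt (z\<^sup>2 + e\<^sup>2)" by (rule abs_le_soft_abs)
  then show ?thesis using soft_abs_pos[OF assms, of z] by (simp add: abs_div)
qed

lemma soft_sgn_tendsto:
  assumes "z \<noteq> (0::real)"
  shows "(\<lambda>k. z / sqrt (z\<^sup>2 + (inverse (real (Suc k)))\<^sup>2)) \<longlonglongrightarrow> sgn z"
proof -
  have "(\<lambda>k. z / sqrt (z\<^sup>2 + (inverse (real (Suc k)))\<^sup>2)) \<longlonglongrightarrow> z / sqrt (z\<^sup>2 + 0\<^sup>2)"
    using assms by (intro tendsto_intros LIMSEQ_inverse_real_of_nat) auto
  moreover have "z / sqrt (z\<^sup>2 + 0\<^sup>2) = sgn z" using assms by (auto simp: sgn_if)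
  ultimately show ?thesis by metis
qed

section \<open>Stretching the horizontal coordinate\<close>

text \<open>These are the conditions under which an identity for smooth changes of variable
  passes to the limit by dominated convergence. The exceptional set \<open>F\<close> is a parameter because
  the derivative of the layered energy is needed at every point off the interfaces.\<close>

inductive smooth_approx :: "real set \<Rightarrow> (real \<Rightarrow> real) \<Rightarrow> (real \<Rightarrow> real) \<Rightarrow> bool"
  for F f f' where
  smooth_approxI: "finite F \<Longrightarrow> (\<And>x. x \<notin> F \<Longrightarrow> (f has_real_derivative f' x) (at x)) \<Longrightarrow>
    (\<And>k j. C_k j (h k)) \<Longrightarrow> (\<And>k x. (h k has_real_derivative h' k x) (at x)) \<Longrightarrow>
    (\<And>k x. \<bar>h k x - f x\<bar> \<le> M / real (Suc k)) \<Longrightarrow> (\<And>k x. \<bar>h' k x\<bar> \<le> M) \<Longrightarrow>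
    (\<And>x. x \<notin> F \<Longrightarrow> (\<lambda>k. h' k x) \<longlonglongrightarrow> f' x) \<Longrightarrow> smooth_approx F f f'"

lemma smooth_approxD:
  assumes "smooth_approx F f f'"
  shows "finite F" "x \<notin> F \<Longrightarrow> (f has_real_derivative f' x) (at x)"
  using assms by (auto elim: smooth_approx.cases)

definition stretch :: "(real \<Rightarrow> real) \<Rightarrow> real \<times> real \<Rightarrow> real \<times> real" where
  "stretch f x = (f (fst x), snd x)"

text \<open>The two inverse maps enter symmetrically, so that every result also holds for the
  inverse stretch (\<open>swap\<close>). The functions \<open>f'\<close> and \<open>g'\<close> are the derivatives off finite sets;
  their values there are arbitrary within the bounds.\<close>

locale stretching =
  fixes f f' g g' :: "real \<Rightarrow> real" and m M :: real
  assumes approx: "\<exists>F. smooth_approx F f f'" "\<exists>F. smooth_approx F g g'"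
    and inverse: "g (f x) = x" "f (g x) = x"
    and mono: "strict_mono f"
    and cont: "continuous_on UNIV f" "continuous_on UNIV g"
    and meas: "f' \<in> borel_measurable borel" "g' \<in> borel_measurable borel"
    and bounds: "0 < m" "m \<le> f' x" "f' x \<le> M" "m \<le> g' x" "g' x \<le> M"
begin

lemma swap: "stretching g g' f f' m M"
proof
  show "strict_mono g"
    using mono inverse by (metis strict_mono_def strict_mono_less)
qed (use approx inverse cont meas bounds in auto)

lemma less_iff: "f x < y \<longleftrightarrow> x < g y" "y < f x \<longleftrightarrow> g y < x"
  using mono inverse by (metis strict_mono_less)+

text \<open>By the fundamental theorem of calculus both measures give an interval its length.\<close>

lemma distr_line: "distr (density lborel (\<lambda>x. ennreal (f' x))) borel f = lborel"
proof (rule lborel_eqI[symmetric])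
  note [measurable] = meas borel_measurable_continuous_onI[OF cont(1)]
  fix l u :: real
  assume "\<And>b. b \<in> Basis \<Longrightarrow> l \<bullet> b \<le> u \<bullet> b"
  then have lu: "l \<le> u" by simp
  obtain F where F: "finite F" "\<And>x. x \<notin> F \<Longrightarrow> (f has_real_derivative f' x) (at x)"
    using approx(1) smooth_approxD by metis
  have "g l \<le> g u" using stretching.mono[OF swap] lu by (simp add: strict_mono_less_eq)
  then have "(f' has_integral f (g u) - f (g l)) {g l..g u}"
    using F cont(1) by (intro fundamental_theorem_of_calculus_interior_strong[of F])
      (auto simp: has_real_derivative_iff_has_vector_derivative intro: continuous_on_subset)
  then have I: "(f' has_integral (u - l)) {g l..g u}" by (simp add: inverse)
  have "(\<integral>\<^sup>+x. ennreal (f' x) * indicator (f -` box l u) x \<partial>lborel) =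
      (\<integral>\<^sup>+x. ennreal (indicator {g l..g u} x * f' x) \<partial>lborel)"
  proof (rule nn_integral_cong_AE)
    have "AE x in lborel. x \<notin> {g l, g u}" by (intro AE_not_in) (auto intro!: countable_imp_null_set_lborel)
    then show "AE x in lborel. ennreal (f' x) * indicator (f -` box l u) x = ennreal (indicator {g l..g u} x * f' x)"
      by eventually_elim (auto simp: indicator_def less_iff box_real)
  qed
  also have "\<dots> = ennreal (u - l)"
    using I meas(1) bounds by (intro nn_integral_has_integral_lebesgue) (auto intro: order_trans[of 0 m])
  moreover have "f -` box l u \<in> sets borel"
    using measurable_sets[OF borel_measurable_continuous_onI[OF cont(1)], of "box l u"] by simp
  ultimately show "emeasure (distr (density lborel (\<lambda>x. ennreal (f' x))) borel f) (box l u) =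
      ennreal (\<Prod>b\<in>Basis. (u - l) \<bullet> b)"
    by (simp add: emeasure_distr emeasure_density)
qed simp

abbreviation w :: "real \<times> real \<Rightarrow> ennreal" where
  "w \<equiv> \<lambda>x. ennreal (f' (fst x))"

lemma measurable_stretch_borel: "stretch f \<in> borel \<rightarrow>\<^sub>M borel"
  unfolding stretch_def[abs_def] borel_prod[symmetric]
  using borel_measurable_continuous_onI[OF cont(1)] by measurable

lemma distr_lborel: "distr (density lborel w) borel (stretch f) = lborel"
proof -
  note [measurable] = meas borel_measurable_continuous_onI[OF cont(1)]
  have "lborel = (lborel \<Otimes>\<^sub>M lborel :: (real \<times> real) measure)" by (simp add: lborel_prod)
  also have "\<dots> = distr (density lborel (\<lambda>x. ennreal (f' x))) borel f \<Otimes>\<^sub>M distr (density lborel (\<lambda>_. 1)) borel (\<lambda>x. x)"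
    by (simp add: distr_line density_1 distr_id2)
  also have "\<dots> = distr (density lborel (\<lambda>x. ennreal (f' x)) \<Otimes>\<^sub>M density lborel (\<lambda>_. 1)) (borel \<Otimes>\<^sub>M borel)
       (\<lambda>(x, y). (f x, y))"
    by (intro pair_measure_distr) (auto simp: density_1 distr_id2 intro: sigma_finite_lborel)
  also have "density lborel (\<lambda>x. ennreal (f' x)) \<Otimes>\<^sub>M density lborel (\<lambda>_. 1) = 
      density (lborel \<Otimes>\<^sub>M lborel) (\<lambda>(x::real, y::real). ennreal (f' x) * 1)"
    by (intro pair_measure_density) (auto simp: density_1 intro: sigma_finite_lborel)
  finally show ?thesis
    by (simp add: lborel_prod borel_prod stretch_def[abs_def] case_prod_unfold)
qed

lemma density_lebesgue: "density lebesgue w = completion (density lborel w)"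
proof (rule completion_density_eq[symmetric])
  show "AE x in lborel. 0 < w x" using bounds by (auto intro: less_le_trans[of 0 m])
  show "w \<in> borel_measurable lborel"
    using meas unfolding lborel_prod[symmetric] by measurable
qed

text \<open>The density is positive, so the null sets of the image measure are the Borel null
  sets, and the change of variables extends from the Borel sets to the completion.\<close>

lemma measurable_stretch_density: "stretch f \<in> density lebesgue w \<rightarrow>\<^sub>M lebesgue"
  and distr_lebesgue: "distr (density lebesgue w) lebesgue (stretch f) = lebesgue"
proof -
  have X: "stretch f \<in> density lborel w \<rightarrow>\<^sub>M lborel"
    using measurable_stretch_borel by (simp cong: measurable_cong_sets)
  interpret D: complete_measure "density lebesgue w"
    unfolding density_lebesgue by (rule completion.complete_measure_axioms)
  have X': "stretch f \<in> density lebesgue w \<rightarrow>\<^sub>M lborel"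
    unfolding density_lebesgue by (rule measurable_completion[OF X])
  have "distr (density lebesgue w) lborel (stretch f) = distr (density lborel w) lborel (stretch f)"
    unfolding density_lebesgue by (rule distr_completion[OF X])
  also have "\<dots> = distr (density lborel w) borel (stretch f)" by (rule distr_cong) auto
  finally have d: "distr (density lebesgue w) lborel (stretch f) = lborel" by (simp add: distr_lborel)
  show "stretch f \<in> density lebesgue w \<rightarrow>\<^sub>M lebesgue"
    by (rule D.measurable_completion2[OF X']) (simp add: d)
  show "distr (density lebesgue w) lebesgue (stretch f) = lebesgue"
    using D.completion_distr_eq[OF X'] by (simp add: d)
qed

lemma measurable_stretch: "stretch f \<in> lebesgue \<rightarrow>\<^sub>M lebesgue"
  using measurable_stretch_density by (simp cong: measurable_cong_sets)

lemma measurable_w: "(\<lambda>x. f' (fst x)) \<in> borel_measurable (lebesgue :: (real \<times> real) measure)"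
proof -
  have "(\<lambda>x. f' (fst x)) \<in> borel_measurable (lborel \<Otimes>\<^sub>M lborel)" using meas by measurable
  then show ?thesis unfolding lborel_prod by (rule measurable_completion)
qed

lemma
  fixes q :: "real \<times> real \<Rightarrow> real"
  assumes q: "q \<in> borel_measurable (lebesgue_on U)" and U: "U \<in> sets lebesgue"
  shows measurable_compose_stretch: "(\<lambda>x. q (stretch f x)) \<in> borel_measurable (lebesgue_on (stretch f -` U))"
    and integrable_stretch: "integrable (lebesgue_on (stretch f -` U)) (\<lambda>x. f' (fst x) * q (stretch f x)) \<longleftrightarrow>
      integrable (lebesgue_on U) q"
    and integral_stretch: "(\<integral>x. f' (fst x) * q (stretch f x) \<partial>lebesgue_on (stretch f -` U)) =
      (\<integral>x. q x \<partial>lebesgue_on U)"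
proof -
  let ?q = "\<lambda>x. indicator U x *\<^sub>R q x"
  let ?V = "stretch f -` U"
  have V: "?V \<in> sets lebesgue" using measurable_sets[OF measurable_stretch U] by simp
  have qm: "?q \<in> borel_measurable lebesgue"
    using q U by (simp add: borel_measurable_restrict_space_iff)
  have qm': "(\<lambda>x. ?q (stretch f x)) \<in> borel_measurable lebesgue"
    by (rule measurable_compose[OF measurable_stretch qm])
  have i: "indicator U (stretch f x) = (indicator ?V x :: real)" for x by (simp add: indicator_def)
  show "(\<lambda>x. q (stretch f x)) \<in> borel_measurable (lebesgue_on ?V)"
    using qm' V by (simp add: borel_measurable_restrict_space_iff i)
  have f0: "0 \<le> f' (fst x)" for x using bounds by (meson less_imp_le order_trans)
  have "integrable (lebesgue_on U) q \<longleftrightarrow> integrable lebesgue ?q"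
    using U by (simp add: integrable_restrict_space)
  also have "\<dots> \<longleftrightarrow> integrable (distr (density lebesgue w) lebesgue (stretch f)) ?q"
    by (simp add: distr_lebesgue)
  also have "\<dots> \<longleftrightarrow> integrable (density lebesgue w) (\<lambda>x. ?q (stretch f x))"
    by (rule integrable_distr_eq[OF measurable_stretch_density qm])
  also have "\<dots> \<longleftrightarrow> integrable lebesgue (\<lambda>x. f' (fst x) *\<^sub>R ?q (stretch f x))"
    using f0 by (intro integrable_density qm' measurable_w) auto
  also have "\<dots> \<longleftrightarrow> integrable (lebesgue_on ?V) (\<lambda>x. f' (fst x) * q (stretch f x))"
    using V by (simp add: integrable_restrict_space i mult.left_commute)
  finally show "integrable (lebesgue_on ?V) (\<lambda>x. f' (fst x) * q (stretch f x)) \<longleftrightarrow> integrable (lebesgue_on U) q" ..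
  have "(\<integral>x. q x \<partial>lebesgue_on U) = (\<integral>x. ?q x \<partial>lebesgue)"
    using U by (simp add: integral_restrict_space)
  also have "\<dots> = (\<integral>x. ?q x \<partial>distr (density lebesgue w) lebesgue (stretch f))"
    by (simp add: distr_lebesgue)
  also have "\<dots> = (\<integral>x. ?q (stretch f x) \<partial>density lebesgue w)"
    by (rule integral_distr[OF measurable_stretch_density qm])
  also have "\<dots> = (\<integral>x. f' (fst x) *\<^sub>R ?q (stretch f x) \<partial>lebesgue)"
    using f0 by (intro integral_density qm' measurable_w) auto
  also have "\<dots> = (\<integral>x. f' (fst x) * q (stretch f x) \<partial>lebesgue_on ?V)"
    using V by (simp add: integral_restrict_space i mult.left_commute)
  finally show "(\<integral>x. f' (fst x) * q (stretch f x) \<partial>lebesgue_on ?V) = (\<integral>x. q x \<partial>lebesgue_on U)" ..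
qed

end

lemma borel_imp_lebesgue_on: "q \<in> borel_measurable borel \<Longrightarrow> q \<in> borel_measurable (lebesgue_on U)"
  for q :: "'a::euclidean_space \<Rightarrow> 'b::euclidean_space"
  by (simp add: measurable_completion measurable_restrict_space1)

lemma AE_fst_notin:
  assumes "finite F" and "U \<in> sets lebesgue"
  shows "AE x in lebesgue_on U. fst (x :: real \<times> real) \<notin> F"
proof -
  have "negligible {x :: real \<times> real. x \<bullet> (1, 0) = c}" for c
    by (intro negligible_standard_hyperplane) (simp add: Basis_prod_def)
  then have "negligible (\<Union>c\<in>F. {x :: real \<times> real. x \<bullet> (1, 0) = c})"
    using assms by (intro negligible_Union) auto
  then have "AE x in lebesgue. x \<notin> (\<Union>c\<in>F. {x :: real \<times> real. x \<bullet> (1, 0) = c})"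
    by (intro AE_not_in) (simp add: negligible_iff_null_sets)
  then have "AE x in lebesgue. fst (x :: real \<times> real) \<notin> F"
    by eventually_elim (auto simp: inner_prod_def)
  then show ?thesis
    using assms(2) by (simp add: AE_restrict_space_iff) (auto elim: eventually_mono)
qed

lemma integrable_L2_on:
  assumes "L2_on U q" and "U \<in> lmeasurable"
  shows "integrable (lebesgue_on U) q"
proof (rule Bochner_Integration.integrable_bound)
  have "integrable (lebesgue_on U) (\<lambda>x. 1::real)"
    using finite_measure_lebesgue_on[OF assms(2)] by (intro finite_measure.integrable_const)
  then show "integrable (lebesgue_on U) (\<lambda>x. 1 + (norm (q x))\<^sup>2)"
    using assms(1) by (auto simp: L2_on_def)
  show "q \<in> borel_measurable (lebesgue_on U)" using assms(1) by (simp add: L2_on_def)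
  have "norm (q x) \<le> 1 + (norm (q x))\<^sup>2" for x
  proof -
    have "0 \<le> (1 - norm (q x))\<^sup>2" by simp
    then have "2 * norm (q x) \<le> 1 + (norm (q x))\<^sup>2" by (simp add: power2_diff)
    then show ?thesis using norm_ge_zero[of "q x"] by linarith
  qed
  then show "AE x in lebesgue_on U. norm (q x) \<le> norm (1 + (norm (q x))\<^sup>2)" by auto
qed

lemma integral_mult_bounded_tendsto:
  fixes p :: "'a \<Rightarrow> real"
  assumes "integrable M p" and "\<And>k. q k \<in> borel_measurable M" and "q' \<in> borel_measurable M"
    and "\<And>k x. \<bar>q k x\<bar> \<le> B" and "AE x in M. (\<lambda>k. q k x) \<longlonglongrightarrow> q' x"
  shows "(\<lambda>k. \<integral>x. p x * q k x \<partial>M) \<longlonglongrightarrow> (\<integral>x. p x * q' x \<partial>M)"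
proof (rule integral_dominated_convergence)
  have [measurable]: "p \<in> borel_measurable M" using assms(1) by simp
  note [measurable] = assms(2,3)
  show "(\<lambda>x. p x * q' x) \<in> borel_measurable M" "(\<lambda>x. p x * q k x) \<in> borel_measurable M" for k
    by measurable
  show "integrable M (\<lambda>x. \<bar>p x\<bar> * B)" using assms(1) by simp
  show "AE x in M. (\<lambda>k. p x * q k x) \<longlonglongrightarrow> p x * q' x"
    using assms(5) by eventually_elim (intro tendsto_intros)
  show "AE x in M. norm (p x * q k x) \<le> \<bar>p x\<bar> * B" for k
    using assms(4) by (simp add: abs_mult mult_left_mono)
qed

lemma test_function_zero:
  assumes "compact K" "\<And>x. x \<notin> K \<Longrightarrow> \<psi> x = 0" "x \<notin> K"
  shows "partial_deriv b \<psi> x = 0"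
proof -
  have "(\<psi> has_derivative (\<lambda>_. 0)) (at x)"
  proof (rule has_derivative_transform_within_open)
    show "((\<lambda>_. 0::real) has_derivative (\<lambda>_. 0)) (at x)" by simp
    show "open (- K)" using compact_imp_closed[OF assms(1)] by (simp add: open_Compl)
  qed (use assms(2,3) in auto)
  then show ?thesis by (simp add: partial_deriv_eq)
qed

lemma test_function_bounded:
  assumes "\<psi> \<in> test_functions U"
  obtains B where "\<And>x. \<bar>\<psi> x\<bar> \<le> B" and "\<And>b x. b \<in> Basis \<Longrightarrow> \<bar>partial_deriv b \<psi> x\<bar> \<le> B"
proof -
  obtain K where K: "compact K" "\<And>x. x \<notin> K \<Longrightarrow> \<psi> x = 0" and C: "\<And>k. C_k k \<psi>"
    using assms by (auto simp: test_functions_def)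
  have bd: "\<exists>B. \<forall>x. \<bar>q x\<bar> \<le> B" if "continuous_on UNIV q" "\<And>x. x \<notin> K \<Longrightarrow> q x = 0" for q :: "'a \<Rightarrow> real"
  proof -
    have "bounded (q ` K)"
      using compact_continuous_image[OF continuous_on_subset[OF that(1)] K(1)] compact_imp_bounded by auto
    then obtain B where "\<forall>x\<in>K. \<bar>q x\<bar> \<le> B" by (auto simp: bounded_iff)
    then have "\<bar>q x\<bar> \<le> \<bar>B\<bar>" for x using that(2)[of x] by (cases "x \<in> K") fastforce+
    then show ?thesis by blast
  qed
  have z: "partial_deriv b \<psi> x = 0" if "x \<notin> K" for b x
    using K that by (rule test_function_zero)
  have c: "continuous_on UNIV (partial_deriv b \<psi>)" if "b \<in> Basis" for b
    using C[of "Suc 0"] that by simp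
  have "\<exists>B. \<forall>x. \<bar>partial_deriv b \<psi> x\<bar> \<le> B" if "b \<in> Basis" for b using bd[OF c[OF that] z] by blast
  then obtain D where D: "\<And>b x. b \<in> Basis \<Longrightarrow> \<bar>partial_deriv b \<psi> x\<bar> \<le> D b" by metis
  obtain B where B: "\<And>x. \<bar>\<psi> x\<bar> \<le> B" using bd[of \<psi>] C[of 0] K(2) by auto
  let ?B = "Max (insert B (D ` Basis))"
  show thesis
  proof (rule that[of ?B])
    show "\<bar>\<psi> x\<bar> \<le> ?B" for x using B[of x] by (rule order_trans) auto
    show "\<bar>partial_deriv b \<psi> x\<bar> \<le> ?B" if "b \<in> Basis" for b x
      using D[OF that, of x] by (rule order_trans) (intro Max_ge; use that in auto)
  qed
qed

context stretching
begin

lemma continuous_stretch: "continuous_on UNIV (stretch f)"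
  unfolding stretch_def[abs_def]
  by (intro continuous_intros continuous_on_compose2[OF cont(1)]) auto

lemma stretch_inverse: "stretch g (stretch f x) = x" "stretch f (stretch g x) = x"
  by (simp_all add: stretch_def inverse)

lemma vimage_vimage: "stretch g -` (stretch f -` U) = U"
  by (simp add: vimage_def stretch_inverse)

lemma open_vimage_stretch: "open U \<Longrightarrow> open (stretch f -` U)"
  using continuous_stretch by (rule open_vimage[rotated])

text \<open>This is the chain rule for \<open>f (g y) = y\<close>; it may fail only at the kinks of \<open>g\<close> and
  at the points that \<open>g\<close> maps to kinks of \<open>f\<close>.\<close>

lemma deriv_product: "\<exists>F. finite F \<and> (\<forall>y. y \<notin> F \<longrightarrow> g' y * f' (g y) = 1)"
proof -
  obtain F where F: "finite F" "\<And>x. x \<notin> F \<Longrightarrow> (f has_real_derivative f' x) (at x)"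
    using approx(1) smooth_approxD by metis
  obtain E where E: "finite E" "\<And>x. x \<notin> E \<Longrightarrow> (g has_real_derivative g' x) (at x)"
    using approx(2) smooth_approxD by metis
  have "g' y * f' (g y) = 1" if "y \<notin> E \<union> f ` F" for y
  proof -
    have "g y \<notin> F" using that inverse(2)[of y] by (metis UnI2 image_eqI)
    then have "((\<lambda>y. f (g y)) has_real_derivative f' (g y) * g' y) (at y)"
      using that E(2) F(2) by (intro DERIV_chain2) auto
    moreover have "((\<lambda>y. f (g y)) has_real_derivative 1) (at y)" by (simp add: inverse)
    ultimately show ?thesis using DERIV_unique by (metis mult.commute)
  qed
  then show ?thesis using E(1) F(1) by (intro exI[of _ "E \<union> f ` F"]) auto
qed

lemma
  fixes q :: "real \<times> real \<Rightarrow> real"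
  assumes q: "integrable (lebesgue_on U) q" "\<And>x. 0 \<le> q x" and U: "U \<in> sets lebesgue"
  shows integrable_stretch_nonneg: "integrable (lebesgue_on (stretch f -` U)) (\<lambda>x. q (stretch f x))"
    and integral_stretch_le: "(\<integral>x. q (stretch f x) \<partial>lebesgue_on (stretch f -` U)) \<le>
      (\<integral>x. q x \<partial>lebesgue_on U) / m"
proof -
  have qm: "q \<in> borel_measurable (lebesgue_on U)" using q by simp
  have i: "integrable (lebesgue_on (stretch f -` U)) (\<lambda>x. f' (fst x) * q (stretch f x))"
    using integrable_stretch[OF qm U] q by simp
  have le: "q (stretch f x) \<le> f' (fst x) * q (stretch f x) / m" for x
    using bounds(1) bounds(2)[of "fst x"] q(2)[of "stretch f x"]
    by (simp add: pos_le_divide_eq mult.commute[of _ m] mult_right_mono)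
  show i': "integrable (lebesgue_on (stretch f -` U)) (\<lambda>x. q (stretch f x))"
  proof (rule Bochner_Integration.integrable_bound[OF integrable_divide[OF i, of m]
        measurable_compose_stretch[OF qm U]])
    have "norm (q (stretch f x)) \<le> norm (f' (fst x) * q (stretch f x) / m)" for x
      using le[of x] q(2)[of "stretch f x"] by (simp only: real_norm_def abs_of_nonneg)
    then show "AE x in lebesgue_on (stretch f -` U). norm (q (stretch f x)) \<le>
        norm (f' (fst x) * q (stretch f x) / m)" by simp
  qed
  have "(\<integral>x. q (stretch f x) \<partial>lebesgue_on (stretch f -` U)) \<le>
      (\<integral>x. f' (fst x) * q (stretch f x) / m \<partial>lebesgue_on (stretch f -` U))"
    by (rule integral_mono[OF i' integrable_divide[OF i]]) (rule le)
  then show "(\<integral>x. q (stretch f x) \<partial>lebesgue_on (stretch f -` U)) \<le> (\<integral>x. q x \<partial>lebesgue_on U) / m"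
    using integral_stretch[OF qm U] by simp
qed

end

section \<open>Weak gradients and traces under a stretch\<close>

lemma eq_neg_limI:
  fixes x y :: real
  assumes "a \<longlonglongrightarrow> x" "b \<longlonglongrightarrow> y" "\<forall>\<^sub>F k in sequentially. a k = - b k"
  shows "x = - y"
proof -
  have "a \<longlonglongrightarrow> - y"
    using tendsto_cong[OF assms(3)] tendsto_minus[OF assms(2)] by blast
  then show ?thesis using LIMSEQ_unique assms(1) by blast
qed

context stretching
begin

text \<open>For a test function \<open>\<psi>\<close> on the stretched domain with support \<open>K\<close>, this makes the
  composition with \<open>h k\<close>, a smooth approximation of \<open>g\<close>, a test function on \<open>U\<close> for large \<open>k\<close>:
  its support lies in the image of a small compact neighbourhood of \<open>K\<close>.\<close>

lemma test_function_stretched_support: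
  assumes U: "open U" and K: "compact K" "K \<subseteq> stretch f -` U"
    and h: "\<And>k x. \<bar>h k x - g x\<bar> \<le> C / real (Suc k)"
  obtains N K' where "compact K'" "K' \<subseteq> U"
    "\<And>k y. N \<le> k \<Longrightarrow> y \<notin> K' \<Longrightarrow> stretch (h k) y \<notin> K"
proof -
  obtain e where e: "e > 0" "(\<Union>x\<in>K. cball x e) \<subseteq> stretch f -` U"
    using compact_subset_open_imp_cball_epsilon_subset[OF K(1) open_vimage_stretch[OF U] K(2)] by blast
  let ?K = "{x + y | x y. x \<in> K \<and> y \<in> cball 0 e}"
  have Ksub: "?K \<subseteq> stretch f -` U"
  proof
    fix z assume "z \<in> ?K"
    then obtain x y where "z = x + y" "x \<in> K" "norm y \<le> e" by auto
    then have "z \<in> (\<Union>x\<in>K. cball x e)" by (intro UN_I[of x]) (auto simp: dist_norm)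
    then show "z \<in> stretch f -` U" using e(2) by blast
  qed
  obtain N where N: "C / e < real N" using reals_Archimedean2 by blast
  show thesis
  proof (rule that[of "stretch f ` ?K" N])
    show "compact (stretch f ` ?K)"
      by (rule compact_continuous_image[OF continuous_on_subset[OF continuous_stretch subset_UNIV]
            compact_sums[OF K(1) compact_cball]])
    show "stretch f ` ?K \<subseteq> U" using Ksub by blast
    fix k y assume k: "N \<le> k" and y: "y \<notin> stretch f ` ?K"
    show "stretch (h k) y \<notin> K"
    proof
      assume a: "stretch (h k) y \<in> K"
      have "C < e * real N" using N e(1) by (simp add: pos_divide_less_eq mult.commute)
      also have "e * real N \<le> e * real (Suc k)" using k e(1) by simp
      finally have "C / real (Suc k) \<le> e" by (simp add: divide_le_eq)
      then have "norm (stretch g y - stretch (h k) y) \<le> e"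
        using h[of k "fst y"] by (simp add: stretch_def norm_prod_def abs_minus_commute)
      then have "stretch g y \<in> ?K" using a
        by (intro CollectI exI[of _ "stretch (h k) y"] exI[of _ "stretch g y - stretch (h k) y"]) simp
      then have "stretch f (stretch g y) \<in> stretch f ` ?K" by (rule imageI)
      with y show False by (simp add: stretch_inverse)
    qed
  qed
qed

text \<open>The weak gradient is tested with \<open>\<psi> \<circ> h\<close> in the first direction and with
  \<open>h' (\<psi> \<circ> h)\<close> in the second, for smooth approximations \<open>h\<close> of \<open>g\<close>. The additional factor in the
  second case is the Jacobian \<open>g'\<close> of the substitution to be made; in the first case
  differentiating \<open>\<psi> \<circ> h\<close> already produces it.\<close>

lemma
  assumes U: "open U" "bounded U" and uG: "weak_gradient U u G"
    and \<psi>: "\<psi> \<in> test_functions (stretch f -` U)"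
  shows stretched_test_fst: "(\<integral>y. u y * (g' (fst y) * partial_deriv (1, 0) \<psi> (stretch g y)) \<partial>lebesgue_on U) =
      - (\<integral>y. fst (G y) * \<psi> (stretch g y) \<partial>lebesgue_on U)"
    and stretched_test_snd: "(\<integral>y. u y * (g' (fst y) * partial_deriv (0, 1) \<psi> (stretch g y)) \<partial>lebesgue_on U) =
      - (\<integral>y. snd (G y) * (g' (fst y) * \<psi> (stretch g y)) \<partial>lebesgue_on U)"
proof -
  let ?M = "lebesgue_on U"
  have Ul: "U \<in> lmeasurable" using U by (simp add: bounded_set_imp_lmeasurable lmeasurable_open)
  have Us: "U \<in> sets lebesgue" using Ul by (rule fmeasurableD)
  obtain F where "smooth_approx F g g'" using approx(2) by blast
  then obtain h h' C where F: "finite F"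
    and C_h: "\<And>k j. C_k j (h k)" and dh: "\<And>k x. (h k has_real_derivative h' k x) (at x)"
    and close: "\<And>k x. \<bar>h k x - g x\<bar> \<le> C / real (Suc k)" and h'C: "\<And>k x. \<bar>h' k x\<bar> \<le> C"
    and lim': "\<And>x. x \<notin> F \<Longrightarrow> (\<lambda>k. h' k x) \<longlonglongrightarrow> g' x"
    by cases (rule that)
  have C_h': "C_k j (h' k)" for j k using C_k_real_SucD[OF C_h dh] .
  obtain K where K: "compact K" "K \<subseteq> stretch f -` U" "\<And>x. x \<notin> K \<Longrightarrow> \<psi> x = 0" and C\<psi>: "\<And>j. C_k j \<psi>"
    using \<psi> by (auto simp: test_functions_def)
  obtain N K' where K': "compact K'" "K' \<subseteq> U" "\<And>k y. N \<le> k \<Longrightarrow> y \<notin> K' \<Longrightarrow> stretch (h k) y \<notin> K"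
    by (rule test_function_stretched_support[OF U(1) K(1,2) close], rule that)
  obtain B where B: "\<And>x. \<bar>\<psi> x\<bar> \<le> B" "\<And>b x. b \<in> Basis \<Longrightarrow> \<bar>partial_deriv b \<psi> x\<bar> \<le> B"
    by (rule test_function_bounded[OF \<psi>], rule that)
  have B0: "0 \<le> B" using B(1)[of 0] by linarith
  have C0: "0 \<le> C" using h'C[of 0 0] by linarith
  have d\<psi>: "\<psi> differentiable (at x)" for x using C\<psi>[of "Suc 0"] unfolding C_k.simps by blast
  have cont\<psi>: "continuous_on UNIV \<psi>" using C\<psi>[of 0] by simp
  have cont\<psi>': "continuous_on UNIV (partial_deriv b \<psi>)" if "b \<in> Basis" for b
    using C\<psi>[of "Suc 0"] that by simp
  have conth: "continuous_on UNIV (h k)" for k using C_h[of 0 k] by simp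
  have conth': "continuous_on UNIV (h' k)" for k using C_h'[of 0 k] by simp
  have conts: "continuous_on UNIV (stretch p)" if "continuous_on UNIV p" for p
    unfolding stretch_def[abs_def]
    by (intro continuous_intros continuous_on_compose2[OF that]) auto
  have limh: "(\<lambda>k. h k x) \<longlonglongrightarrow> g x" for x
  proof (rule LIM_zero_cancel, rule Lim_null_comparison[of _ "\<lambda>k. C / real (Suc k)"])
    show "\<forall>\<^sub>F k in sequentially. norm (h k x - g x) \<le> C / real (Suc k)" using close by simp
    show "(\<lambda>k. C / real (Suc k)) \<longlonglongrightarrow> 0"
      using tendsto_mult_right_zero[OF LIMSEQ_inverse_real_of_nat, of C] by (simp add: field_simps)
  qed
  have lims: "(\<lambda>k. q (stretch (h k) y)) \<longlonglongrightarrow> q (stretch g y)" if "continuous_on UNIV q" for q :: "real \<times> real \<Rightarrow> real" and y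
    unfolding stretch_def
    by (rule continuous_on_tendsto_compose[OF that]) (auto intro!: tendsto_intros limh)

  have mh: "(\<lambda>y. q (stretch (h k) y)) \<in> borel_measurable ?M" if "continuous_on UNIV q" for q :: "real \<times> real \<Rightarrow> real" and k
    by (intro borel_imp_lebesgue_on borel_measurable_continuous_onI continuous_on_compose2[OF that conts[OF conth]]) auto
  have mg: "(\<lambda>y. q (stretch g y)) \<in> borel_measurable ?M" if "continuous_on UNIV q" for q :: "real \<times> real \<Rightarrow> real"
    by (intro borel_imp_lebesgue_on borel_measurable_continuous_onI continuous_on_compose2[OF that conts[OF cont(2)]]) auto
  have mh': "(\<lambda>y. h' k (fst y)) \<in> borel_measurable ?M" for k
    by (intro borel_imp_lebesgue_on borel_measurable_continuous_onI continuous_on_compose2[OF conth'])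
      (auto intro: continuous_intros)
  have mg': "(\<lambda>y. g' (fst y)) \<in> borel_measurable ?M"
    using stretching.measurable_w[OF swap] by (rule measurable_restrict_space1)
  have aeF: "AE y in ?M. fst y \<notin> F" by (rule AE_fst_notin[OF F Us])

  have iu: "integrable ?M u" and iG: "integrable ?M G"
    using uG Ul by (auto simp: weak_gradient_def intro: integrable_L2_on)
  have iG1: "integrable ?M (\<lambda>y. fst (G y))" and iG2: "integrable ?M (\<lambda>y. snd (G y))"
    using integrable_bounded_linear[OF bounded_linear_fst iG] integrable_bounded_linear[OF bounded_linear_snd iG] .

  have limq: "(\<lambda>k. \<integral>y. p y * (h' k (fst y) * q (stretch (h k) y)) \<partial>?M) \<longlonglongrightarrow>
      (\<integral>y. p y * (g' (fst y) * q (stretch g y)) \<partial>?M)"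
    if p: "integrable ?M p" and q: "continuous_on UNIV q" and qB: "\<And>x. \<bar>q x\<bar> \<le> B"
    for p q :: "real \<times> real \<Rightarrow> real"
  proof (rule integral_mult_bounded_tendsto[OF p])
    show "(\<lambda>y. h' k (fst y) * q (stretch (h k) y)) \<in> borel_measurable ?M" for k
      by (intro borel_measurable_times mh' mh q)
    show "(\<lambda>y. g' (fst y) * q (stretch g y)) \<in> borel_measurable ?M"
      by (intro borel_measurable_times mg' mg q)
    show "\<bar>h' k (fst y) * q (stretch (h k) y)\<bar> \<le> C * B" for k y
      unfolding abs_mult using h'C qB C0 by (intro mult_mono) auto
    show "AE y in ?M. (\<lambda>k. h' k (fst y) * q (stretch (h k) y)) \<longlonglongrightarrow> g' (fst y) * q (stretch g y)"
      using aeF by eventually_elim (intro tendsto_mult lim' lims q)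
  qed

  have test: "(\<lambda>y. \<psi> (stretch (h k) y)) \<in> test_functions U"
    and test': "(\<lambda>y. h' k (fst y) * \<psi> (stretch (h k) y)) \<in> test_functions U" if "N \<le> k" for k
  proof -
    have a: "C_k j (\<lambda>y. \<psi> (stretch (h k) y))" for j
      unfolding stretch_def by (rule C_k_stretched[OF C\<psi> C_h])
    then have b: "C_k j (\<lambda>y. h' k (fst y) * \<psi> (stretch (h k) y))" for j
      by (intro C_k_mult C_k_fst C_h')
    have "\<psi> (stretch (h k) y) = 0" if "y \<notin> K'" for y using K'(3)[OF \<open>N \<le> k\<close> that] K(3) by blast
    then show "(\<lambda>y. \<psi> (stretch (h k) y)) \<in> test_functions U"
       "(\<lambda>y. h' k (fst y) * \<psi> (stretch (h k) y)) \<in> test_functions U"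
      using a b K'(1,2) by (auto simp: test_functions_def)
  qed
  have e1: "(1::real, 0::real) \<in> Basis" and e2: "(0::real, 1::real) \<in> Basis" by (simp_all add: Basis_real2)

  have p1: "partial_deriv (1, 0) (\<lambda>y. \<psi> (stretch (h k) y)) y =
      h' k (fst y) * partial_deriv (1, 0) \<psi> (stretch (h k) y)" for k y
    unfolding stretch_def by (rule partial_deriv_stretched(1)[OF d\<psi> dh])
  have p2: "partial_deriv (0, 1) (\<lambda>y. h' k (fst y) * \<psi> (stretch (h k) y)) y =
      h' k (fst y) * partial_deriv (0, 1) \<psi> (stretch (h k) y)" for k y
  proof -
    have d1: "((\<lambda>x::real\<times>real. h' k (fst x)) has_derivative (\<lambda>v. partial_deriv 1 (h' k) (fst y) * fst v)) (at y)"
      by (rule has_derivative_compose[OF has_derivative_fst[OF has_derivative_ident]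
        C_k_real_deriv[OF C_h', unfolded has_field_derivative_def]])
    note d2 = has_derivative_stretched[OF d\<psi> dh]
    have "partial_deriv (0, 1) \<psi> (stretch (h k) y) = partial_deriv (0, 1) (\<lambda>y. \<psi> (stretch (h k) y)) y"
      unfolding stretch_def by (rule partial_deriv_stretched(2)[OF d\<psi> dh, symmetric])
    then show ?thesis
      unfolding stretch_def partial_deriv_eq[OF has_derivative_mult[OF d1 d2]] partial_deriv_eq[OF d2]
      by simp
  qed

  have "(\<lambda>k. \<integral>y. u y * (h' k (fst y) * partial_deriv (1, 0) \<psi> (stretch (h k) y)) \<partial>?M) \<longlonglongrightarrow>
      (\<integral>y. u y * (g' (fst y) * partial_deriv (1, 0) \<psi> (stretch g y)) \<partial>?M)"
    by (rule limq[OF iu cont\<psi>'[OF e1] B(2)[OF e1]])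
  moreover have "(\<lambda>k. \<integral>y. fst (G y) * \<psi> (stretch (h k) y) \<partial>?M) \<longlonglongrightarrow> (\<integral>y. fst (G y) * \<psi> (stretch g y) \<partial>?M)"
    by (rule integral_mult_bounded_tendsto[OF iG1 mh[OF cont\<psi>] mg[OF cont\<psi>] B(1)]) (simp add: lims[OF cont\<psi>])
  moreover have "\<forall>\<^sub>F k in sequentially. (\<integral>y. u y * (h' k (fst y) * partial_deriv (1, 0) \<psi> (stretch (h k) y)) \<partial>?M) =
      - (\<integral>y. fst (G y) * \<psi> (stretch (h k) y) \<partial>?M)"
  proof (rule eventually_sequentiallyI)
    fix k assume "N \<le> k"
    from uG test[OF this] e1 show "(\<integral>y. u y * (h' k (fst y) * partial_deriv (1, 0) \<psi> (stretch (h k) y)) \<partial>?M) =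
      - (\<integral>y. fst (G y) * \<psi> (stretch (h k) y) \<partial>?M)"
      unfolding weak_gradient_def p1[symmetric] by (auto simp: inner_prod_def)
  qed
  ultimately show "(\<integral>y. u y * (g' (fst y) * partial_deriv (1, 0) \<psi> (stretch g y)) \<partial>?M) =
      - (\<integral>y. fst (G y) * \<psi> (stretch g y) \<partial>?M)"
    by (rule eq_neg_limI)

  have "(\<lambda>k. \<integral>y. u y * (h' k (fst y) * partial_deriv (0, 1) \<psi> (stretch (h k) y)) \<partial>?M) \<longlonglongrightarrow>
      (\<integral>y. u y * (g' (fst y) * partial_deriv (0, 1) \<psi> (stretch g y)) \<partial>?M)"
    by (rule limq[OF iu cont\<psi>'[OF e2] B(2)[OF e2]])
  moreover have "(\<lambda>k. \<integral>y. snd (G y) * (h' k (fst y) * \<psi> (stretch (h k) y)) \<partial>?M) \<longlonglongrightarrow>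
      (\<integral>y. snd (G y) * (g' (fst y) * \<psi> (stretch g y)) \<partial>?M)"
    by (rule limq[OF iG2 cont\<psi> B(1)])
  moreover have "\<forall>\<^sub>F k in sequentially. (\<integral>y. u y * (h' k (fst y) * partial_deriv (0, 1) \<psi> (stretch (h k) y)) \<partial>?M) =
      - (\<integral>y. snd (G y) * (h' k (fst y) * \<psi> (stretch (h k) y)) \<partial>?M)"
  proof (rule eventually_sequentiallyI)
    fix k assume "N \<le> k"
    from uG test'[OF this] e2 show "(\<integral>y. u y * (h' k (fst y) * partial_deriv (0, 1) \<psi> (stretch (h k) y)) \<partial>?M) =
      - (\<integral>y. snd (G y) * (h' k (fst y) * \<psi> (stretch (h k) y)) \<partial>?M)"
      unfolding weak_gradient_def p2[symmetric] by (auto simp: inner_prod_def)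
  qed
  ultimately show "(\<integral>y. u y * (g' (fst y) * partial_deriv (0, 1) \<psi> (stretch g y)) \<partial>?M) =
      - (\<integral>y. snd (G y) * (g' (fst y) * \<psi> (stretch g y)) \<partial>?M)"
    by (rule eq_neg_limI)
qed

end

text \<open>The chain rule: the gradient of \<open>u \<circ> stretch f\<close> when \<open>G\<close> is the gradient of \<open>u\<close>.\<close>

definition stretch_grad ::
    "(real \<Rightarrow> real) \<Rightarrow> (real \<Rightarrow> real) \<Rightarrow> (real \<times> real \<Rightarrow> real \<times> real) \<Rightarrow> real \<times> real \<Rightarrow> real \<times> real" where
  "stretch_grad f f' G x = (f' (fst x) * fst (G (stretch f x)), snd (G (stretch f x)))"

lemma norm_real2: "(norm x)\<^sup>2 = (fst x)\<^sup>2 + (snd x)\<^sup>2" for x :: "real \<times> real"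
  by (simp add: norm_prod_def)

lemma L2_on_diff:
  assumes "L2_on U p" "L2_on U q"
  shows "L2_on U (\<lambda>x. p x - q x)"
  unfolding L2_on_def
proof
  show m: "(\<lambda>x. p x - q x) \<in> borel_measurable (lebesgue_on U)"
    using assms by (auto simp: L2_on_def)
  show "integrable (lebesgue_on U) (\<lambda>x. (norm (p x - q x))\<^sup>2)"
  proof (rule Bochner_Integration.integrable_bound)
    show "integrable (lebesgue_on U) (\<lambda>x. 2 * (norm (p x))\<^sup>2 + 2 * (norm (q x))\<^sup>2)"
      using assms by (auto simp: L2_on_def)
    have "(norm (p x - q x))\<^sup>2 \<le> 2 * (norm (p x))\<^sup>2 + 2 * (norm (q x))\<^sup>2" for x
    proof -
      have "(norm (p x - q x))\<^sup>2 \<le> (norm (p x) + norm (q x))\<^sup>2"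
        by (intro power_mono norm_triangle_ineq4) simp
      also have "\<dots> \<le> 2 * (norm (p x))\<^sup>2 + 2 * (norm (q x))\<^sup>2"
        using sum_squares_bound[of "norm (p x)" "norm (q x)"] by (simp add: power2_sum)
      finally show ?thesis .
    qed
    then show "AE x in lebesgue_on U. norm ((norm (p x - q x))\<^sup>2) \<le> norm (2 * (norm (p x))\<^sup>2 + 2 * (norm (q x))\<^sup>2)"
      by simp
  qed (use m in measurable)
qed

lemma measurable_real2:
  fixes G :: "'a \<Rightarrow> real \<times> real"
  shows "G \<in> borel_measurable N \<longleftrightarrow> (\<lambda>x. fst (G x)) \<in> borel_measurable N \<and> (\<lambda>x. snd (G x)) \<in> borel_measurable N"
  unfolding borel_prod[symmetric] measurable_pair_iff comp_def ..

context stretching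
begin

lemma f'_pos: "0 < f' x" using bounds(1,2) by (rule less_le_trans)

lemma stretch_grad_norm_le:
  "(norm (stretch_grad f f' G x - stretch_grad f f' E x))\<^sup>2 \<le>
    (M\<^sup>2 + 1) * (norm (G (stretch f x) - E (stretch f x)))\<^sup>2"
proof -
  define a where "a = fst (G (stretch f x)) - fst (E (stretch f x))"
  define b where "b = snd (G (stretch f x)) - snd (E (stretch f x))"
  have "(f' (fst x))\<^sup>2 \<le> M\<^sup>2" using bounds(3) f'_pos by (intro power_mono) (auto intro: less_imp_le)
  then have "(f' (fst x))\<^sup>2 * a\<^sup>2 \<le> M\<^sup>2 * a\<^sup>2" by (intro mult_right_mono) auto
  moreover have "0 \<le> M\<^sup>2 * b\<^sup>2" by simp
  moreover have "(norm (stretch_grad f f' G x - stretch_grad f f' E x))\<^sup>2 = (f' (fst x))\<^sup>2 * a\<^sup>2 + b\<^sup>2"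
    by (simp add: norm_real2 stretch_grad_def a_def b_def right_diff_distrib[symmetric] power_mult_distrib)
  moreover have "(norm (G (stretch f x) - E (stretch f x)))\<^sup>2 = a\<^sup>2 + b\<^sup>2"
    by (simp add: norm_real2 a_def b_def)
  moreover have "0 \<le> a\<^sup>2" by simp
  ultimately show ?thesis by (simp only: distrib_left distrib_right mult_1)
qed

lemma measurable_stretch_grad:
  assumes "G \<in> borel_measurable (lebesgue_on U)" and "U \<in> sets lebesgue"
  shows "stretch_grad f f' G \<in> borel_measurable (lebesgue_on (stretch f -` U))"
proof -
  have "(\<lambda>x. fst (G (stretch f x))) \<in> borel_measurable (lebesgue_on (stretch f -` U))"
    "(\<lambda>x. snd (G (stretch f x))) \<in> borel_measurable (lebesgue_on (stretch f -` U))"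
    using assms(1) by (auto simp: measurable_real2[of G] intro!: measurable_compose_stretch[OF _ assms(2)])
  moreover have "(\<lambda>x. f' (fst x)) \<in> borel_measurable (lebesgue_on (stretch f -` U))"
    using measurable_w by (rule measurable_restrict_space1)
  ultimately show ?thesis by (simp add: measurable_real2 stretch_grad_def)
qed

lemma L2_on_stretch:
  fixes u :: "real \<times> real \<Rightarrow> real"
  assumes "L2_on U u" and "U \<in> sets lebesgue"
  shows "L2_on (stretch f -` U) (\<lambda>x. u (stretch f x))"
  using assms integrable_stretch_nonneg[of U "\<lambda>x. (norm (u x))\<^sup>2"] measurable_compose_stretch[of u U]
  by (auto simp: L2_on_def)

lemma L2_on_stretch_grad:
  assumes "L2_on U G" and U: "U \<in> sets lebesgue"
  shows "L2_on (stretch f -` U) (stretch_grad f f' G)"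
proof -
  have m: "stretch_grad f f' G \<in> borel_measurable (lebesgue_on (stretch f -` U))"
    using assms by (intro measurable_stretch_grad) (auto simp: L2_on_def)
  have "integrable (lebesgue_on (stretch f -` U)) (\<lambda>x. (norm (G (stretch f x)))\<^sup>2)"
    using assms by (intro integrable_stretch_nonneg[of U "\<lambda>x. (norm (G x))\<^sup>2"]) (auto simp: L2_on_def)
  then have "integrable (lebesgue_on (stretch f -` U)) (\<lambda>x. (M\<^sup>2 + 1) * (norm (G (stretch f x)))\<^sup>2)"
    by simp
  then have "integrable (lebesgue_on (stretch f -` U)) (\<lambda>x. (norm (stretch_grad f f' G x))\<^sup>2)"
  proof (rule Bochner_Integration.integrable_bound)
    have "(norm (stretch_grad f f' G x))\<^sup>2 \<le> (M\<^sup>2 + 1) * (norm (G (stretch f x)))\<^sup>2" for x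
      using stretch_grad_norm_le[of G x "\<lambda>_. 0"] by (simp add: stretch_grad_def)
    then show "AE x in lebesgue_on (stretch f -` U). norm ((norm (stretch_grad f f' G x))\<^sup>2) \<le>
        norm ((M\<^sup>2 + 1) * (norm (G (stretch f x)))\<^sup>2)"
      by (simp add: abs_mult)
  qed (use m in measurable)
  with m show ?thesis by (simp add: L2_on_def)
qed

text \<open>Substituting \<open>y = stretch f x\<close> in the two tested identities removes the factors
  \<open>g'\<close>; in the first direction the right-hand side carries no such factor, and \<open>g' (f' \<circ> g) = 1\<close>
  supplies the factor \<open>f'\<close> of \<open>stretch_grad\<close>.\<close>

lemma weak_gradient_stretch:
  assumes U: "open U" "bounded U" and uG: "weak_gradient U u G"
  shows "weak_gradient (stretch f -` U) (\<lambda>x. u (stretch f x)) (stretch_grad f f' G)"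
proof -
  let ?V = "stretch f -` U"
  have Us: "U \<in> sets lebesgue" using U by (simp add: lmeasurable_open bounded_set_imp_lmeasurable fmeasurableD)
  have Vs: "?V \<in> sets lebesgue" using measurable_sets[OF measurable_stretch Us] by simp
  have u: "L2_on U u" and G: "L2_on U G" using uG by (auto simp: weak_gradient_def)
  have mu: "(\<lambda>x. u (stretch f x)) \<in> borel_measurable (lebesgue_on ?V)"
    using L2_on_stretch[OF u Us] by (simp add: L2_on_def)
  have "stretch_grad f f' G \<in> borel_measurable (lebesgue_on ?V)"
    using L2_on_stretch_grad[OF G Us] by (simp add: L2_on_def)
  then have m1: "(\<lambda>x. f' (fst x) * fst (G (stretch f x))) \<in> borel_measurable (lebesgue_on ?V)"
    and m2: "(\<lambda>x. snd (G (stretch f x))) \<in> borel_measurable (lebesgue_on ?V)"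
    by (simp_all add: measurable_real2 stretch_grad_def)
  have pull: "(\<integral>y. g' (fst y) * q (stretch g y) \<partial>lebesgue_on U) = (\<integral>x. q x \<partial>lebesgue_on ?V)"
    if "q \<in> borel_measurable (lebesgue_on ?V)" for q
    using stretching.integral_stretch[OF swap that Vs] by (simp add: vimage_vimage)
  have "(\<integral>x. u (stretch f x) * partial_deriv b \<psi> x \<partial>lebesgue_on ?V) =
      - (\<integral>x. (stretch_grad f f' G x \<bullet> b) * \<psi> x \<partial>lebesgue_on ?V)"
    if \<psi>: "\<psi> \<in> test_functions ?V" and b: "b \<in> Basis" for \<psi> b
  proof -
    have C: "\<And>j. C_k j \<psi>" using \<psi> by (simp add: test_functions_def)
    have m\<psi>: "\<psi> \<in> borel_measurable (lebesgue_on ?V)"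
      using C[of 0] by (intro borel_imp_lebesgue_on borel_measurable_continuous_onI) simp
    have m\<psi>': "partial_deriv b \<psi> \<in> borel_measurable (lebesgue_on ?V)"
      using C[of "Suc 0"] b by (intro borel_imp_lebesgue_on borel_measurable_continuous_onI) simp
    have lhs: "(\<integral>x. u (stretch f x) * partial_deriv b \<psi> x \<partial>lebesgue_on ?V) =
        (\<integral>y. u y * (g' (fst y) * partial_deriv b \<psi> (stretch g y)) \<partial>lebesgue_on U)"
      using pull[OF borel_measurable_times[OF mu m\<psi>']] by (simp add: stretch_inverse mult.left_commute)
    consider "b = (1, 0)" | "b = (0, 1)" using b by (auto simp: Basis_real2)
    then show ?thesis
    proof cases
      case 1
      obtain F where F: "finite F" "\<And>y. y \<notin> F \<Longrightarrow> g' y * f' (g y) = 1" using deriv_product by blast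
      have ae: "AE y in lebesgue_on U. fst y \<notin> F" by (rule AE_fst_notin[OF F(1) Us])
      have m\<psi>g: "(\<lambda>y. \<psi> (stretch g y)) \<in> borel_measurable (lebesgue_on U)"
        using stretching.measurable_compose_stretch[OF swap m\<psi> Vs] by (simp add: vimage_vimage)
      have mG: "(\<lambda>y. fst (G y)) \<in> borel_measurable (lebesgue_on U)"
        using G by (simp add: L2_on_def measurable_real2)
      have mm: "(\<lambda>y. g' (fst y) * (f' (g (fst y)) * fst (G y) * \<psi> (stretch g y))) \<in> borel_measurable (lebesgue_on U)"
        using borel_measurable_times[OF measurable_restrict_space1[OF stretching.measurable_w[OF swap]]
            stretching.measurable_compose_stretch[OF swap borel_measurable_times[OF m1 m\<psi>] Vs]]
        by (simp add: vimage_vimage stretch_inverse) (simp add: stretch_def)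
      have "(\<integral>x. (stretch_grad f f' G x \<bullet> b) * \<psi> x \<partial>lebesgue_on ?V) =
          (\<integral>y. g' (fst y) * (f' (g (fst y)) * fst (G y) * \<psi> (stretch g y)) \<partial>lebesgue_on U)"
        using pull[OF borel_measurable_times[OF m1 m\<psi>]] 1
        by (simp add: stretch_inverse stretch_grad_def) (simp add: stretch_def)
      also have "\<dots> = (\<integral>y. fst (G y) * \<psi> (stretch g y) \<partial>lebesgue_on U)"
      proof (rule integral_cong_AE[OF mm borel_measurable_times[OF mG m\<psi>g]])
        show "AE y in lebesgue_on U. g' (fst y) * (f' (g (fst y)) * fst (G y) * \<psi> (stretch g y)) =
            fst (G y) * \<psi> (stretch g y)"
          using ae by eventually_elim (simp add: F(2) mult.assoc[symmetric])
      qed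
      finally show ?thesis using lhs stretched_test_fst[OF U uG \<psi>] 1 by simp
    next
      case 2
      have "(\<integral>x. (stretch_grad f f' G x \<bullet> b) * \<psi> x \<partial>lebesgue_on ?V) =
          (\<integral>y. snd (G y) * (g' (fst y) * \<psi> (stretch g y)) \<partial>lebesgue_on U)"
        using pull[OF borel_measurable_times[OF m2 m\<psi>]] 2
        by (simp add: stretch_inverse stretch_grad_def mult.left_commute)
      then show ?thesis using lhs stretched_test_snd[OF U uG \<psi>] 2 by simp
    qed
  qed
  then show ?thesis
    using L2_on_stretch[OF u Us] L2_on_stretch_grad[OF G Us] by (simp add: weak_gradient_def)
qed

text \<open>A side over a fixed point of \<open>f\<close> is left in place, and the \<open>L\<^sup>2\<close> distances of the
  approximations change at most by a constant factor.\<close>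

lemma has_trace_stretch:
  assumes R: "open R" "bounded R" "stretch f -` R = R" and a: "f a = a"
    and tr: "has_trace R a J u \<tau>"
  shows "has_trace R a J (\<lambda>x. u (stretch f x)) \<tau>"
proof -
  have Rs: "R \<in> sets lebesgue" using R by (simp add: lmeasurable_open bounded_set_imp_lmeasurable fmeasurableD)
  obtain G v V where G: "weak_gradient R u G"
    and v: "\<And>k::nat. continuous_on (closure R) (v k)" "\<And>k. weak_gradient R (v k) (V k)"
    and lim: "(\<lambda>k. \<integral>x. (v k x - u x)\<^sup>2 \<partial>lebesgue_on R) \<longlonglongrightarrow> 0"
      "(\<lambda>k. \<integral>x. (norm (V k x - G x))\<^sup>2 \<partial>lebesgue_on R) \<longlonglongrightarrow> 0"
      "(\<lambda>k. \<integral>t. (v k (a, t) - \<tau> t)\<^sup>2 \<partial>lebesgue_on J) \<longlonglongrightarrow> 0"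
    using tr by (auto simp: has_trace_def)
  have "stretch f ` R \<subseteq> R" using R(3) by (metis image_vimage_subset)
  then have cl: "stretch f ` closure R \<subseteq> closure R"
    using continuous_on_subset[OF continuous_stretch] closure_subset
    by (intro image_closure_subset) auto
  have "continuous_on (closure R) (\<lambda>x. v k (stretch f x))" for k
    using cl by (intro continuous_on_compose2[OF v(1)] continuous_on_subset[OF continuous_stretch]) auto
  moreover have "weak_gradient R (\<lambda>x. u (stretch f x)) (stretch_grad f f' G)"
    using weak_gradient_stretch[OF R(1,2) G] R(3) by simp
  moreover have "weak_gradient R (\<lambda>x. v k (stretch f x)) (stretch_grad f f' (V k))" for k
    using weak_gradient_stretch[OF R(1,2) v(2)] R(3) by simp
  moreover have "(\<lambda>k. \<integral>x. (v k (stretch f x) - u (stretch f x))\<^sup>2 \<partial>lebesgue_on R) \<longlonglongrightarrow> 0"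
  proof (rule tendsto_sandwich[OF _ _ tendsto_const tendsto_divide_zero[OF lim(1), of m]])
    show "\<forall>\<^sub>F k in sequentially. (\<integral>x. (v k (stretch f x) - u (stretch f x))\<^sup>2 \<partial>lebesgue_on R) \<le>
        (\<integral>x. (v k x - u x)\<^sup>2 \<partial>lebesgue_on R) / m"
    proof (rule always_eventually, rule allI)
      fix k
      have "integrable (lebesgue_on R) (\<lambda>x. (v k x - u x)\<^sup>2)"
        using L2_on_diff[of R "v k" u] G v(2)[of k] by (simp add: weak_gradient_def L2_on_def)
      from integral_stretch_le[OF this _ Rs] show "(\<integral>x. (v k (stretch f x) - u (stretch f x))\<^sup>2 \<partial>lebesgue_on R) \<le>
        (\<integral>x. (v k x - u x)\<^sup>2 \<partial>lebesgue_on R) / m" using R(3) by simp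
    qed
  qed (simp add: integral_nonneg)
  moreover have "(\<lambda>k. \<integral>x. (norm (stretch_grad f f' (V k) x - stretch_grad f f' G x))\<^sup>2 \<partial>lebesgue_on R) \<longlonglongrightarrow> 0"
  proof (rule tendsto_sandwich[OF _ _ tendsto_const tendsto_mult_right_zero[OF tendsto_divide_zero[OF lim(2), of m], of "M\<^sup>2 + 1"]])
    show "\<forall>\<^sub>F k in sequentially. (\<integral>x. (norm (stretch_grad f f' (V k) x - stretch_grad f f' G x))\<^sup>2 \<partial>lebesgue_on R) \<le>
        (M\<^sup>2 + 1) * ((\<integral>x. (norm (V k x - G x))\<^sup>2 \<partial>lebesgue_on R) / m)"
    proof (rule always_eventually, rule allI)
      fix k
      have L: "L2_on R G" "L2_on R (V k)" using G v(2)[of k] by (auto simp: weak_gradient_def)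
      have i: "integrable (lebesgue_on R) (\<lambda>x. (norm (V k x - G x))\<^sup>2)"
        using L2_on_diff[OF L(2,1)] by (simp add: L2_on_def)
      have i': "integrable (lebesgue_on R) (\<lambda>x. (norm (V k (stretch f x) - G (stretch f x)))\<^sup>2)"
        using integrable_stretch_nonneg[OF i _ Rs] R(3) by simp
      have i'': "integrable (lebesgue_on R) (\<lambda>x. (norm (stretch_grad f f' (V k) x - stretch_grad f f' G x))\<^sup>2)"
        using L2_on_diff[OF L2_on_stretch_grad[OF L(2) Rs] L2_on_stretch_grad[OF L(1) Rs]] R(3)
        by (simp add: L2_on_def)
      have "(\<integral>x. (norm (stretch_grad f f' (V k) x - stretch_grad f f' G x))\<^sup>2 \<partial>lebesgue_on R) \<le>
          (\<integral>x. (M\<^sup>2 + 1) * (norm (V k (stretch f x) - G (stretch f x)))\<^sup>2 \<partial>lebesgue_on R)"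
        using i'' i' stretch_grad_norm_le by (intro integral_mono) auto
      also have "\<dots> = (M\<^sup>2 + 1) * (\<integral>x. (norm (V k (stretch f x) - G (stretch f x)))\<^sup>2 \<partial>lebesgue_on R)"
        by simp
      also have "\<dots> \<le> (M\<^sup>2 + 1) * ((\<integral>x. (norm (V k x - G x))\<^sup>2 \<partial>lebesgue_on R) / m)"
        using integral_stretch_le[OF i _ Rs] R(3) by (intro mult_left_mono) auto
      finally show "(\<integral>x. (norm (stretch_grad f f' (V k) x - stretch_grad f f' G x))\<^sup>2 \<partial>lebesgue_on R) \<le>
        (M\<^sup>2 + 1) * ((\<integral>x. (norm (V k x - G x))\<^sup>2 \<partial>lebesgue_on R) / m)" .
    qed
  qed (simp add: integral_nonneg)
  moreover have "(\<lambda>k. \<integral>t. (v k (stretch f (a, t)) - \<tau> t)\<^sup>2 \<partial>lebesgue_on J) \<longlonglongrightarrow> 0"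
    using lim(3) a by (simp add: stretch_def)
  ultimately show ?thesis
    using tr unfolding has_trace_def by (intro conjI exI[of _ "stretch_grad f f' G"]
        exI[of _ "\<lambda>k x. v k (stretch f x)"] exI[of _ "\<lambda>k. stretch_grad f f' (V k)"]) auto
qed

end

section \<open>Energies under a stretch\<close>

text \<open>An equality of these sets gives an equality of minimal energies even when no
  displacement is admissible and \<open>Inf\<close> is unspecified.\<close>

definition energies ::
    "real \<Rightarrow> real \<Rightarrow> (real \<times> real \<Rightarrow> real) \<Rightarrow> (real \<times> real \<Rightarrow> real \<times> real) \<Rightarrow> real \<Rightarrow> real set" where
  "energies L H g C l = {1/2 * (\<integral>x. diag_form (C x) (G x) \<partial>lebesgue_on (Omega L H - crack l)) | u G.
            u \<in> admissible L H g l \<and> weak_gradient (Omega L H - crack l) u G}"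

lemma min_energy_eq: "min_energy L H g C l = Inf (energies L H g C l)"
  by (simp add: min_energy_def energies_def)

lemma open_cracked: "open (Omega L H - crack l)"
  by (auto simp: Omega_def crack_def intro!: open_Diff open_Times closed_Times)

lemma bounded_Omega: "bounded (Omega L H)"
  by (simp add: Omega_def bounded_Times)

lemma bounded_cracked: "bounded (Omega L H - crack l)"
  using bounded_Omega by (rule bounded_subset) blast

lemma cracked_lmeasurable: "Omega L H - crack l \<in> lmeasurable"
  using open_cracked bounded_cracked by (simp add: bounded_set_imp_lmeasurable lmeasurable_open)

lemma cracked_sets: "Omega L H - crack l \<in> sets lebesgue"
  by (rule fmeasurableD[OF cracked_lmeasurable])

lemma measurable_diag_form:
  assumes "G \<in> borel_measurable (lebesgue_on U)"
    and "c1 \<in> borel_measurable borel" "c2 \<in> borel_measurable borel"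
  shows "(\<lambda>x :: real \<times> real. diag_form (c1 (fst x), c2 (fst x)) (G x)) \<in> borel_measurable (lebesgue_on U)"
proof -
  have b: "(\<lambda>x :: real \<times> real. c (fst x)) \<in> borel_measurable (lebesgue_on U)"
    if c: "c \<in> borel_measurable borel" for c :: "real \<Rightarrow> real"
    by (rule borel_imp_lebesgue_on)
      (rule measurable_compose[OF borel_measurable_continuous_onI[OF continuous_on_fst[OF continuous_on_id]] c])
  note [measurable] = b[OF assms(2)] b[OF assms(3)]
  have [measurable]: "(\<lambda>x. fst (G x)) \<in> borel_measurable (lebesgue_on U)"
    "(\<lambda>x. snd (G x)) \<in> borel_measurable (lebesgue_on U)"
    using assms(1) by (auto simp: measurable_real2[of G])
  show ?thesis unfolding diag_form_def fst_conv snd_conv by measurable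
qed

lemma energies_cong:
  assumes "finite F" and eq: "\<And>t. 0 < t \<Longrightarrow> t < L \<Longrightarrow> t \<notin> F \<Longrightarrow> c1 t = d1 t \<and> c2 t = d2 t"
    and "c1 \<in> borel_measurable borel" "c2 \<in> borel_measurable borel"
    and "d1 \<in> borel_measurable borel" "d2 \<in> borel_measurable borel"
  shows "energies L H g (\<lambda>x. (c1 (fst x), c2 (fst x))) l = energies L H g (\<lambda>x. (d1 (fst x), d2 (fst x))) l"
proof -
  let ?U = "Omega L H - crack l"
  have "(\<integral>x. diag_form (c1 (fst x), c2 (fst x)) (G x) \<partial>lebesgue_on ?U) =
      (\<integral>x. diag_form (d1 (fst x), d2 (fst x)) (G x) \<partial>lebesgue_on ?U)" if "weak_gradient ?U u G" for u G
  proof -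
    have G: "G \<in> borel_measurable (lebesgue_on ?U)" using that by (simp add: weak_gradient_def L2_on_def)
    have "AE x in lebesgue_on ?U. diag_form (c1 (fst x), c2 (fst x)) (G x) = diag_form (d1 (fst x), d2 (fst x)) (G x)"
      using AE_fst_notin[OF assms(1) cracked_sets] AE_space[of "lebesgue_on ?U"]
      by eventually_elim (auto simp: eq Omega_def)
    then show ?thesis
      by (intro integral_cong_AE measurable_diag_form[OF G] assms)
  qed
  then show ?thesis unfolding energies_def by (metis (no_types, lifting))
qed

context stretching
begin

lemma vimage_cracked:
  assumes "f 0 = 0" "f L = L"
  shows "stretch f -` (Omega L H - crack (f l)) = Omega L H - crack l"
proof -
  have "f x < f y \<longleftrightarrow> x < y" "f x \<le> f y \<longleftrightarrow> x \<le> y" for x y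
    using mono by (simp_all add: strict_mono_less strict_mono_less_eq)
  from this[of 0] this[of _ L] this[of _ l] assms show ?thesis
    by (auto simp: stretch_def Omega_def crack_def)
qed

lemma vimage_half:
  assumes "f 0 = 0" "f L = L"
  shows "stretch f -` ({0<..<L} \<times> J) = {0<..<L} \<times> J"
proof -
  have "f x < f y \<longleftrightarrow> x < y" for x y
    using mono by (simp add: strict_mono_less)
  from this[of 0] this[of _ L] assms show ?thesis
    by (auto simp: stretch_def)
qed

lemma admissible_stretch:
  assumes f: "f 0 = 0" "f L = L" and u: "u \<in> admissible L H h (f l)"
  shows "(\<lambda>x. u (stretch f x)) \<in> admissible L H h l"
proof -
  obtain G where "weak_gradient (Omega L H - crack (f l)) u G"
    using u by (auto simp: admissible_def H1_def)
  from weak_gradient_stretch[OF open_cracked bounded_cracked this]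
  have "(\<lambda>x. u (stretch f x)) \<in> H1 (Omega L H - crack l)"
    using vimage_cracked[OF f] by (auto simp: H1_def)
  moreover have "has_trace ({0<..<L} \<times> J) a J (\<lambda>x. u (stretch f x)) (\<lambda>t. h (a, t))"
    if J: "J \<in> {{-H<..<0}, {0<..<H}}" and a: "a \<in> {0, L}" for J a
  proof (rule has_trace_stretch[OF _ _ vimage_half[OF f]])
    show "open ({0<..<L} \<times> J)" using J by (auto intro: open_Times)
    show "bounded ({0<..<L} \<times> J)" using J by (auto intro: bounded_Times)
    show "f a = a" using a f by auto
    show "has_trace ({0<..<L} \<times> J) a J u (\<lambda>t. h (a, t))"
      using u J a unfolding admissible_def by blast
  qed
  ultimately show ?thesis by (simp add: admissible_def)
qed

text \<open>Of the two factors \<open>f'\<close> in the square of the stretched first derivative, the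
  Jacobian cancels one; in the second direction the Jacobian itself remains.\<close>

lemma energies_stretch_subset:
  assumes f: "f 0 = 0" "f L = L"
    and c: "c1 \<in> borel_measurable borel" "c2 \<in> borel_measurable borel"
  shows "energies L H h (\<lambda>x. (c1 (fst x), c2 (fst x))) (f l) \<subseteq>
      energies L H h (\<lambda>x. (c1 (f (fst x)) / f' (fst x), c2 (f (fst x)) * f' (fst x))) l"
proof
  let ?U = "Omega L H - crack (f l)"
  fix e assume "e \<in> energies L H h (\<lambda>x. (c1 (fst x), c2 (fst x))) (f l)"
  then obtain u G where e: "e = 1/2 * (\<integral>x. diag_form (c1 (fst x), c2 (fst x)) (G x) \<partial>lebesgue_on ?U)"
    and u: "u \<in> admissible L H h (f l)" and G: "weak_gradient ?U u G"
    by (auto simp: energies_def)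
  have mG: "G \<in> borel_measurable (lebesgue_on ?U)" using G by (simp add: weak_gradient_def L2_on_def)
  have *: "f' (fst x) * diag_form (c1 (fst (stretch f x)), c2 (fst (stretch f x))) (G (stretch f x)) =
      diag_form (c1 (f (fst x)) / f' (fst x), c2 (f (fst x)) * f' (fst x)) (stretch_grad f f' G x)" for x
  proof -
    have "fst (stretch f x) = f (fst x)" by (simp add: stretch_def)
    then show ?thesis
      using f'_pos[of "fst x"] unfolding diag_form_def stretch_grad_def
      by (simp add: field_simps power2_eq_square)
  qed
  have "e = 1/2 * (\<integral>x. diag_form (c1 (f (fst x)) / f' (fst x), c2 (f (fst x)) * f' (fst x))
      (stretch_grad f f' G x) \<partial>lebesgue_on (Omega L H - crack l))"
    using integral_stretch[OF measurable_diag_form[OF mG c] cracked_sets] 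
    unfolding e * vimage_cracked[OF f] by simp
  moreover have "weak_gradient (Omega L H - crack l) (\<lambda>x. u (stretch f x)) (stretch_grad f f' G)"
    using weak_gradient_stretch[OF open_cracked bounded_cracked G] vimage_cracked[OF f] by simp
  ultimately show "e \<in> energies L H h (\<lambda>x. (c1 (f (fst x)) / f' (fst x), c2 (f (fst x)) * f' (fst x))) l"
    using admissible_stretch[OF f u] unfolding energies_def by blast
qed

text \<open>The reverse inclusion is the same statement for the inverse stretch, applied to the
  transformed coefficients: since \<open>g' (f' \<circ> g) = 1\<close> off a finite set, it restores the constant
  ones.\<close>

lemma energies_stretch:
  assumes f: "f 0 = 0" "f L = L"
  shows "energies L H h (\<lambda>_. (a, b)) (f l) = energies L H h (\<lambda>x. (a / f' (fst x), b * f' (fst x))) l"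
proof
  show "energies L H h (\<lambda>_. (a, b)) (f l) \<subseteq> energies L H h (\<lambda>x. (a / f' (fst x), b * f' (fst x))) l"
    using energies_stretch_subset[OF f, of "\<lambda>_. a" "\<lambda>_. b"] by simp
  obtain F where F: "finite F" "\<And>y. y \<notin> F \<Longrightarrow> g' y * f' (g y) = 1" using deriv_product by blast
  have g: "g 0 = 0" "g L = L" using inverse(1) f by metis+
  note [measurable] = meas borel_measurable_continuous_onI[OF cont(2)]
  have "energies L H h (\<lambda>x. (a / f' (fst x), b * f' (fst x))) (g (f l)) \<subseteq>
      energies L H h (\<lambda>x. ((a / f' (g (fst x))) / g' (fst x), (b * f' (g (fst x))) * g' (fst x))) (f l)"
    using meas by (intro stretching.energies_stretch_subset[OF swap g]) measurable
  also have "\<dots> = energies L H h (\<lambda>x. (a, b)) (f l)"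
  proof (rule energies_cong[OF F(1)])
    fix t assume "t \<notin> F"
    then have *: "f' (g t) * g' t = 1" using F(2) by (simp add: mult.commute)
    then show "a / f' (g t) / g' t = a \<and> b * f' (g t) * g' t = b"
      by (simp add: mult.assoc)
  qed measurable
  finally show "energies L H h (\<lambda>x. (a / f' (fst x), b * f' (fst x))) l \<subseteq> energies L H h (\<lambda>_. (a, b)) (f l)"
    by (simp add: inverse)
qed

end

section \<open>Minimal values of linear forms with varying coefficients\<close>

definition min_value :: "'e::euclidean_space set \<Rightarrow> 'e \<Rightarrow> real" where
  "min_value K c = Inf ((\<lambda>p. c \<bullet> p) ` K)"

definition orthant :: "'e::euclidean_space set" where
  "orthant = {p. \<forall>i\<in>Basis. 0 \<le> p \<bullet> i}"

lemma inner_orthant_nonneg: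
  assumes "c \<in> orthant" "p \<in> orthant"
  shows "0 \<le> c \<bullet> p"
  using assms by (subst euclidean_inner) (auto simp: orthant_def intro!: sum_nonneg)

lemma closed_orthant: "closed (orthant :: 'a::euclidean_space set)"
  unfolding orthant_def Collect_ball_eq
  by (intro closed_INT ballI closed_Collect_le continuous_intros)

lemma norm_le_inner:
  fixes c p :: "'e::euclidean_space"
  assumes "0 < m" and c: "\<And>i. i \<in> Basis \<Longrightarrow> m \<le> c \<bullet> i" and p: "p \<in> orthant"
  shows "norm p \<le> c \<bullet> p / m"
proof -
  have "norm p \<le> (\<Sum>i\<in>Basis. \<bar>p \<bullet> i\<bar>)" by (rule norm_le_l1)
  also have "\<dots> \<le> (\<Sum>i\<in>Basis. (c \<bullet> i) * (p \<bullet> i) / m)"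
  proof (rule sum_mono)
    fix i :: 'e assume i: "i \<in> Basis"
    have "0 \<le> p \<bullet> i" using p i by (simp add: orthant_def)
    then show "\<bar>p \<bullet> i\<bar> \<le> (c \<bullet> i) * (p \<bullet> i) / m"
      using c[OF i] assms(1) by (simp add: pos_le_divide_eq mult.commute[of _ m] mult_right_mono)
  qed
  also have "\<dots> = c \<bullet> p / m" by (simp add: euclidean_inner[of c p] sum_divide_distrib)
  finally show ?thesis .
qed

lemma positive_lower_bound:
  fixes c :: "'e::euclidean_space"
  assumes "\<And>i. i \<in> Basis \<Longrightarrow> 0 < c \<bullet> i"
  obtains m where "0 < m" "\<And>i. i \<in> Basis \<Longrightarrow> m \<le> c \<bullet> i"
proof (rule that[of "Min ((\<lambda>i. c \<bullet> i) ` Basis)"])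
  show "0 < Min ((\<lambda>i. c \<bullet> i) ` Basis)" using assms by (subst Min_gr_iff) auto
qed auto

lemma min_value_le:
  assumes "K \<subseteq> orthant" "c \<in> orthant" "p \<in> K"
  shows "min_value K c \<le> c \<bullet> p"
  unfolding min_value_def using assms inner_orthant_nonneg
  by (intro cInf_lower) (auto intro!: bdd_belowI[of _ 0])

lemma min_value_attained:
  fixes K :: "'e::euclidean_space set"
  assumes K: "closed K" "K \<noteq> {}" "K \<subseteq> orthant" and c: "\<And>i. i \<in> Basis \<Longrightarrow> 0 < c \<bullet> i"
  obtains p where "p \<in> K" "min_value K c = c \<bullet> p" "\<And>q. q \<in> K \<Longrightarrow> c \<bullet> p \<le> c \<bullet> q"
proof -
  obtain m where m: "0 < m" "\<And>i. i \<in> Basis \<Longrightarrow> m \<le> c \<bullet> i" by (rule positive_lower_bound[of c, OF c], assumption, rule that)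
  obtain q where q: "q \<in> K" using K by blast
  let ?S = "K \<inter> {p. c \<bullet> p \<le> c \<bullet> q}"
  have "bounded ?S"
    unfolding bounded_iff
  proof (intro exI[of _ "c \<bullet> q / m"] ballI)
    fix p assume p: "p \<in> ?S"
    then have "norm p \<le> c \<bullet> p / m" using K(3) by (intro norm_le_inner m) auto
    also have "\<dots> \<le> c \<bullet> q / m" using p m by (intro divide_right_mono) auto
    finally show "norm p \<le> c \<bullet> q / m" .
  qed
  moreover have "closed ?S" using K(1) by (auto intro!: closed_Int closed_Collect_le continuous_intros)
  ultimately have "compact ?S" using compact_eq_bounded_closed by blast
  moreover have "?S \<noteq> {}" using q by auto
  moreover have "continuous_on ?S (\<lambda>p. c \<bullet> p)" by (intro continuous_intros)
  ultimately have "\<exists>p\<in>?S. \<forall>y\<in>?S. c \<bullet> p \<le> c \<bullet> y" by (rule continuous_attains_inf)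
  then obtain p where p: "p \<in> ?S" "\<And>y. y \<in> ?S \<Longrightarrow> c \<bullet> p \<le> c \<bullet> y" by blast
  have le: "c \<bullet> p \<le> c \<bullet> y" if "y \<in> K" for y
    using p that by (cases "c \<bullet> y \<le> c \<bullet> q") auto
  have "min_value K c = c \<bullet> p"
    unfolding min_value_def using p(1) le by (intro cInf_eq_minimum) auto
  with p(1) le show thesis by (intro that) auto
qed

text \<open>Uniqueness makes the graph of \<open>P\<close> the set of all pairs of a parameter and a
  minimizer, which is closed; the coercivity of positive coefficients on the orthant bounds the
  values of \<open>P\<close>.\<close>

lemma minimizer_continuous:
  fixes K :: "'e::euclidean_space set" and c :: "real \<Rightarrow> 'e"
  assumes K: "closed K" "K \<subseteq> orthant"
    and T: "compact T" and cont: "continuous_on T c" and pos: "\<And>t i. t \<in> T \<Longrightarrow> i \<in> Basis \<Longrightarrow> 0 < c t \<bullet> i"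
    and P: "\<And>t. t \<in> T \<Longrightarrow> P t \<in> K" "\<And>t q. t \<in> T \<Longrightarrow> q \<in> K \<Longrightarrow> c t \<bullet> P t \<le> c t \<bullet> q"
    and uniq: "\<And>t p. t \<in> T \<Longrightarrow> p \<in> K \<Longrightarrow> c t \<bullet> p \<le> c t \<bullet> P t \<Longrightarrow> p = P t"
  shows "continuous_on T P"
proof (cases "T = {}")
  case False
  have "\<exists>m>0. \<forall>t\<in>T. m \<le> c t \<bullet> i" if "i \<in> Basis" for i
  proof -
    have "continuous_on T (\<lambda>t. c t \<bullet> i)" using cont by (intro continuous_intros)
    from continuous_attains_inf[OF T False this] show ?thesis using pos[OF _ that] by blast
  qed
  then obtain \<mu> where \<mu>: "\<And>i. i \<in> Basis \<Longrightarrow> 0 < \<mu> i" "\<And>i t. i \<in> Basis \<Longrightarrow> t \<in> T \<Longrightarrow> \<mu> i \<le> c t \<bullet> i"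
    by metis
  define m where "m = Min (\<mu> ` Basis)"
  have m: "0 < m" "\<And>i t. i \<in> Basis \<Longrightarrow> t \<in> T \<Longrightarrow> m \<le> c t \<bullet> i"
    using \<mu> by (auto simp: m_def Min_gr_iff intro!: order_trans[OF Min_le])
  obtain t0 where t0: "t0 \<in> T" using False by blast
  have "continuous_on T (\<lambda>t. c t \<bullet> P t0)" using cont by (intro continuous_intros)
  from continuous_attains_sup[OF T False this] obtain B where B: "\<And>t. t \<in> T \<Longrightarrow> c t \<bullet> P t0 \<le> B" by blast
  have "norm (P t) \<le> B / m" if t: "t \<in> T" for t
  proof -
    have "norm (P t) \<le> c t \<bullet> P t / m" using m t P(1) K(2) by (intro norm_le_inner) auto
    also have "\<dots> \<le> B / m" using P(2)[OF t P(1)[OF t0]] B[OF t] m(1) by (intro divide_right_mono) auto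
    finally show ?thesis .
  qed
  then have im: "P \<in> T \<rightarrow> cball 0 (B / m)" by auto
  have graph: "(\<lambda>t. (t, P t)) ` T = {z \<in> T \<times> K. \<forall>q\<in>K. c (fst z) \<bullet> snd z \<le> c (fst z) \<bullet> q}" (is "_ = ?G")
  proof
    show "(\<lambda>t. (t, P t)) ` T \<subseteq> ?G" using P by auto
    show "?G \<subseteq> (\<lambda>t. (t, P t)) ` T" using P(1) uniq by force
  qed
  have "closed ?G"
  proof -
    have TK: "closed (T \<times> K)" by (rule closed_Times[OF compact_imp_closed[OF T] K(1)])
    have cf: "continuous_on (T \<times> K) (\<lambda>z. c (fst z))"
      by (intro continuous_on_compose2[OF cont] continuous_intros) auto
    have "closed {z \<in> T \<times> K. c (fst z) \<bullet> snd z \<le> c (fst z) \<bullet> q}" for q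
      using TK cf by (intro continuous_on_closed_Collect_le[OF _ _ TK] continuous_intros)
    then have "closed (T \<times> K \<inter> (\<Inter>q\<in>K. {z \<in> T \<times> K. c (fst z) \<bullet> snd z \<le> c (fst z) \<bullet> q}))"
      using TK by (intro closed_Int closed_INT) auto
    moreover have "?G = T \<times> K \<inter> (\<Inter>q\<in>K. {z \<in> T \<times> K. c (fst z) \<bullet> snd z \<le> c (fst z) \<bullet> q})" by auto
    ultimately show ?thesis by simp
  qed
  then show ?thesis
    using continuous_from_closed_graph[OF compact_cball im] graph by simp
qed simp

text \<open>Danskin's theorem. Using the minimizer at either parameter as a competitor at the
  other confines the difference quotient of the minimal value between \<open>q t \<bullet> P t0\<close> and
  \<open>q t \<bullet> P t\<close>, where \<open>q\<close> is the difference quotient of \<open>c\<close>.\<close>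

lemma min_value_has_derivative:
  fixes K :: "'e::euclidean_space set" and c :: "real \<Rightarrow> 'e"
  assumes K: "closed K" "K \<subseteq> orthant"
    and I: "open I" "t0 \<in> I" and pos: "\<And>t i. t \<in> I \<Longrightarrow> i \<in> Basis \<Longrightarrow> 0 < c t \<bullet> i"
    and deriv: "(c has_vector_derivative c') (at t0)"
    and P: "\<And>t. t \<in> I \<Longrightarrow> P t \<in> K" "\<And>t q. t \<in> I \<Longrightarrow> q \<in> K \<Longrightarrow> c t \<bullet> P t \<le> c t \<bullet> q"
    and cont: "isCont P t0"
  shows "((\<lambda>t. min_value K (c t)) has_real_derivative c' \<bullet> P t0) (at t0)"
proof -
  have mv: "min_value K (c t) = c t \<bullet> P t" if "t \<in> I" for t
    unfolding min_value_def using P that by (intro cInf_eq_minimum) auto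
  define q where "q t = (c t - c t0) /\<^sub>R (t - t0)" for t
  have q: "q \<midarrow>t0\<rightarrow> c'"
  proof (rule LIM_zero_cancel, rule tendsto_norm_zero_cancel, rule Lim_transform_eventually)
    show "(\<lambda>t. norm (c t - c t0 - (t - t0) *\<^sub>R c') / norm (t - t0)) \<midarrow>t0\<rightarrow> 0"
      using deriv by (simp add: has_vector_derivative_def has_derivative_iff_norm)
    have "norm (c t - c t0 - (t - t0) *\<^sub>R c') / norm (t - t0) = norm (q t - c')" if "t \<noteq> t0" for t
    proof -
      have "c t - c t0 - (t - t0) *\<^sub>R c' = (t - t0) *\<^sub>R (q t - c')"
        using that by (simp add: q_def scaleR_diff_right)
      then show ?thesis using that by simp
    qed
    then show "\<forall>\<^sub>F t in at t0. norm (c t - c t0 - (t - t0) *\<^sub>R c') / norm (t - t0) = norm (q t - c')"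
      by (simp add: eventually_at_filter)
  qed
  have P': "P \<midarrow>t0\<rightarrow> P t0" using cont by (simp add: isCont_def)
  let ?D = "\<lambda>t. (min_value K (c t) - min_value K (c t0)) / (t - t0)"
  have le: "norm (?D t - q t \<bullet> P t0) \<le> \<bar>q t \<bullet> P t - q t \<bullet> P t0\<bar>" if t: "t \<in> I" "t \<noteq> t0" for t
  proof -
    have q': "q t \<bullet> p = (c t \<bullet> p - c t0 \<bullet> p) / (t - t0)" for p
      by (simp add: q_def inner_diff_left divide_inverse_commute)
    have u: "min_value K (c t) - min_value K (c t0) \<le> c t \<bullet> P t0 - c t0 \<bullet> P t0"
      and l: "c t \<bullet> P t - c t0 \<bullet> P t \<le> min_value K (c t) - min_value K (c t0)"
      using P I(2) t(1) by (simp_all add: mv)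
    show ?thesis
    proof (cases "t0 < t")
      case True
      have "?D t \<le> q t \<bullet> P t0" "q t \<bullet> P t \<le> ?D t"
        unfolding q' using u l True by (intro divide_right_mono; simp)+
      then show ?thesis by simp
    next
      case False
      have "q t \<bullet> P t0 \<le> ?D t" "?D t \<le> q t \<bullet> P t"
        unfolding q' using u l False by (intro divide_right_mono_neg; simp)+
      then show ?thesis by simp
    qed
  qed
  have "(\<lambda>t. q t \<bullet> P t - q t \<bullet> P t0) \<midarrow>t0\<rightarrow> c' \<bullet> P t0 - c' \<bullet> P t0"
    by (intro tendsto_intros q P')
  then have z: "(\<lambda>t. \<bar>q t \<bullet> P t - q t \<bullet> P t0\<bar>) \<midarrow>t0\<rightarrow> 0" using tendsto_rabs by fastforce
  have "(\<lambda>t. ?D t - q t \<bullet> P t0) \<midarrow>t0\<rightarrow> 0"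
  proof (rule Lim_null_comparison[OF _ z])
    show "\<forall>\<^sub>F t in at t0. norm (?D t - q t \<bullet> P t0) \<le> \<bar>q t \<bullet> P t - q t \<bullet> P t0\<bar>"
      using eventually_at_in_open[OF I] by eventually_elim (rule le, auto)
  qed
  from tendsto_add[OF this tendsto_inner[OF q tendsto_const[of "P t0"]]]
  have "?D \<midarrow>t0\<rightarrow> c' \<bullet> P t0" by simp
  then show ?thesis by (simp add: has_field_derivative_iff)
qed

lemma min_value_C1:
  fixes K :: "'e::euclidean_space set" and c c' :: "real \<Rightarrow> 'e"
  assumes K: "closed K" "K \<noteq> {}" "K \<subseteq> orthant"
    and I: "open I" and pos: "\<And>t i. t \<in> I \<Longrightarrow> i \<in> Basis \<Longrightarrow> 0 < c t \<bullet> i"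
    and deriv: "\<And>t. t \<in> I \<Longrightarrow> (c has_vector_derivative c' t) (at t)" and c': "continuous_on I c'"
    and uniq: "\<And>t p q. t \<in> I \<Longrightarrow> p \<in> K \<Longrightarrow> q \<in> K \<Longrightarrow> c t \<bullet> p = min_value K (c t) \<Longrightarrow>
      c t \<bullet> q = min_value K (c t) \<Longrightarrow> p = q"
  obtains D where "continuous_on I D"
    "\<And>t. t \<in> I \<Longrightarrow> ((\<lambda>t. min_value K (c t)) has_real_derivative D t) (at t)"
proof -
  have "\<exists>p. p \<in> K \<and> min_value K (c t) = c t \<bullet> p \<and> (\<forall>q\<in>K. c t \<bullet> p \<le> c t \<bullet> q)" if "t \<in> I" for t
    by (rule min_value_attained[OF K pos[OF that]]) blast+
  then obtain P where P: "\<And>t. t \<in> I \<Longrightarrow> P t \<in> K" "\<And>t. t \<in> I \<Longrightarrow> min_value K (c t) = c t \<bullet> P t"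
    "\<And>t q. t \<in> I \<Longrightarrow> q \<in> K \<Longrightarrow> c t \<bullet> P t \<le> c t \<bullet> q" by metis
  have contc: "continuous_on I c"
    by (intro continuous_at_imp_continuous_on ballI has_vector_derivative_continuous[OF deriv])
  have contP: "isCont P t0" if t0: "t0 \<in> I" for t0
  proof -
    obtain e where e: "e > 0" "cball t0 e \<subseteq> I" using I t0 open_contains_cball by blast
    have "continuous_on (cball t0 e) P"
    proof (rule minimizer_continuous[OF K(1,3) compact_cball])
      show "continuous_on (cball t0 e) c" using contc e(2) by (rule continuous_on_subset)
      fix t p assume "t \<in> cball t0 e" "p \<in> K" "c t \<bullet> p \<le> c t \<bullet> P t"
      moreover from this(1) have t: "t \<in> I" using e(2) by blast
      ultimately have "c t \<bullet> p = min_value K (c t)"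
        using P(2)[OF t] P(3)[OF t \<open>p \<in> K\<close>] by linarith
      then show "p = P t" by (rule uniq[OF t \<open>p \<in> K\<close> P(1)[OF t] _ P(2)[OF t, symmetric]])
    qed (use e(2) pos P in auto)
    then show ?thesis using e(1) continuous_on_interior by fastforce
  qed
  show thesis
  proof
    show "continuous_on I (\<lambda>t. c' t \<bullet> P t)"
      by (rule continuous_on_inner[OF c' continuous_at_imp_continuous_on]) (blast intro: contP)
    show "((\<lambda>t. min_value K (c t)) has_real_derivative c' t \<bullet> P t) (at t)" if "t \<in> I" for t
      using P(1,3) by (intro min_value_has_derivative[OF K(1,3) I that pos deriv[OF that]] contP[OF that])
  qed
qed

lemma min_value_closure:
  assumes "S \<noteq> {}" "S \<subseteq> orthant" "c \<in> orthant"
  shows "min_value (closure S) c = min_value S c"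
proof (rule antisym)
  have cl: "closure S \<subseteq> orthant" using assms(2) closed_orthant closure_minimal by blast
  show "min_value (closure S) c \<le> min_value S c"
    unfolding min_value_def[of S] using assms closure_subset[of S]
    by (intro cInf_greatest) (auto intro!: min_value_le[OF cl])
  have "closure S \<subseteq> {p. min_value S c \<le> c \<bullet> p}"
    using assms by (intro closure_minimal) (auto intro!: min_value_le closed_Collect_le continuous_intros)
  then show "min_value S c \<le> min_value (closure S) c"
    unfolding min_value_def[of "closure S"] using assms(1) by (intro cInf_greatest) auto
qed

text \<open>The set of values of a tuple of nonnegative quadratic forms on a convex set has
  this property: \<open>r\<close> is the value at the midpoint and \<open>d\<close> the value at half the difference, so
  the equation is the parallelogram identity and the inequality bounds the change of a form by
  its value at the difference.\<close>

definition midpoint_convex :: "'e::euclidean_space set \<Rightarrow> bool" where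
  "midpoint_convex S \<longleftrightarrow> (\<forall>p\<in>S. \<forall>q\<in>S. \<exists>r\<in>S. \<exists>d\<in>orthant. r + d = (1/2) *\<^sub>R (p + q) \<and>
     (\<forall>s>0. \<forall>i\<in>Basis. \<bar>p \<bullet> i - q \<bullet> i\<bar> \<le> 2 / s * (d \<bullet> i) + s * (p \<bullet> i + q \<bullet> i)))"

text \<open>Along two minimizing sequences the midpoints cannot do better than the infimum, so
  the defects \<open>d\<close> tend to 0; then the inequality with arbitrarily small \<open>s\<close> identifies the two
  limits.\<close>

lemma midpoint_convex_unique_minimizer:
  fixes S :: "'e::euclidean_space set"
  assumes S: "S \<subseteq> orthant" "midpoint_convex S" and c: "\<And>i. i \<in> Basis \<Longrightarrow> 0 < c \<bullet> i"
    and p: "p \<in> closure S" "c \<bullet> p = min_value (closure S) c"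
    and q: "q \<in> closure S" "c \<bullet> q = min_value (closure S) c"
  shows "p = q"
proof -
  have cO: "c \<in> orthant" using c by (auto simp: orthant_def intro: less_imp_le)
  have ne: "S \<noteq> {}" using p(1) by auto
  let ?E = "min_value S c"
  have E: "min_value (closure S) c = ?E" by (rule min_value_closure[OF ne S(1) cO])
  obtain pn where pn: "\<And>n. pn n \<in> S" "pn \<longlonglongrightarrow> p" using p(1) closure_sequential by blast
  obtain qn where qn: "\<And>n. qn n \<in> S" "qn \<longlonglongrightarrow> q" using q(1) closure_sequential by blast
  define defect where "defect n r d \<longleftrightarrow> r \<in> S \<and> d \<in> orthant \<and> r + d = (1/2) *\<^sub>R (pn n + qn n) \<and>
     (\<forall>s>0. \<forall>i\<in>Basis. \<bar>pn n \<bullet> i - qn n \<bullet> i\<bar> \<le> 2 / s * (d \<bullet> i) + s * (pn n \<bullet> i + qn n \<bullet> i))" for n r d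
  have "\<forall>n. \<exists>r d. defect n r d"
  proof
    fix n
    from S(2)[unfolded midpoint_convex_def, THEN bspec, OF pn(1)[of n], THEN bspec, OF qn(1)[of n]]
    show "\<exists>r d. defect n r d" unfolding defect_def by blast
  qed
  then obtain r d where defect: "\<And>n. defect n (r n) (d n)" by metis
  have r: "\<And>n. r n \<in> S" and d: "\<And>n. d n \<in> orthant"
    and rd: "\<And>n. r n + d n = (1/2) *\<^sub>R (pn n + qn n)"
    and le: "\<And>n s i. s > 0 \<Longrightarrow> i \<in> Basis \<Longrightarrow>
      \<bar>pn n \<bullet> i - qn n \<bullet> i\<bar> \<le> 2 / s * (d n \<bullet> i) + s * (pn n \<bullet> i + qn n \<bullet> i)"
    using defect unfolding defect_def by (simp_all only:)
  have cd: "c \<bullet> d n \<le> (c \<bullet> pn n + c \<bullet> qn n) / 2 - ?E" for n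
  proof -
    have "c \<bullet> r n + c \<bullet> d n = (c \<bullet> pn n + c \<bullet> qn n) / 2"
      using arg_cong[OF rd[of n], of "\<lambda>x. c \<bullet> x"] by (simp add: inner_add_right)
    then show ?thesis using min_value_le[OF S(1) cO r[of n]] by linarith
  qed
  have "(\<lambda>n. (c \<bullet> pn n + c \<bullet> qn n) / 2 - ?E) \<longlonglongrightarrow> (c \<bullet> p + c \<bullet> q) / 2 - ?E"
    by (intro tendsto_intros pn(2) qn(2)) simp
  then have lim0: "(\<lambda>n. (c \<bullet> pn n + c \<bullet> qn n) / 2 - ?E) \<longlonglongrightarrow> 0" using p(2) q(2) E by simp
  obtain m where m: "0 < m" "\<And>i. i \<in> Basis \<Longrightarrow> m \<le> c \<bullet> i"
    by (rule positive_lower_bound[of c, OF c], assumption, rule that)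
  have dlim: "d \<longlonglongrightarrow> 0"
  proof (rule Lim_null_comparison)
    show "\<forall>\<^sub>F n in sequentially. norm (d n) \<le> ((c \<bullet> pn n + c \<bullet> qn n) / 2 - ?E) / m"
    proof (rule always_eventually, rule allI)
      fix n
      have "norm (d n) \<le> c \<bullet> d n / m" by (rule norm_le_inner[OF m d])
      also have "\<dots> \<le> ((c \<bullet> pn n + c \<bullet> qn n) / 2 - ?E) / m" using cd m(1) by (intro divide_right_mono) auto
      finally show "norm (d n) \<le> ((c \<bullet> pn n + c \<bullet> qn n) / 2 - ?E) / m" .
    qed
    show "(\<lambda>n. ((c \<bullet> pn n + c \<bullet> qn n) / 2 - ?E) / m) \<longlonglongrightarrow> 0"
      using tendsto_divide_zero[OF lim0] .
  qed
  show ?thesis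
  proof (rule euclidean_eqI)
    fix i :: 'e assume i: "i \<in> Basis"
    have "\<bar>p \<bullet> i - q \<bullet> i\<bar> \<le> s * (p \<bullet> i + q \<bullet> i)" if s: "s > 0" for s
    proof -
      have "(\<lambda>n. 2 / s * (d n \<bullet> i) + s * (pn n \<bullet> i + qn n \<bullet> i)) \<longlonglongrightarrow> 2 / s * (0 \<bullet> i) + s * (p \<bullet> i + q \<bullet> i)"
        by (intro tendsto_intros dlim pn(2) qn(2))
      moreover have "(\<lambda>n. \<bar>pn n \<bullet> i - qn n \<bullet> i\<bar>) \<longlonglongrightarrow> \<bar>p \<bullet> i - q \<bullet> i\<bar>"
        by (intro tendsto_intros pn(2) qn(2))
      ultimately have "\<bar>p \<bullet> i - q \<bullet> i\<bar> \<le> 2 / s * (0 \<bullet> i) + s * (p \<bullet> i + q \<bullet> i)"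
        using le[OF s i] by (intro LIMSEQ_le[of "\<lambda>n. \<bar>pn n \<bullet> i - qn n \<bullet> i\<bar>"]) auto
      then show ?thesis by simp
    qed
    note small = this
    have "\<bar>p \<bullet> i - q \<bullet> i\<bar> \<le> 0 + e" if e: "e > 0" for e
    proof -
      define b where "b = \<bar>p \<bullet> i + q \<bullet> i\<bar> + 1"
      have b: "b > 0" "p \<bullet> i + q \<bullet> i \<le> b" by (auto simp: b_def)
      have "\<bar>p \<bullet> i - q \<bullet> i\<bar> \<le> e / b * (p \<bullet> i + q \<bullet> i)" using e b by (intro small) simp
      also have "\<dots> \<le> e / b * b" using e b by (intro mult_left_mono) auto
      finally show ?thesis using b by simp
    qed
    then have "\<bar>p \<bullet> i - q \<bullet> i\<bar> \<le> 0" by (rule field_le_epsilon)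
    then show "p \<bullet> i = q \<bullet> i" by simp
  qed
qed

section \<open>Convexity of the admissible displacements\<close>

lemma L2_on_average:
  assumes "L2_on U p" "L2_on U q"
  shows "L2_on U (\<lambda>x. (1/2) *\<^sub>R (p x + q x))"
proof -
  have s: "L2_on U (\<lambda>x. c *\<^sub>R r x)" if "L2_on U r" for c and r :: "'a \<Rightarrow> 'b"
    using that by (auto simp: L2_on_def power_mult_distrib)
  have "L2_on U (\<lambda>x. (1/2) *\<^sub>R p x - (- 1/2) *\<^sub>R q x)"
    by (intro L2_on_diff s assms)
  then show ?thesis by (simp add: scaleR_add_right)
qed

lemma integral_average_le:
  assumes "L2_on U p" "L2_on U q"
  shows "(\<integral>x. (norm ((1/2) *\<^sub>R (p x + q x)))\<^sup>2 \<partial>lebesgue_on U) \<le>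
    ((\<integral>x. (norm (p x))\<^sup>2 \<partial>lebesgue_on U) + (\<integral>x. (norm (q x))\<^sup>2 \<partial>lebesgue_on U)) / 2"
proof -
  have "(norm ((1/2) *\<^sub>R (p x + q x)))\<^sup>2 \<le> ((norm (p x))\<^sup>2 + (norm (q x))\<^sup>2) / 2" for x
  proof -
    have "(norm (p x + q x))\<^sup>2 \<le> (norm (p x) + norm (q x))\<^sup>2"
      by (intro power_mono norm_triangle_ineq) simp
    also have "\<dots> \<le> 2 * (norm (p x))\<^sup>2 + 2 * (norm (q x))\<^sup>2"
      using sum_squares_bound[of "norm (p x)" "norm (q x)"] by (simp add: power2_sum)
    finally show ?thesis by (simp add: power_divide)
  qed
  then have "(\<integral>x. (norm ((1/2) *\<^sub>R (p x + q x)))\<^sup>2 \<partial>lebesgue_on U) \<le>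
      (\<integral>x. ((norm (p x))\<^sup>2 + (norm (q x))\<^sup>2) / 2 \<partial>lebesgue_on U)"
    using assms L2_on_average[OF assms] by (intro integral_mono) (auto simp: L2_on_def)
  also have "\<dots> = ((\<integral>x. (norm (p x))\<^sup>2 \<partial>lebesgue_on U) + (\<integral>x. (norm (q x))\<^sup>2 \<partial>lebesgue_on U)) / 2"
    using assms by (simp add: L2_on_def)
  finally show ?thesis .
qed

lemma integral_average_tendsto:
  assumes "\<And>k::nat. L2_on U (p k)" "\<And>k. L2_on U (q k)"
    and "(\<lambda>k. \<integral>x. (norm (p k x))\<^sup>2 \<partial>lebesgue_on U) \<longlonglongrightarrow> 0"
    and "(\<lambda>k. \<integral>x. (norm (q k x))\<^sup>2 \<partial>lebesgue_on U) \<longlonglongrightarrow> 0"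
  shows "(\<lambda>k. \<integral>x. (norm ((1/2) *\<^sub>R (p k x + q k x)))\<^sup>2 \<partial>lebesgue_on U) \<longlonglongrightarrow> 0"
proof (rule tendsto_sandwich[OF _ _ tendsto_const])
  show "(\<lambda>k. ((\<integral>x. (norm (p k x))\<^sup>2 \<partial>lebesgue_on U) + (\<integral>x. (norm (q k x))\<^sup>2 \<partial>lebesgue_on U)) / 2) \<longlonglongrightarrow> 0"
    using tendsto_divide_zero[OF tendsto_add_zero[OF assms(3,4)]] .
qed (use integral_average_le[OF assms(1,2)] in \<open>auto simp: integral_nonneg\<close>)

lemma weak_gradient_average:
  assumes U: "U \<in> lmeasurable" and uG: "weak_gradient U u G" and vE: "weak_gradient U v E"
  shows "weak_gradient U (\<lambda>x. (1/2) *\<^sub>R (u x + v x)) (\<lambda>x. (1/2) *\<^sub>R (G x + E x))"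
proof -
  note L = uG[unfolded weak_gradient_def] vE[unfolded weak_gradient_def]
  have "(\<integral>x. (1/2) *\<^sub>R (u x + v x) * partial_deriv b \<phi> x \<partial>lebesgue_on U) =
      - (\<integral>x. ((1/2) *\<^sub>R (G x + E x) \<bullet> b) * \<phi> x \<partial>lebesgue_on U)"
    if \<phi>: "\<phi> \<in> test_functions U" and b: "b \<in> Basis" for \<phi> b
  proof -
    obtain B where B: "\<And>x. \<bar>\<phi> x\<bar> \<le> B" "\<And>b x. b \<in> Basis \<Longrightarrow> \<bar>partial_deriv b \<phi> x\<bar> \<le> B"
      by (rule test_function_bounded[OF \<phi>], rule that)
    have C: "\<And>j. C_k j \<phi>" using \<phi> by (simp add: test_functions_def)
    have int: "integrable (lebesgue_on U) (\<lambda>x. p x * q x)"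
      if p: "integrable (lebesgue_on U) p" and q: "continuous_on UNIV q" "\<And>x. \<bar>q x\<bar> \<le> B" for p q :: "'a \<Rightarrow> real"
    proof (rule Bochner_Integration.integrable_bound)
      show "integrable (lebesgue_on U) (\<lambda>x. B * p x)" using p by simp
      have "q \<in> borel_measurable (lebesgue_on U)"
        using q(1) by (intro borel_imp_lebesgue_on borel_measurable_continuous_onI)
      then show "(\<lambda>x. p x * q x) \<in> borel_measurable (lebesgue_on U)" using p by simp
      have "norm (p x * q x) \<le> norm (B * p x)" for x
      proof -
        have "\<bar>q x\<bar> \<le> \<bar>B\<bar>" using q(2)[of x] by linarith
        then show ?thesis by (simp add: abs_mult mult.commute[of "\<bar>B\<bar>"] mult_left_mono)
      qed
      then show "AE x in lebesgue_on U. norm (p x * q x) \<le> norm (B * p x)" by simp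
    qed
    have d: "continuous_on UNIV (partial_deriv b \<phi>)" using C[of "Suc 0"] b by simp
    have c: "continuous_on UNIV \<phi>" using C[of 0] by simp
    have uv: "integrable (lebesgue_on U) u" "integrable (lebesgue_on U) v"
      "integrable (lebesgue_on U) G" "integrable (lebesgue_on U) E"
      using L U by (auto intro: integrable_L2_on)
    then have GE: "integrable (lebesgue_on U) (\<lambda>x. G x \<bullet> b)" "integrable (lebesgue_on U) (\<lambda>x. E x \<bullet> b)"
      by auto
    have "(\<integral>x. (1/2) *\<^sub>R (u x + v x) * partial_deriv b \<phi> x \<partial>lebesgue_on U) =
      (\<integral>x. (1/2) * (u x * partial_deriv b \<phi> x + v x * partial_deriv b \<phi> x) \<partial>lebesgue_on U)"
      by (intro Bochner_Integration.integral_cong) (auto simp: field_simps)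
    also have "\<dots> = (1/2) * ((\<integral>x. u x * partial_deriv b \<phi> x \<partial>lebesgue_on U) + (\<integral>x. v x * partial_deriv b \<phi> x \<partial>lebesgue_on U))"
      using int[OF uv(1) d B(2)[OF b]] int[OF uv(2) d B(2)[OF b]] by simp
    also have "\<dots> = - ((1/2) * ((\<integral>x. (G x \<bullet> b) * \<phi> x \<partial>lebesgue_on U) + (\<integral>x. (E x \<bullet> b) * \<phi> x \<partial>lebesgue_on U)))"
      using L \<phi> b by (simp add: field_simps)
    also have "(1/2) * ((\<integral>x. (G x \<bullet> b) * \<phi> x \<partial>lebesgue_on U) + (\<integral>x. (E x \<bullet> b) * \<phi> x \<partial>lebesgue_on U)) =
      (\<integral>x. (1/2) * ((G x \<bullet> b) * \<phi> x + (E x \<bullet> b) * \<phi> x) \<partial>lebesgue_on U)"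
      using int[OF GE(1) c B(1)] int[OF GE(2) c B(1)] by simp
    also have "\<dots> = (\<integral>x. ((1/2) *\<^sub>R (G x + E x) \<bullet> b) * \<phi> x \<partial>lebesgue_on U)"
      by (intro Bochner_Integration.integral_cong) (auto simp: inner_add_left field_simps)
    finally show ?thesis .
  qed
  moreover have "L2_on U u" "L2_on U v" "L2_on U G" "L2_on U E" using L by simp_all
  ultimately show ?thesis
    unfolding weak_gradient_def by (intro conjI ballI L2_on_average)
qed

text \<open>The squares of the trace errors must be integrable before their integrals can be
  compared; functions continuous up to the boundary are bounded on the side.\<close>

lemma L2_on_slice:
  assumes R: "bounded R" and J: "open J" "bounded J" "{a} \<times> J \<subseteq> closure R"
    and v: "continuous_on (closure R) (v :: real \<times> real \<Rightarrow> real)"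
  shows "L2_on J (\<lambda>t. v (a, t))"
proof -
  have Jl: "J \<in> lmeasurable" using J by (simp add: bounded_set_imp_lmeasurable lmeasurable_open)
  have c: "continuous_on J (\<lambda>t. v (a, t))"
    using J(3) by (intro continuous_on_compose2[OF v] continuous_intros) auto
  then have m: "(\<lambda>t. v (a, t)) \<in> borel_measurable (lebesgue_on J)"
    using Jl by (intro continuous_imp_measurable_on_sets_lebesgue) (auto intro: fmeasurableD)
  have "compact (v ` closure R)"
    using R v by (intro compact_continuous_image) auto
  then obtain B where B: "\<And>z. z \<in> closure R \<Longrightarrow> \<bar>v z\<bar> \<le> B"
    using compact_imp_bounded by (fastforce simp: bounded_iff)
  have "integrable (lebesgue_on J) (\<lambda>t. (norm (v (a, t)))\<^sup>2)"
  proof (rule Bochner_Integration.integrable_bound)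
    show "integrable (lebesgue_on J) (\<lambda>_. B\<^sup>2)"
      using finite_measure_lebesgue_on[OF Jl] by (intro finite_measure.integrable_const)
    have "norm ((norm (v (a, t)))\<^sup>2) \<le> norm (B\<^sup>2)" if "t \<in> J" for t
      using B[of "(a, t)"] that J(3) by (auto intro!: abs_le_square_iff[THEN iffD1])
    then show "AE t in lebesgue_on J. norm ((norm (v (a, t)))\<^sup>2) \<le> norm (B\<^sup>2)"
      by (intro AE_I2) simp
  qed (use m in measurable)
  with m show ?thesis by (simp add: L2_on_def)
qed

lemma has_trace_average:
  assumes R: "open R" "bounded R" and J: "open J" "bounded J" "{a} \<times> J \<subseteq> closure R"
    and u: "has_trace R a J u \<tau>" and w: "has_trace R a J w \<tau>"
  shows "has_trace R a J (\<lambda>x. (1/2) *\<^sub>R (u x + w x)) \<tau>"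
proof -
  have Rl: "R \<in> lmeasurable" using R by (simp add: bounded_set_imp_lmeasurable lmeasurable_open)
  have \<tau>: "L2_on J \<tau>" using u by (simp add: has_trace_def)
  obtain G v V where G: "weak_gradient R u G"
    and v: "\<And>k::nat. continuous_on (closure R) (v k)" "\<And>k. weak_gradient R (v k) (V k)"
    and lim: "(\<lambda>k. \<integral>x. (v k x - u x)\<^sup>2 \<partial>lebesgue_on R) \<longlonglongrightarrow> 0"
      "(\<lambda>k. \<integral>x. (norm (V k x - G x))\<^sup>2 \<partial>lebesgue_on R) \<longlonglongrightarrow> 0"
      "(\<lambda>k. \<integral>t. (v k (a, t) - \<tau> t)\<^sup>2 \<partial>lebesgue_on J) \<longlonglongrightarrow> 0"
    using u by (auto simp: has_trace_def)
  obtain G' v' V' where G': "weak_gradient R w G'"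
    and v': "\<And>k::nat. continuous_on (closure R) (v' k)" "\<And>k. weak_gradient R (v' k) (V' k)"
    and lim': "(\<lambda>k. \<integral>x. (v' k x - w x)\<^sup>2 \<partial>lebesgue_on R) \<longlonglongrightarrow> 0"
      "(\<lambda>k. \<integral>x. (norm (V' k x - G' x))\<^sup>2 \<partial>lebesgue_on R) \<longlonglongrightarrow> 0"
      "(\<lambda>k. \<integral>t. (v' k (a, t) - \<tau> t)\<^sup>2 \<partial>lebesgue_on J) \<longlonglongrightarrow> 0"
    using w by (auto simp: has_trace_def)
  have L: "L2_on R u" "L2_on R w" "L2_on R G" "L2_on R G'"
    "L2_on R (v k)" "L2_on R (V k)" "L2_on R (v' k)" "L2_on R (V' k)" for k
    using G G' v(2)[of k] v'(2)[of k] by (simp_all add: weak_gradient_def)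
  have eq: "(1/2) *\<^sub>R (p + q) - (1/2) *\<^sub>R (p' + q') = (1/2) *\<^sub>R ((p - p') + (q - q'))"
    for p p' q q' :: "'z::real_vector" by (simp add: algebra_simps)
  have eq\<tau>: "(1/2) *\<^sub>R (p + q) - r = (1/2) *\<^sub>R ((p - r) + (q - r))" for p q r :: real
    by (simp add: field_simps)
  have sq: "(norm r)\<^sup>2 = r\<^sup>2" for r :: real by simp
  show ?thesis
    unfolding has_trace_def
  proof (intro conjI exI allI)
    show "L2_on J \<tau>" by (rule \<tau>)
    show "weak_gradient R (\<lambda>x. (1/2) *\<^sub>R (u x + w x)) (\<lambda>x. (1/2) *\<^sub>R (G x + G' x))"
      by (rule weak_gradient_average[OF Rl G G'])
    show "continuous_on (closure R) ((\<lambda>k x. (1/2) *\<^sub>R (v k x + v' k x)) k)" for k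
      by (intro continuous_intros v v')
    show "weak_gradient R ((\<lambda>k x. (1/2) *\<^sub>R (v k x + v' k x)) k) ((\<lambda>k x. (1/2) *\<^sub>R (V k x + V' k x)) k)" for k
      by (rule weak_gradient_average[OF Rl v(2) v'(2)])
    show "(\<lambda>k. \<integral>x. ((\<lambda>k x. (1/2) *\<^sub>R (v k x + v' k x)) k x - (1/2) *\<^sub>R (u x + w x))\<^sup>2 \<partial>lebesgue_on R) \<longlonglongrightarrow> 0"
      unfolding eq using integral_average_tendsto[of R "\<lambda>k x. v k x - u x" "\<lambda>k x. v' k x - w x", unfolded sq]
      by (auto intro: L2_on_diff L lim lim')
    show "(\<lambda>k. \<integral>x. (norm ((\<lambda>k x. (1/2) *\<^sub>R (V k x + V' k x)) k x - (1/2) *\<^sub>R (G x + G' x)))\<^sup>2 \<partial>lebesgue_on R) \<longlonglongrightarrow> 0"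
      unfolding eq by (intro integral_average_tendsto L2_on_diff L lim lim')
    show "(\<lambda>k. \<integral>t. ((\<lambda>k x. (1/2) *\<^sub>R (v k x + v' k x)) k (a, t) - \<tau> t)\<^sup>2 \<partial>lebesgue_on J) \<longlonglongrightarrow> 0"
      unfolding eq\<tau>
      by (rule integral_average_tendsto[of J "\<lambda>k t. v k (a, t) - \<tau> t" "\<lambda>k t. v' k (a, t) - \<tau> t", unfolded sq])
        (intro L2_on_diff L2_on_slice[OF R(2) J v(1)] L2_on_slice[OF R(2) J v'(1)] \<tau> lim(3) lim'(3))+
  qed
qed

lemma admissible_average:
  assumes L: "0 < L" and u: "u \<in> admissible L H h l" and w: "w \<in> admissible L H h l"
  shows "(\<lambda>x. (1/2) *\<^sub>R (u x + w x)) \<in> admissible L H h l"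
proof -
  have Ul: "Omega L H - crack l \<in> lmeasurable"
    by (rule cracked_lmeasurable)
  have "(\<lambda>x. (1/2) *\<^sub>R (u x + w x)) \<in> H1 (Omega L H - crack l)"
    using u w weak_gradient_average[OF Ul] unfolding admissible_def H1_def by blast
  moreover have "has_trace ({0<..<L} \<times> J) a J (\<lambda>x. (1/2) *\<^sub>R (u x + w x)) (\<lambda>t. h (a, t))"
    if J: "J \<in> {{-H<..<0}, {0<..<H}}" and a: "a \<in> {0, L}" for J a
  proof (rule has_trace_average)
    show "open ({0<..<L} \<times> J)" "open J" using J by (auto intro: open_Times)
    show "bounded ({0<..<L} \<times> J)" "bounded J" using J by (auto intro: bounded_Times)
    show "{a} \<times> J \<subseteq> closure ({0<..<L} \<times> J)"
      using a L closure_subset[of J] by (auto simp: closure_Times)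
    show "has_trace ({0<..<L} \<times> J) a J u (\<lambda>t. h (a, t))" "has_trace ({0<..<L} \<times> J) a J w (\<lambda>t. h (a, t))"
      using u w J a unfolding admissible_def by blast+
  qed
  ultimately show ?thesis by (simp add: admissible_def)
qed

definition dirichlet_part ::
    "(real \<times> real) set \<Rightarrow> (real \<times> real) set \<Rightarrow> real \<times> real \<Rightarrow> (real \<times> real \<Rightarrow> real \<times> real) \<Rightarrow> real" where
  "dirichlet_part U W b G = 1/2 * (\<integral>x. indicator W x * (G x \<bullet> b)\<^sup>2 \<partial>lebesgue_on U)"

lemma integrable_dirichlet_part:
  assumes G: "L2_on U G" and W: "W \<in> sets lebesgue"
  shows "integrable (lebesgue_on U) (\<lambda>x. indicator W x * (G x \<bullet> b)\<^sup>2)"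
proof (rule Bochner_Integration.integrable_bound)
  have [measurable]: "G \<in> borel_measurable (lebesgue_on U)" using G by (simp add: L2_on_def)
  have [measurable]: "(indicator W :: _ \<Rightarrow> real) \<in> borel_measurable (lebesgue_on U)"
    using W by (intro measurable_restrict_space1 borel_measurable_indicator)
  show "(\<lambda>x. indicator W x * (G x \<bullet> b)\<^sup>2) \<in> borel_measurable (lebesgue_on U)" by measurable
  show "integrable (lebesgue_on U) (\<lambda>x. (norm b)\<^sup>2 * (norm (G x))\<^sup>2)"
    using G by (auto simp: L2_on_def)
  have "indicator W x * (G x \<bullet> b)\<^sup>2 \<le> (norm b)\<^sup>2 * (norm (G x))\<^sup>2" for x
  proof -
    have "indicator W x * (G x \<bullet> b)\<^sup>2 \<le> (G x \<bullet> b)\<^sup>2" by (simp add: indicator_def)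
    also have "\<dots> \<le> (norm (G x) * norm b)\<^sup>2"
      using Cauchy_Schwarz_ineq2[of "G x" b] by (simp add: abs_le_square_iff[symmetric])
    finally show ?thesis by (simp add: power_mult_distrib mult.commute)
  qed
  then show "AE x in lebesgue_on U. norm (indicator W x * (G x \<bullet> b)\<^sup>2) \<le> norm ((norm b)\<^sup>2 * (norm (G x))\<^sup>2)"
    by simp
qed

lemma dirichlet_part_nonneg: "0 \<le> dirichlet_part U W b G"
  by (simp add: dirichlet_part_def integral_nonneg)

text \<open>The second claim integrates \<open>\<bar>p\<^sup>2 - q\<^sup>2\<bar> = \<bar>p - q\<bar> \<bar>p + q\<bar>\<close> after a weighted
  application of the inequality between arithmetic and geometric means.\<close>

lemma
  assumes G: "L2_on U G" and E: "L2_on U E" and W: "W \<in> sets lebesgue"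
  shows dirichlet_part_parallelogram: "dirichlet_part U W b (\<lambda>x. (1/2) *\<^sub>R (G x + E x)) + dirichlet_part U W b (\<lambda>x. (1/2) *\<^sub>R (G x - E x)) =
      (dirichlet_part U W b G + dirichlet_part U W b E) / 2"
    and dirichlet_part_diff_le: "0 < s \<Longrightarrow> \<bar>dirichlet_part U W b G - dirichlet_part U W b E\<bar> \<le>
      2 / s * dirichlet_part U W b (\<lambda>x. (1/2) *\<^sub>R (G x - E x)) + s * (dirichlet_part U W b G + dirichlet_part U W b E)"
proof -
  have "L2_on U (\<lambda>x. (-1) *\<^sub>R E x)" using E by (auto simp: L2_on_def)
  from L2_on_average[OF G this] have D: "L2_on U (\<lambda>x. (1/2) *\<^sub>R (G x - E x))" by simp
  note i = integrable_dirichlet_part[OF G W, of b] integrable_dirichlet_part[OF E W, of b]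
    integrable_dirichlet_part[OF L2_on_average[OF G E] W, of b] integrable_dirichlet_part[OF D W, of b]
  let ?I = "indicator W :: real \<times> real \<Rightarrow> real"
  have "(\<integral>x. ?I x * ((1/2) *\<^sub>R (G x + E x) \<bullet> b)\<^sup>2 \<partial>lebesgue_on U) + (\<integral>x. ?I x * ((1/2) *\<^sub>R (G x - E x) \<bullet> b)\<^sup>2 \<partial>lebesgue_on U)
      = (\<integral>x. ?I x * ((1/2) *\<^sub>R (G x + E x) \<bullet> b)\<^sup>2 + ?I x * ((1/2) *\<^sub>R (G x - E x) \<bullet> b)\<^sup>2 \<partial>lebesgue_on U)"
    using i by simp
  also have "\<dots> = (\<integral>x. (?I x * (G x \<bullet> b)\<^sup>2 + ?I x * (E x \<bullet> b)\<^sup>2) / 2 \<partial>lebesgue_on U)"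
    by (intro Bochner_Integration.integral_cong)
      (auto simp: inner_add_left inner_diff_left power2_eq_square field_simps)
  also have "\<dots> = ((\<integral>x. ?I x * (G x \<bullet> b)\<^sup>2 \<partial>lebesgue_on U) + (\<integral>x. ?I x * (E x \<bullet> b)\<^sup>2 \<partial>lebesgue_on U)) / 2"
    using i by simp
  finally show "dirichlet_part U W b (\<lambda>x. (1/2) *\<^sub>R (G x + E x)) + dirichlet_part U W b (\<lambda>x. (1/2) *\<^sub>R (G x - E x)) =
      (dirichlet_part U W b G + dirichlet_part U W b E) / 2"
    unfolding dirichlet_part_def by (simp add: field_simps)
  assume s: "0 < s"
  have pw: "\<bar>p\<^sup>2 - q\<^sup>2\<bar> \<le> 2 / s * ((p - q) / 2)\<^sup>2 + s * (p\<^sup>2 + q\<^sup>2)" for p q :: real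
  proof -
    have "2 * (\<bar>p - q\<bar> * (s * \<bar>p + q\<bar>)) \<le> \<bar>p - q\<bar>\<^sup>2 + (s * \<bar>p + q\<bar>)\<^sup>2"
      using sum_squares_bound[of "\<bar>p - q\<bar>" "s * \<bar>p + q\<bar>"] by (simp add: mult.assoc)
    moreover have "\<bar>p - q\<bar> * \<bar>p + q\<bar> = \<bar>p\<^sup>2 - q\<^sup>2\<bar>"
      by (simp add: abs_mult[symmetric] power2_eq_square algebra_simps)
    moreover have "(s * \<bar>p + q\<bar>)\<^sup>2 \<le> s\<^sup>2 * (2 * (p\<^sup>2 + q\<^sup>2))"
    proof -
      have "(p + q)\<^sup>2 \<le> 2 * (p\<^sup>2 + q\<^sup>2)" using sum_squares_bound[of p q] by (simp add: power2_sum)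
      then show ?thesis by (simp add: power_mult_distrib mult_left_mono)
    qed
    ultimately have "2 * (s * \<bar>p\<^sup>2 - q\<^sup>2\<bar>) \<le> (p - q)\<^sup>2 + s\<^sup>2 * (2 * (p\<^sup>2 + q\<^sup>2))"
      by (simp add: mult.left_commute)
    moreover have "2 * s * (2 / s * ((p - q) / 2)\<^sup>2 + s * (p\<^sup>2 + q\<^sup>2)) = (p - q)\<^sup>2 + s\<^sup>2 * (2 * (p\<^sup>2 + q\<^sup>2))"
      using s by (simp add: field_simps power2_eq_square)
    ultimately have "2 * s * \<bar>p\<^sup>2 - q\<^sup>2\<bar> \<le> 2 * s * (2 / s * ((p - q) / 2)\<^sup>2 + s * (p\<^sup>2 + q\<^sup>2))"
      by (simp only: mult.assoc)
    then show ?thesis using s by simp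
  qed
  have "\<bar>(\<integral>x. ?I x * (G x \<bullet> b)\<^sup>2 \<partial>lebesgue_on U) - (\<integral>x. ?I x * (E x \<bullet> b)\<^sup>2 \<partial>lebesgue_on U)\<bar> =
      \<bar>\<integral>x. ?I x * (G x \<bullet> b)\<^sup>2 - ?I x * (E x \<bullet> b)\<^sup>2 \<partial>lebesgue_on U\<bar>"
    using i by simp
  also have "\<dots> \<le> (\<integral>x. \<bar>?I x * (G x \<bullet> b)\<^sup>2 - ?I x * (E x \<bullet> b)\<^sup>2\<bar> \<partial>lebesgue_on U)"
    by (rule integral_abs_bound)
  also have "\<dots> \<le> (\<integral>x. 2 / s * (?I x * ((1/2) *\<^sub>R (G x - E x) \<bullet> b)\<^sup>2) +
      s * (?I x * (G x \<bullet> b)\<^sup>2 + ?I x * (E x \<bullet> b)\<^sup>2) \<partial>lebesgue_on U)"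
    using i pw by (intro integral_mono) (auto simp: indicator_def inner_diff_left)
  also have "\<dots> = 2 / s * (\<integral>x. ?I x * ((1/2) *\<^sub>R (G x - E x) \<bullet> b)\<^sup>2 \<partial>lebesgue_on U) +
      s * ((\<integral>x. ?I x * (G x \<bullet> b)\<^sup>2 \<partial>lebesgue_on U) + (\<integral>x. ?I x * (E x \<bullet> b)\<^sup>2 \<partial>lebesgue_on U))"
    using i by simp
  finally show "\<bar>dirichlet_part U W b G - dirichlet_part U W b E\<bar> \<le>
      2 / s * dirichlet_part U W b (\<lambda>x. (1/2) *\<^sub>R (G x - E x)) + s * (dirichlet_part U W b G + dirichlet_part U W b E)"
    unfolding dirichlet_part_def right_diff_distrib[symmetric] distrib_left[symmetric] abs_mult
    by (simp add: field_simps)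
qed

text \<open>Each partial derivative contributes separately, on each side of the vertical line
  through the crack tip, because a stretch that moves the tip multiplies these four integrals by
  different factors.\<close>

definition dirichlet_parts :: "(real \<times> real) set \<Rightarrow> real \<Rightarrow> (real \<times> real \<Rightarrow> real \<times> real) \<Rightarrow> (real \<times> real) \<times> (real \<times> real)" where
  "dirichlet_parts U l G =
     ((dirichlet_part U {x. fst x < l} (1, 0) G, dirichlet_part U {x. fst x < l} (0, 1) G),
      (dirichlet_part U {x. l \<le> fst x} (1, 0) G, dirichlet_part U {x. l \<le> fst x} (0, 1) G))"

lemma half_planes: "{x :: real \<times> real. fst x < l} \<in> sets lebesgue" "{x :: real \<times> real. l \<le> fst x} \<in> sets lebesgue"
proof -
  have "open {x :: real \<times> real. fst x < l}" by (intro open_Collect_less continuous_intros)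
  moreover have "closed {x :: real \<times> real. l \<le> fst x}" by (intro closed_Collect_le continuous_intros)
  ultimately show "{x :: real \<times> real. fst x < l} \<in> sets lebesgue" "{x :: real \<times> real. l \<le> fst x} \<in> sets lebesgue"
    by (auto simp: borel_open borel_closed)
qed

lemma Basis_real4: "(Basis :: ((real \<times> real) \<times> (real \<times> real)) set) =
    {((1, 0), 0), ((0, 1), 0), (0, (1, 0)), (0, (0, 1))}"
  by (auto simp: Basis_prod_def Basis_real2)

lemma inner_dirichlet_parts: "((a\<^sub>1, b\<^sub>1), (a\<^sub>2, b\<^sub>2)) \<bullet> dirichlet_parts U l G =
    1/2 * (\<integral>x. diag_form (if fst x < l then a\<^sub>1 else a\<^sub>2, if fst x < l then b\<^sub>1 else b\<^sub>2) (G x) \<partial>lebesgue_on U)"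
  if G: "L2_on U G"
proof -
  note i = integrable_dirichlet_part[OF G half_planes(1), where l1 = l] integrable_dirichlet_part[OF G half_planes(2), where l1 = l]
  have "(\<integral>x. diag_form (if fst x < l then a\<^sub>1 else a\<^sub>2, if fst x < l then b\<^sub>1 else b\<^sub>2) (G x) \<partial>lebesgue_on U) =
    (\<integral>x. (a\<^sub>1 * (indicator {x. fst x < l} x * (G x \<bullet> (1, 0))\<^sup>2) + b\<^sub>1 * (indicator {x. fst x < l} x * (G x \<bullet> (0, 1))\<^sup>2)) +
      (a\<^sub>2 * (indicator {x. l \<le> fst x} x * (G x \<bullet> (1, 0))\<^sup>2) + b\<^sub>2 * (indicator {x. l \<le> fst x} x * (G x \<bullet> (0, 1))\<^sup>2)) \<partial>lebesgue_on U)"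
    by (intro Bochner_Integration.integral_cong) (auto simp: diag_form_def inner_prod_def indicator_def)
  then show ?thesis using i by (simp add: dirichlet_parts_def dirichlet_part_def algebra_simps)
qed

definition dirichlet_set :: "real \<Rightarrow> real \<Rightarrow> (real \<times> real \<Rightarrow> real) \<Rightarrow> real \<Rightarrow> ((real \<times> real) \<times> (real \<times> real)) set" where
  "dirichlet_set L H h l = {dirichlet_parts (Omega L H - crack l) l G | u G.
     u \<in> admissible L H h l \<and> weak_gradient (Omega L H - crack l) u G}"

lemma energies_step:
  "energies L H h (\<lambda>x. (if fst x < l then a\<^sub>1 else a\<^sub>2, if fst x < l then b\<^sub>1 else b\<^sub>2)) l =
    (\<lambda>p. ((a\<^sub>1, b\<^sub>1), (a\<^sub>2, b\<^sub>2)) \<bullet> p) ` dirichlet_set L H h l"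
proof -
  let ?U = "Omega L H - crack l"
  have "1/2 * (\<integral>x. diag_form (if fst x < l then a\<^sub>1 else a\<^sub>2, if fst x < l then b\<^sub>1 else b\<^sub>2) (G x) \<partial>lebesgue_on ?U) =
      ((a\<^sub>1, b\<^sub>1), (a\<^sub>2, b\<^sub>2)) \<bullet> dirichlet_parts ?U l G" if "weak_gradient ?U u G" for u G
    using inner_dirichlet_parts[of ?U G] that by (simp add: weak_gradient_def)
  note eq = this
  show ?thesis
  proof (intro subset_antisym subsetI)
    fix e assume "e \<in> energies L H h (\<lambda>x. (if fst x < l then a\<^sub>1 else a\<^sub>2, if fst x < l then b\<^sub>1 else b\<^sub>2)) l"
    then show "e \<in> (\<lambda>p. ((a\<^sub>1, b\<^sub>1), (a\<^sub>2, b\<^sub>2)) \<bullet> p) ` dirichlet_set L H h l"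
      unfolding energies_def dirichlet_set_def using eq by blast
  next
    fix e assume "e \<in> (\<lambda>p. ((a\<^sub>1, b\<^sub>1), (a\<^sub>2, b\<^sub>2)) \<bullet> p) ` dirichlet_set L H h l"
    then obtain u G where e: "e = ((a\<^sub>1, b\<^sub>1), (a\<^sub>2, b\<^sub>2)) \<bullet> dirichlet_parts ?U l G"
      and uG: "u \<in> admissible L H h l" "weak_gradient ?U u G"
      unfolding dirichlet_set_def by blast
    show "e \<in> energies L H h (\<lambda>x. (if fst x < l then a\<^sub>1 else a\<^sub>2, if fst x < l then b\<^sub>1 else b\<^sub>2)) l"
      unfolding energies_def using uG
      by (intro CollectI exI[of _ u] exI[of _ G] conjI) (simp_all only: e eq)
  qed
qed

lemma dirichlet_set_orthant: "dirichlet_set L H h l \<subseteq> orthant"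
  by (auto simp: dirichlet_set_def orthant_def Basis_real4 dirichlet_parts_def dirichlet_part_nonneg)

lemma midpoint_convex_dirichlet_set:
  assumes "0 < L"
  shows "midpoint_convex (dirichlet_set L H h l)"
  unfolding midpoint_convex_def
proof (intro ballI)
  let ?U = "Omega L H - crack l"
  have Ul: "?U \<in> lmeasurable"
    by (rule cracked_lmeasurable)
  fix p q assume "p \<in> dirichlet_set L H h l" "q \<in> dirichlet_set L H h l"
  then obtain u G v E where p: "p = dirichlet_parts ?U l G" "u \<in> admissible L H h l" "weak_gradient ?U u G"
    and q: "q = dirichlet_parts ?U l E" "v \<in> admissible L H h l" "weak_gradient ?U v E"
    unfolding dirichlet_set_def by blast
  have G: "L2_on ?U G" and E: "L2_on ?U E" using p(3) q(3) by (simp_all add: weak_gradient_def)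
  let ?r = "dirichlet_parts ?U l (\<lambda>x. (1/2) *\<^sub>R (G x + E x))"
  let ?d = "dirichlet_parts ?U l (\<lambda>x. (1/2) *\<^sub>R (G x - E x))"
  have "?r \<in> dirichlet_set L H h l"
    using admissible_average[OF assms p(2) q(2)] weak_gradient_average[OF Ul p(3) q(3)]
    unfolding dirichlet_set_def by blast
  moreover have "?d \<in> orthant"
    by (auto simp: orthant_def Basis_real4 dirichlet_parts_def dirichlet_part_nonneg)
  moreover have "?r + ?d = (1/2) *\<^sub>R (p + q)"
    unfolding p(1) q(1) dirichlet_parts_def
    using dirichlet_part_parallelogram[OF G E half_planes(1)] dirichlet_part_parallelogram[OF G E half_planes(2)] by simp
  moreover have "\<forall>s>0. \<forall>i\<in>Basis. \<bar>p \<bullet> i - q \<bullet> i\<bar> \<le> 2 / s * (?d \<bullet> i) + s * (p \<bullet> i + q \<bullet> i)"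
    unfolding p(1) q(1) dirichlet_parts_def Basis_real4
    using dirichlet_part_diff_le[OF G E half_planes(1)] dirichlet_part_diff_le[OF G E half_planes(2)] by simp
  ultimately show "\<exists>r\<in>dirichlet_set L H h l. \<exists>d\<in>orthant. r + d = (1/2) *\<^sub>R (p + q) \<and>
     (\<forall>s>0. \<forall>i\<in>Basis. \<bar>p \<bullet> i - q \<bullet> i\<bar> \<le> 2 / s * (d \<bullet> i) + s * (p \<bullet> i + q \<bullet> i))"
    by blast
qed

section \<open>Piecewise affine maps adapted to the layers\<close>

lemma smooth_approx_ident: "smooth_approx {} (\<lambda>x. x) (\<lambda>_. 1)"
  by (rule smooth_approxI[where h = "\<lambda>_ x. x" and h' = "\<lambda>_ _. 1" and M = 1])
    (auto intro: C_k_linear bounded_linear_ident derivative_eq_intros)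

lemma smooth_approx_zero: "smooth_approx {} (\<lambda>x. 0) (\<lambda>_. 0)"
  by (rule smooth_approxI[where h = "\<lambda>_ x. 0" and h' = "\<lambda>_ _. 0" and M = 0])
    (auto intro: C_k_const)

lemma smooth_approx_mono: "smooth_approx F f f' \<Longrightarrow> F \<subseteq> E \<Longrightarrow> finite E \<Longrightarrow> smooth_approx E f f'"
proof (elim smooth_approx.cases)
  fix h h' M
  assume h: "\<And>x. x \<notin> F \<Longrightarrow> (f has_real_derivative f' x) (at x)"
    "\<And>k j. C_k j (h k)" "\<And>k x. (h k has_real_derivative h' k x) (at x)"
    "\<And>k x. \<bar>h k x - f x\<bar> \<le> M / real (Suc k)" "\<And>k x. \<bar>h' k x\<bar> \<le> M"
    "\<And>x. x \<notin> F \<Longrightarrow> (\<lambda>k. h' k x) \<longlonglongrightarrow> f' x" and E: "F \<subseteq> E" "finite E"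
  show "smooth_approx E f f'"
    by (rule smooth_approxI[OF E(2) h(1) h(2-5) h(6)]) (use E(1) in auto)
qed

lemma smooth_approx_add:
  assumes "smooth_approx F f f'" "smooth_approx F g g'"
  shows "smooth_approx F (\<lambda>x. f x + g x) (\<lambda>x. f' x + g' x)"
  using assms(1)
proof cases
  case 1: (smooth_approxI h h' M)
  from assms(2) show ?thesis
  proof cases
    case 2: (smooth_approxI i i' N)
    show ?thesis
    proof (rule smooth_approxI[where h = "\<lambda>k x. h k x + i k x" and h' = "\<lambda>k x. h' k x + i' k x" and M = "M + N"])
      show "\<bar>h k x + i k x - (f x + g x)\<bar> \<le> (M + N) / real (Suc k)" for k x
        using 1(5)[of k x] 2(5)[of k x] unfolding add_divide_distrib by linarith
      show "\<bar>h' k x + i' k x\<bar> \<le> M + N" for k x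
        using 1(6)[of k x] 2(6)[of k x] by linarith
    qed (use 1 2 in \<open>auto intro: DERIV_add C_k_add tendsto_add\<close>)
  qed
qed

lemma smooth_approx_cmult:
  assumes "smooth_approx F f f'"
  shows "smooth_approx F (\<lambda>x. c * f x) (\<lambda>x. c * f' x)"
  using assms
proof cases
  case 1: (smooth_approxI h h' M)
  show ?thesis
  proof (rule smooth_approxI[where h = "\<lambda>k x. c * h k x" and h' = "\<lambda>k x. c * h' k x" and M = "\<bar>c\<bar> * M"])
    show "\<bar>c * h k x - c * f x\<bar> \<le> \<bar>c\<bar> * M / real (Suc k)" for k x
      using mult_left_mono[OF 1(5)[of k x], of "\<bar>c\<bar>"] by (simp add: abs_mult[symmetric] right_diff_distrib)
    show "\<bar>c * h' k x\<bar> \<le> \<bar>c\<bar> * M" for k x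
      using 1(6)[of k x] by (simp add: abs_mult mult_left_mono)
  qed (use 1 in \<open>auto intro!: C_k_mult C_k_const tendsto_mult DERIV_cmult\<close>)
qed

lemma smooth_approx_sum:
  assumes "finite F" "\<And>i. i \<in> I \<Longrightarrow> smooth_approx F (f i) (f' i)"
  shows "smooth_approx F (\<lambda>x. \<Sum>i\<in>I. f i x) (\<lambda>x. \<Sum>i\<in>I. f' i x)"
  using assms(2)
proof (induction I rule: infinite_finite_induct)
  case (insert i I)
  then show ?case using smooth_approx_add[of F "f i" "f' i"] by simp
qed (auto intro: smooth_approx_mono[OF smooth_approx_zero] assms(1))

text \<open>The value at 0 makes slopes continuous from the right, as the energy release at an
  interface requires.\<close>

definition rsgn :: "real \<Rightarrow> real" where
  "rsgn z = (if 0 \<le> z then 1 else - 1)"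

lemma C_k_shift:
  fixes f :: "real \<Rightarrow> real"
  shows "C_k k f \<Longrightarrow> C_k k (\<lambda>x. f (x - c))"
proof (induction k arbitrary: f)
  case 0
  then show ?case by (auto intro!: continuous_on_compose2[of UNIV f] continuous_intros)
next
  case (Suc k)
  show ?case
  proof (rule C_k_real_SucI)
    show "((\<lambda>x. f (x - c)) has_real_derivative partial_deriv 1 f (x - c)) (at x)" for x
      using DERIV_chain2[OF C_k_real_deriv[OF Suc.prems] DERIV_diff[OF DERIV_ident DERIV_const[of c]]] by simp
    show "C_k k (\<lambda>x. partial_deriv 1 f (x - c))"
      using Suc by simp
  qed
qed

lemma smooth_approx_abs_shift: "smooth_approx {c} (\<lambda>x. \<bar>x - c\<bar>) (\<lambda>x. rsgn (x - c))"
proof (rule smooth_approxI[where h = "\<lambda>k x. sqrt ((x - c)\<^sup>2 + (inverse (real (Suc k)))\<^sup>2)"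
      and h' = "\<lambda>k x. (x - c) / sqrt ((x - c)\<^sup>2 + (inverse (real (Suc k)))\<^sup>2)" and M = 1])
  fix k :: nat and x :: real
  have e: "0 < inverse (real (Suc k))" by simp
  show "C_k j (\<lambda>x. sqrt ((x - c)\<^sup>2 + (inverse (real (Suc k)))\<^sup>2))" for j
    by (rule C_k_shift[OF soft_abs_smooth[OF e]])
  show "((\<lambda>x. sqrt ((x - c)\<^sup>2 + (inverse (real (Suc k)))\<^sup>2)) has_real_derivative
      (x - c) / sqrt ((x - c)\<^sup>2 + (inverse (real (Suc k)))\<^sup>2)) (at x)"
    using DERIV_chain2[OF soft_abs_deriv[OF e] DERIV_diff[OF DERIV_ident DERIV_const[of c]]] by simp
  show "\<bar>sqrt ((x - c)\<^sup>2 + (inverse (real (Suc k)))\<^sup>2) - \<bar>x - c\<bar>\<bar> \<le> 1 / real (Suc k)"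
    using soft_abs_close[OF e, of "x - c"] by (simp add: inverse_eq_divide)
  show "\<bar>(x - c) / sqrt ((x - c)\<^sup>2 + (inverse (real (Suc k)))\<^sup>2)\<bar> \<le> 1"
    by (rule soft_sgn_le_1[OF e])
next
  fix x assume x: "x \<notin> {c}"
  have sg: "rsgn (x - c) = sgn (x - c)" using x by (simp add: rsgn_def sgn_if)
  show "((\<lambda>x. \<bar>x - c\<bar>) has_real_derivative rsgn (x - c)) (at x)"
  proof (cases "c < x")
    case True
    have "((\<lambda>x. x - c) has_real_derivative rsgn (x - c)) (at x)"
      using True by (auto simp: rsgn_def intro!: derivative_eq_intros)
    then show ?thesis
      by (rule has_field_derivative_transform_within_open[where S = "{c<..}"]) (use True in auto)
  next
    case False
    have "((\<lambda>x. c - x) has_real_derivative rsgn (x - c)) (at x)"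
      using False x by (auto simp: rsgn_def intro!: derivative_eq_intros)
    then show ?thesis
      by (rule has_field_derivative_transform_within_open[where S = "{..<c}"]) (use False x in auto)
  qed
  show "(\<lambda>k. (x - c) / sqrt ((x - c)\<^sup>2 + (inverse (real (Suc k)))\<^sup>2)) \<longlonglongrightarrow> rsgn (x - c)"
    unfolding sg using x by (intro soft_sgn_tendsto) simp
qed simp

lemma smooth_approx_abs:
  assumes "0 < p"
  shows "smooth_approx {q / p} (\<lambda>x. \<bar>p * x - q\<bar>) (\<lambda>x. p * rsgn (p * x - q))"
proof -
  have 1: "\<bar>p * x - q\<bar> = p * \<bar>x - q / p\<bar>" for x
  proof -
    have "p * x - q = p * (x - q / p)" using assms by (simp add: field_simps)
    then show ?thesis using assms by (simp add: abs_mult)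
  qed
  have 2: "rsgn (p * x - q) = rsgn (x - q / p)" for x
    using assms by (simp add: rsgn_def field_simps)
  show ?thesis unfolding 1 2 by (rule smooth_approx_cmult[OF smooth_approx_abs_shift])
qed

lemma rsgn_eventually_right:
  assumes "0 < p"
  shows "\<forall>\<^sub>F t in at_right s. rsgn (p * t - q) = rsgn (p * s - q)"
proof (cases "0 \<le> p * s - q")
  case True
  have "rsgn (p * t - q) = rsgn (p * s - q)" if "s < t" for t
  proof -
    have "p * s < p * t" using that assms by simp
    then have "0 \<le> p * t - q" using True by linarith
    then show ?thesis using True by (simp add: rsgn_def)
  qed
  then show ?thesis using eventually_at_right_less[of s] by (auto elim: eventually_mono)
next
  case False
  then have "s < q / p" using assms by (simp add: field_simps)
  then have "\<forall>\<^sub>F t in at_right s. t < q / p" by (rule order_tendstoD(2)[OF tendsto_ident_at])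
  then show ?thesis using assms False by (auto elim!: eventually_mono simp: rsgn_def field_simps)
qed

text \<open>On a cell of length 1 the second slope is determined by the first: the cell is
  mapped onto itself exactly if \<open>lam a + (1 - lam) b = 1\<close>.\<close>

definition cell_map :: "real \<Rightarrow> real \<Rightarrow> real \<Rightarrow> real" where
  "cell_map lam a z = (if z < lam then a * z else 1 - (1 - lam * a) / (1 - lam) * (1 - z))"

definition cell_slope :: "real \<Rightarrow> real \<Rightarrow> real \<Rightarrow> real" where
  "cell_slope lam a z = (if z < lam then a else (1 - lam * a) / (1 - lam))"

definition layer_map :: "real \<Rightarrow> nat \<Rightarrow> real \<Rightarrow> real \<Rightarrow> real \<Rightarrow> real" where
  "layer_map L n lam a x = (let y = real n / L * x in
     if 0 \<le> y \<and> y < real n then L / real n * (of_int \<lfloor>y\<rfloor> + cell_map lam a (frac y)) else x)"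

definition layer_slope :: "real \<Rightarrow> nat \<Rightarrow> real \<Rightarrow> real \<Rightarrow> real \<Rightarrow> real" where
  "layer_slope L n lam a x = (let y = real n / L * x in
     if 0 \<le> y \<and> y < real n then cell_slope lam a (frac y) else 1)"

text \<open>The hat function on the unit interval whose maximum \<open>lam\<close> is attained at \<open>lam\<close>.
  Written with absolute values, it inherits their smooth approximation.\<close>

definition tent :: "real \<Rightarrow> real \<Rightarrow> real" where
  "tent lam z = \<bar>z\<bar> / 2 - \<bar>z - lam\<bar> / (2 * (1 - lam)) + lam * \<bar>z - 1\<bar> / (2 * (1 - lam))"

definition tent_slope :: "real \<Rightarrow> real \<Rightarrow> real" where
  "tent_slope lam z = rsgn z / 2 - rsgn (z - lam) / (2 * (1 - lam)) + lam * rsgn (z - 1) / (2 * (1 - lam))"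

lemma tent_coefficients:
  assumes "lam < 1"
  obtains r where "lam * r = r - 1/2"
    "\<And>a. (1 - lam * a) / (1 - lam) = 2 * r - a * (2 * r - 1)"
    "\<And>z. tent lam z = \<bar>z\<bar> / 2 - r * \<bar>z - lam\<bar> + (r - 1/2) * \<bar>z - 1\<bar>"
    "\<And>z. tent_slope lam z = rsgn z / 2 - r * rsgn (z - lam) + (r - 1/2) * rsgn (z - 1)"
proof
  let ?r = "1 / (2 * (1 - lam))"
  show l: "lam * ?r = ?r - 1/2" using assms by (simp add: field_simps)
  have e: "lam / (1 - lam) = 2 * ?r - 1" using assms by (simp add: field_simps)
  show "(1 - lam * a) / (1 - lam) = 2 * ?r - a * (2 * ?r - 1)" for a
  proof -
    have "2 * ?r = 1 / (1 - lam)" using assms by (simp add: field_simps)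
    then show ?thesis unfolding e[symmetric] by (simp add: diff_divide_distrib mult.commute)
  qed
  show "tent lam z = \<bar>z\<bar> / 2 - ?r * \<bar>z - lam\<bar> + (?r - 1/2) * \<bar>z - 1\<bar>"
    "tent_slope lam z = rsgn z / 2 - ?r * rsgn (z - lam) + (?r - 1/2) * rsgn (z - 1)" for z
    unfolding l[symmetric] by (simp_all add: tent_def tent_slope_def)
qed

lemma
  assumes lam: "0 < lam" "lam < 1"
  shows tent_outside: "\<not> (0 \<le> z \<and> z < 1) \<Longrightarrow> tent lam z = 0"
    and tent_slope_outside: "\<not> (0 \<le> z \<and> z < 1) \<Longrightarrow> tent_slope lam z = 0"
    and cell_map_tent: "0 \<le> z \<Longrightarrow> z < 1 \<Longrightarrow> cell_map lam a z = z + (a - 1) * tent lam z"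
    and cell_slope_tent: "0 \<le> z \<Longrightarrow> z < 1 \<Longrightarrow> cell_slope lam a z = 1 + (a - 1) * tent_slope lam z"
proof -
  obtain r where r: "lam * r = r - 1/2"
    and b: "(1 - lam * a) / (1 - lam) = 2 * r - a * (2 * r - 1)"
    and t: "tent lam z = \<bar>z\<bar> / 2 - r * \<bar>z - lam\<bar> + (r - 1/2) * \<bar>z - 1\<bar>"
    and t': "tent_slope lam z = rsgn z / 2 - r * rsgn (z - lam) + (r - 1/2) * rsgn (z - 1)"
    by (rule tent_coefficients[OF lam(2)], rule that)
  have r': "r * lam = r - 1/2" using r by (simp add: mult.commute)
  { assume "\<not> (0 \<le> z \<and> z < 1)"
    then consider "z < 0" | "1 \<le> z" by linarith
    then show "tent lam z = 0"
      by cases (use lam in \<open>simp_all add: t r r' field_simps\<close>) }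
  { assume "\<not> (0 \<le> z \<and> z < 1)"
    then consider "z < 0" | "1 \<le> z" by linarith
    then show "tent_slope lam z = 0"
      by cases (use lam in \<open>simp_all add: t' rsgn_def r r' field_simps\<close>) }
  assume z: "0 \<le> z" "z < 1"
  show "cell_map lam a z = z + (a - 1) * tent lam z"
  proof (cases "z < lam")
    case True
    then have "tent lam z = z" using z by (simp add: t r r' field_simps)
    then show ?thesis using True by (simp add: cell_map_def algebra_simps)
  next
    case False
    then have tz: "tent lam z = (1 - z) * (2 * r - 1)" using z by (simp add: t r r' field_simps)
    show ?thesis using False unfolding cell_map_def b tz by (simp add: algebra_simps)
  qed
  show "cell_slope lam a z = 1 + (a - 1) * tent_slope lam z"
  proof (cases "z < lam")
    case True
    then show ?thesis using z by (simp add: cell_slope_def t' rsgn_def r r' field_simps)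
  next
    case False
    then have tz: "tent_slope lam z = 1 - 2 * r" using z by (simp add: t' rsgn_def r r' field_simps)
    show ?thesis using False unfolding cell_slope_def b tz by (simp add: algebra_simps)
  qed
qed

text \<open>At most one cell contains \<open>y\<close>, so all but one summand vanish.\<close>

lemma sum_cells:
  fixes q :: "real \<Rightarrow> real"
  assumes q: "\<And>z. \<not> (0 \<le> z \<and> z < 1) \<Longrightarrow> q z = 0"
  shows "(\<Sum>j<n. q (y - real j)) = (if 0 \<le> y \<and> y < real n then q (frac y) else 0)"
proof (cases "0 \<le> y \<and> y < real n")
  case True
  then have k: "nat \<lfloor>y\<rfloor> < n" and y: "y - real (nat \<lfloor>y\<rfloor>) = frac y"
    by (simp_all add: frac_def nat_less_iff floor_less_iff)
  have "(\<Sum>j<n. q (y - real j)) = (\<Sum>j<n. if j = nat \<lfloor>y\<rfloor> then q (frac y) else 0)"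
  proof (rule sum.cong[OF refl])
    fix j
    have "q (y - real j) = 0" if "j \<noteq> nat \<lfloor>y\<rfloor>"
    proof (rule q, rule notI)
      assume "0 \<le> y - real j \<and> y - real j < 1"
      then have "\<lfloor>y\<rfloor> = int j" by (intro floor_unique) auto
      with that show False by simp
    qed
    then show "q (y - real j) = (if j = nat \<lfloor>y\<rfloor> then q (frac y) else 0)" using y by auto
  qed
  also have "\<dots> = q (frac y)" using k by simp
  finally show ?thesis using True by simp
next
  case False
  have "q (y - real j) = 0" if "j < n" for j using False that by (intro q) auto
  then have "(\<Sum>j<n. q (y - real j)) = 0" by simp
  then show ?thesis using False by (simp only: if_False)
qed

context
  fixes L lam a :: real and n :: nat
  assumes L: "0 < L" and n: "0 < n" and lam: "0 < lam" "lam < 1"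
begin

lemma layer_map_tents: "layer_map L n lam a x = x + (a - 1) * (L / real n) * (\<Sum>j<n. tent lam (real n / L * x - real j))"
proof -
  let ?y = "real n / L * x"
  have x: "L / real n * ?y = x" using L n by simp
  have "L / real n * (of_int \<lfloor>?y\<rfloor> + cell_map lam a (frac ?y)) = L / real n * (?y + (a - 1) * tent lam (frac ?y))"
    using cell_map_tent[OF lam frac_ge_0 frac_lt_1, of a ?y] by (simp add: frac_def)
  also have "\<dots> = x + (a - 1) * (L / real n) * tent lam (frac ?y)"
    unfolding distrib_left x by (simp only: mult.assoc mult.left_commute)
  finally have inside: "L / real n * (of_int \<lfloor>?y\<rfloor> + cell_map lam a (frac ?y)) = x + (a - 1) * (L / real n) * tent lam (frac ?y)" .
  have S: "(\<Sum>j<n. tent lam (?y - real j)) = (if 0 \<le> ?y \<and> ?y < real n then tent lam (frac ?y) else 0)"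
    by (rule sum_cells) (rule tent_outside[OF lam])
  show ?thesis
    unfolding layer_map_def Let_def S inside
    by (cases "0 \<le> ?y \<and> ?y < real n") (simp_all only: if_True if_False mult_zero_right add_0_right simp_thms)
qed

lemma layer_slope_tents: "layer_slope L n lam a x = 1 + (a - 1) * (\<Sum>j<n. tent_slope lam (real n / L * x - real j))"
proof -
  let ?y = "real n / L * x"
  have S: "(\<Sum>j<n. tent_slope lam (?y - real j)) = (if 0 \<le> ?y \<and> ?y < real n then tent_slope lam (frac ?y) else 0)"
    by (rule sum_cells) (rule tent_slope_outside[OF lam])
  show ?thesis
    unfolding layer_slope_def Let_def S cell_slope_tent[OF lam frac_ge_0 frac_lt_1] by simp
qed

lemma finite_interfaces: "finite (interfaces L lam n)"
proof -
  have "interfaces L lam n = (\<lambda>k. real k * L / real n) ` {..n} \<union> (\<lambda>k. (real k + lam) * L / real n) ` {..<n}"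
    by (auto simp: interfaces_def)
  then show ?thesis by simp
qed

lemma smooth_approx_layer_map: "smooth_approx (interfaces L lam n) (layer_map L n lam a) (layer_slope L n lam a)"
proof -
  let ?p = "real n / L"
  have p: "0 < ?p" using L n by simp
  have abs: "smooth_approx (interfaces L lam n) (\<lambda>x. \<bar>?p * x - q\<bar>) (\<lambda>x. ?p * rsgn (?p * x - q))"
    if "q * L / real n \<in> interfaces L lam n" for q
    by (rule smooth_approx_mono[OF smooth_approx_abs[OF p]]) (use that finite_interfaces in auto)
  have tent: "smooth_approx (interfaces L lam n) (\<lambda>x. tent lam (?p * x - real j)) (\<lambda>x. ?p * tent_slope lam (?p * x - real j))"
    if j: "j < n" for j
  proof -
    have "real j * L / real n \<in> interfaces L lam n" "(real j + lam) * L / real n \<in> interfaces L lam n"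
      "(real j + 1) * L / real n \<in> interfaces L lam n"
    proof -
      show "real j * L / real n \<in> interfaces L lam n" using j less_imp_le unfolding interfaces_def by blast
      show "(real j + lam) * L / real n \<in> interfaces L lam n" using j unfolding interfaces_def by blast
      have "real (Suc j) * L / real n \<in> interfaces L lam n" using j Suc_leI unfolding interfaces_def by blast
      then show "(real j + 1) * L / real n \<in> interfaces L lam n" by (simp add: add.commute)
    qed
    note abs[OF this(1)] abs[OF this(2)] abs[OF this(3)]
    from smooth_approx_add[OF smooth_approx_add[OF smooth_approx_cmult[OF this(1), of "1/2"]
          smooth_approx_cmult[OF this(2), of "- 1 / (2 * (1 - lam))"]] smooth_approx_cmult[OF this(3), of "lam / (2 * (1 - lam))"]]
    show ?thesis by (simp add: tent_def tent_slope_def algebra_simps add_divide_distrib diff_divide_distrib)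
  qed
  have "smooth_approx (interfaces L lam n)
      (\<lambda>x. x + (a - 1) * (L / real n) * (\<Sum>j<n. tent lam (?p * x - real j)))
      (\<lambda>x. 1 + (a - 1) * (L / real n) * (\<Sum>j<n. ?p * tent_slope lam (?p * x - real j)))"
    using finite_interfaces by (intro smooth_approx_add smooth_approx_cmult smooth_approx_sum tent
        smooth_approx_mono[OF smooth_approx_ident]) auto
  moreover have "(a - 1) * (L / real n) * (\<Sum>j<n. ?p * tent_slope lam (?p * x - real j)) =
     (a - 1) * (\<Sum>j<n. tent_slope lam (?p * x - real j))" for x
    unfolding sum_distrib_left[symmetric] using L n by simp
  ultimately show ?thesis by (simp add: layer_map_tents[abs_def] layer_slope_tents[abs_def])
qed

lemma layer_slope_eventually_right: "\<forall>\<^sub>F t in at_right s. layer_slope L n lam a t = layer_slope L n lam a s"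
proof -
  let ?p = "real n / L"
  have p: "0 < ?p" using L n by simp
  have "\<forall>\<^sub>F t in at_right s. tent_slope lam (?p * t - real j) = tent_slope lam (?p * s - real j)" for j
    using rsgn_eventually_right[OF p, of "real j" s] rsgn_eventually_right[OF p, of "real j + lam" s]
      rsgn_eventually_right[OF p, of "real j + 1" s]
    by eventually_elim (simp add: tent_slope_def diff_diff_eq)
  then have "\<forall>\<^sub>F t in at_right s. \<forall>j\<in>{..<n}. tent_slope lam (?p * t - real j) = tent_slope lam (?p * s - real j)"
    by (intro eventually_ball_finite) auto
  then show ?thesis
    by eventually_elim (simp add: layer_slope_tents)
qed

lemma continuous_layer_map: "continuous_on UNIV (layer_map L n lam a)"
  unfolding layer_map_tents[abs_def] tent_def using lam by (intro continuous_intros) auto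

lemma measurable_layer_slope: "layer_slope L n lam a \<in> borel_measurable borel"
  unfolding layer_slope_tents[abs_def] tent_slope_def rsgn_def by measurable

lemma layer_map_fixed: "layer_map L n lam a 0 = 0" "layer_map L n lam a L = L"
  using L n lam by (simp_all add: layer_map_def cell_map_def)

lemma layer_slope_cases: "layer_slope L n lam a x \<in> {1, a, (1 - lam * a) / (1 - lam)}"
  by (simp add: layer_slope_def cell_slope_def Let_def)

end

lemma
  assumes lam: "0 < lam" "lam < 1" and a: "0 < a" "lam * a < 1"
  shows cell_map_bounds: "0 \<le> z \<Longrightarrow> z < 1 \<Longrightarrow> 0 \<le> cell_map lam a z \<and> cell_map lam a z < 1"
    and cell_map_strict: "z < z' \<Longrightarrow> cell_map lam a z < cell_map lam a z'"
    and cell_map_inverse: "cell_map (lam * a) (1 / a) (cell_map lam a z) = z"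
proof -
  define b where "b = (1 - lam * a) / (1 - lam)"
  have b: "0 < b" and b': "(1 - lam) / (1 - lam * a) = 1 / b" using lam a by (simp_all add: b_def)
  have cm: "cell_map lam a z = (if z < lam then a * z else 1 - b * (1 - z))" for z
    by (simp add: cell_map_def b_def)
  have bl: "b * (1 - lam) = 1 - lam * a" using lam by (simp add: b_def)
  have up: "lam * a \<le> 1 - b * (1 - z)" if "lam \<le> z" for z
  proof -
    have "b * (1 - z) \<le> b * (1 - lam)" using b that by simp
    then show ?thesis using bl by linarith
  qed
  have low: "a * z < lam * a" if "z < lam" for z using a that by (simp add: mult.commute)
  { assume z: "0 \<le> z" "z < 1"
    have "0 < b * (1 - z)" using b z by simp
    moreover have "0 < lam * a" using a lam by simp
    ultimately show "0 \<le> cell_map lam a z \<and> cell_map lam a z < 1"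
      using less_trans[OF low[of z] a(2)] up[of z] a z unfolding cm by (cases "z < lam") auto }
  { assume "z < z'"
    then show "cell_map lam a z < cell_map lam a z'"
      using less_le_trans[OF low[of z] up[of z']] a b unfolding cm by (auto simp: not_less) }
  show "cell_map (lam * a) (1 / a) (cell_map lam a z) = z"
  proof (cases "z < lam")
    case True
    then show ?thesis using low[OF True] a by (simp add: cm) (simp add: cell_map_def)
  next
    case False
    then have "\<not> 1 - b * (1 - z) < lam * a" using up[of z] by simp
    moreover have "1 - lam * a * (1 / a) = 1 - lam" using a by simp
    ultimately have "cell_map (lam * a) (1 / a) (1 - b * (1 - z)) = 1 - 1 / b * (b * (1 - z))"
      unfolding cell_map_def[of "lam * a"] by (simp add: b')
    then show ?thesis using False b by (simp add: cm)
  qed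
qed

context
  fixes L lam a :: real and n :: nat
  assumes L: "0 < L" and n: "0 < n" and lam: "0 < lam" "lam < 1" and a: "0 < a" "lam * a < 1"
begin

lemma layer_map_scaled: "real n / L * layer_map L n lam a x = (let y = real n / L * x in
     if 0 \<le> y \<and> y < real n then of_int \<lfloor>y\<rfloor> + cell_map lam a (frac y) else y)"
  using L n by (simp add: layer_map_def Let_def)

text \<open>Every cell is mapped onto itself. This gives closeness to the identity, strict
  monotonicity across cells, and the inverse.\<close>

lemma floor_layer_map: "\<lfloor>real n / L * layer_map L n lam a x\<rfloor> = \<lfloor>real n / L * x\<rfloor>"
proof -
  let ?y = "real n / L * x"
  have "\<lfloor>of_int \<lfloor>?y\<rfloor> + cell_map lam a (frac ?y)\<rfloor> = \<lfloor>?y\<rfloor>"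
    using cell_map_bounds[OF lam a frac_ge_0 frac_lt_1, of ?y] by (intro floor_unique) auto
  then show ?thesis unfolding layer_map_scaled Let_def by auto
qed

lemma layer_map_close: "\<bar>layer_map L n lam a x - x\<bar> \<le> L / real n"
proof -
  let ?p = "real n / L"
  have p: "0 < ?p" using L n by simp
  have "\<bar>?p * layer_map L n lam a x - ?p * x\<bar> \<le> 1"
    using floor_layer_map[of x] floor_correct[of "?p * x"] floor_correct[of "?p * layer_map L n lam a x"]
    by linarith
  then have "?p * \<bar>layer_map L n lam a x - x\<bar> \<le> 1"
    using p by (simp only: right_diff_distrib[symmetric] abs_mult abs_of_pos)
  then have "\<bar>layer_map L n lam a x - x\<bar> \<le> 1 / ?p"
    using p by (simp only: pos_le_divide_eq mult.commute)
  then show ?thesis by simp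
qed

lemma strict_mono_layer_map: "strict_mono (layer_map L n lam a)"
proof (rule strict_monoI)
  fix x x' :: real assume x: "x < x'"
  let ?p = "real n / L" and ?f = "layer_map L n lam a"
  have p: "0 < ?p" using L n by simp
  have y: "?p * x < ?p * x'" using x p by (rule mult_strict_left_mono)
  have "?p * ?f x < ?p * ?f x'"
  proof (cases "\<lfloor>?p * x\<rfloor> = \<lfloor>?p * x'\<rfloor>")
    case True
    have E: "(0 \<le> ?p * x \<and> ?p * x < real n) = (0 \<le> \<lfloor>?p * x\<rfloor> \<and> \<lfloor>?p * x\<rfloor> < int n)"
      "(0 \<le> ?p * x' \<and> ?p * x' < real n) = (0 \<le> \<lfloor>?p * x'\<rfloor> \<and> \<lfloor>?p * x'\<rfloor> < int n)"
      by (simp_all only: zero_le_floor floor_less_iff of_int_of_nat_eq)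
    have r: "(0 \<le> ?p * x \<and> ?p * x < real n) = (0 \<le> ?p * x' \<and> ?p * x' < real n)"
      by (simp only: E True)
    have "frac (?p * x) < frac (?p * x')" using y True by (simp only: frac_def)
    then have "cell_map lam a (frac (?p * x)) < cell_map lam a (frac (?p * x'))"
      by (rule cell_map_strict[OF lam a])
    then show ?thesis unfolding layer_map_scaled Let_def r using y True
      by (cases "0 \<le> ?p * x' \<and> ?p * x' < real n") (simp_all only: if_True if_False simp_thms add_left_mono add_less_cancel_left)
  next
    case False
    then have "\<lfloor>?p * x\<rfloor> < \<lfloor>?p * x'\<rfloor>" using floor_mono[OF less_imp_le[OF y]] by linarith
    then have "\<lfloor>?p * ?f x\<rfloor> < \<lfloor>?p * ?f x'\<rfloor>" by (simp only: floor_layer_map)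
    then show ?thesis by (meson floor_mono not_le)
  qed
  then show "?f x < ?f x'" using p by (simp only: mult_less_cancel_left_pos)
qed

end

text \<open>The inverse is a map of the same family, with the interface at \<open>lam * a\<close> and the
  slope \<open>1 / a\<close>.\<close>

lemma layer_map_inverse:
  assumes "0 < L" "0 < n" and lam: "0 < lam" "lam < 1" and a: "0 < a" "lam * a < 1"
  shows "layer_map L n (lam * a) (1 / a) (layer_map L n lam a x) = x"
proof -
  let ?p = "real n / L" let ?Y = "?p * layer_map L n lam a x" and ?y = "?p * x"
  have p: "?p \<noteq> 0" using assms by simp
  have fl: "\<lfloor>?Y\<rfloor> = \<lfloor>?y\<rfloor>" by (rule floor_layer_map[OF assms])
  have range_iff: "(0 \<le> y \<and> y < real n) = (0 \<le> \<lfloor>y\<rfloor> \<and> \<lfloor>y\<rfloor> < int n)" for y :: real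
    by (simp only: zero_le_floor floor_less_iff of_int_of_nat_eq)
  have "?p * layer_map L n (lam * a) (1 / a) (layer_map L n lam a x) =
     (if 0 \<le> ?Y \<and> ?Y < real n then of_int \<lfloor>?Y\<rfloor> + cell_map (lam * a) (1 / a) (frac ?Y) else ?Y)"
    using assms by (simp add: layer_map_def[of L n "lam * a"] Let_def)
  also have "\<dots> = ?y"
  proof (cases "0 \<le> ?y \<and> ?y < real n")
    case True
    then have "?Y = of_int \<lfloor>?y\<rfloor> + cell_map lam a (frac ?y)"
      using layer_map_scaled[OF assms, of x] by (simp only: Let_def if_True simp_thms)
    then have "?Y - of_int \<lfloor>?Y\<rfloor> = cell_map lam a (frac ?y)" unfolding fl by linarith
    then have "frac ?Y = cell_map lam a (frac ?y)" by (simp only: frac_def[of ?Y])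
    then have "cell_map (lam * a) (1 / a) (frac ?Y) = frac ?y"
      by (simp only: cell_map_inverse[OF lam a])
    moreover have "0 \<le> ?Y \<and> ?Y < real n" using True unfolding range_iff fl .
    ultimately show ?thesis by (simp only: if_True simp_thms fl) (simp add: frac_def)
  next
    case False
    then have "?Y = ?y"
      using layer_map_scaled[OF assms, of x] by (simp only: Let_def if_False)
    then show ?thesis using False by (simp only: if_False)
  qed
  finally show ?thesis using mult_left_cancel[OF p] by blast
qed

lemma stretching_layer_map:
  assumes L: "0 < L" "0 < n" and lam: "0 < lam" "lam < 1" and a: "0 < a" "lam * a < 1"
  obtains m M where "stretching (layer_map L n lam a) (layer_slope L n lam a)
    (layer_map L n (lam * a) (1 / a)) (layer_slope L n (lam * a) (1 / a)) m M"
proof -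
  have lam': "0 < lam * a" "lam * a < 1" and a': "0 < 1 / a" "lam * a * (1 / a) < 1"
    using lam a by simp_all
  let ?S = "{1, a, (1 - lam * a) / (1 - lam), 1 / a, (1 - lam * a * (1 / a)) / (1 - lam * a)}"
  have f: "layer_slope L n lam a x \<in> ?S" for x
    using layer_slope_cases[OF L lam, of a x] by auto
  have g: "layer_slope L n (lam * a) (1 / a) x \<in> ?S" for x
    using layer_slope_cases[OF L lam', of "1 / a" x] by auto
  have pos: "\<And>s. s \<in> ?S \<Longrightarrow> 0 < s" using lam a by auto
  have "stretching (layer_map L n lam a) (layer_slope L n lam a)
    (layer_map L n (lam * a) (1 / a)) (layer_slope L n (lam * a) (1 / a)) (Min ?S) (Max ?S)"
  proof
    show "\<exists>F. smooth_approx F (layer_map L n lam a) (layer_slope L n lam a)"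
      "\<exists>F. smooth_approx F (layer_map L n (lam * a) (1 / a)) (layer_slope L n (lam * a) (1 / a))"
      using smooth_approx_layer_map[OF L lam] smooth_approx_layer_map[OF L lam'] by blast+
    show "layer_map L n (lam * a) (1 / a) (layer_map L n lam a x) = x" for x
      by (rule layer_map_inverse[OF L lam a])
    show "layer_map L n lam a (layer_map L n (lam * a) (1 / a) x) = x" for x
      using layer_map_inverse[OF L lam' a', of x] a by simp
    show "strict_mono (layer_map L n lam a)" by (rule strict_mono_layer_map[OF L lam a])
    show "0 < Min ?S" using pos by (subst Min_gr_iff) auto
    show "Min ?S \<le> layer_slope L n lam a x" "layer_slope L n lam a x \<le> Max ?S"
      "Min ?S \<le> layer_slope L n (lam * a) (1 / a) x" "layer_slope L n (lam * a) (1 / a) x \<le> Max ?S" for x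
      using f[of x] g[of x] by (intro Min_le Max_ge; simp)+
  qed (rule continuous_layer_map[OF L lam] continuous_layer_map[OF L lam'] measurable_layer_slope[OF L lam]
      measurable_layer_slope[OF L lam'])+
  then show thesis by (rule that)
qed

lemma layer_index:
  assumes L: "0 < L" "0 < n" and x: "0 \<le> x" "x < L" and lam: "0 < lam" "lam < 1"
  shows "(\<exists>k<n. real k * L / real n \<le> x \<and> x < (real k + lam) * L / real n) \<longleftrightarrow> frac (real n / L * x) < lam"
proof -
  let ?y = "real n / L * x"
  have eq: "(real k * L / real n \<le> x \<and> x < (real k + lam) * L / real n) \<longleftrightarrow> real k \<le> ?y \<and> ?y < real k + lam" for k
    using L by (simp add: field_simps)
  have y: "0 \<le> ?y" "?y < real n" using L x by (simp_all add: field_simps)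
  show ?thesis unfolding eq
  proof
    assume "\<exists>k<n. real k \<le> ?y \<and> ?y < real k + lam"
    then obtain k where k: "real k \<le> ?y" "?y < real k + lam" by blast
    then have "\<lfloor>?y\<rfloor> = int k" using lam by (intro floor_unique) auto
    then show "frac ?y < lam" using k by (simp add: frac_def)
  next
    assume "frac ?y < lam"
    moreover have "real (nat \<lfloor>?y\<rfloor>) = ?y - frac ?y" using y by (simp add: frac_def)
    moreover have "nat \<lfloor>?y\<rfloor> < n" using y by (simp add: nat_less_iff floor_less_iff)
    ultimately show "\<exists>k<n. real k \<le> ?y \<and> ?y < real k + lam"
      using frac_ge_0[of ?y] by (intro exI[of _ "nat \<lfloor>?y\<rfloor>"]) auto
  qed
qed

lemma layer_slope_inside:
  assumes "0 < L" "0 < n" "0 \<le> x" "x < L"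
  shows "layer_slope L n lam a x = (if frac (real n / L * x) < lam then a else (1 - lam * a) / (1 - lam))"
proof -
  have "0 \<le> real n / L * x \<and> real n / L * x < real n" using assms by (simp add: field_simps)
  then show ?thesis by (simp only: layer_slope_def cell_slope_def Let_def if_True simp_thms)
qed

lemma toughness_inside:
  assumes "0 < L" "0 < n" "0 \<le> x" "x < L" "0 < lam" "lam < 1"
  shows "toughness L lam Gc\<^sub>A Gc\<^sub>B n x = (if frac (real n / L * x) < lam then Gc\<^sub>A else Gc\<^sub>B)"
  using layer_index[OF assms] assms(4) by (simp only: toughness_def) auto

lemma layer_index_open:
  assumes L: "0 < L" "0 < n" and x: "0 < x" "x < L" "x \<notin> interfaces L lam n" and lam: "0 < lam" "lam < 1"
  shows "(\<exists>k<n. real k * L / real n < x \<and> x < (real k + lam) * L / real n) \<longleftrightarrow> frac (real n / L * x) < lam"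
proof -
  have "real k * L / real n < x \<longleftrightarrow> real k * L / real n \<le> x" if "k < n" for k
  proof -
    have "real k * L / real n \<in> interfaces L lam n" using that less_imp_le unfolding interfaces_def by blast
    then show ?thesis using x(3) by (metis order.order_iff_strict)
  qed
  then have "(\<exists>k<n. real k * L / real n < x \<and> x < (real k + lam) * L / real n) \<longleftrightarrow>
      (\<exists>k<n. real k * L / real n \<le> x \<and> x < (real k + lam) * L / real n)" by blast
  also have "\<dots> \<longleftrightarrow> frac (real n / L * x) < lam"
    by (rule layer_index[OF L less_imp_le[OF x(1)] x(2) lam])
  finally show ?thesis .
qed

section \<open>The layered energy is a rescaled homogenized energy\<close>

lemma energies_layer_map:
  assumes L: "0 < L" "0 < n" and lam: "0 < lam" "lam < 1" and a: "0 < a" "lam * a < 1"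
  shows "energies L H h (\<lambda>_. (c, q)) (layer_map L n lam a l) =
    energies L H h (\<lambda>x. (c / layer_slope L n lam a (fst x), q * layer_slope L n lam a (fst x))) l"
proof -
  obtain m M where "stretching (layer_map L n lam a) (layer_slope L n lam a)
    (layer_map L n (lam * a) (1 / a)) (layer_slope L n (lam * a) (1 / a)) m M"
    by (rule stretching_layer_map[OF assms])
  then show ?thesis
    using layer_map_fixed[OF L lam] by (rule stretching.energies_stretch)
qed

text \<open>The slopes \<open>c / A\<^sub>1\<close> and \<open>c / B\<^sub>1\<close> turn the constant coefficient \<open>c\<close> into \<open>A\<^sub>1\<close> and
  \<open>B\<^sub>1\<close>; they turn \<open>q\<close> into \<open>A\<^sub>2\<close> and \<open>B\<^sub>2\<close> because \<open>q c\<close> is the common value of \<open>A\<^sub>1 A\<^sub>2\<close> and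
  \<open>B\<^sub>1 B\<^sub>2\<close>. The definition of \<open>c\<close> as a harmonic mean is the condition that a period is mapped
  onto itself.\<close>

lemma energy_n_eq:
  assumes L: "0 < L" "0 < n" and lam: "0 < lam" "lam < 1" and C: "0 < A\<^sub>1" "0 < B\<^sub>1" "B\<^sub>1 * B\<^sub>2 = A\<^sub>1 * A\<^sub>2"
    and c: "c = fst (C_hom lam (A\<^sub>1, A\<^sub>2) (B\<^sub>1, B\<^sub>2))"
  shows "0 < c" "lam * (c / A\<^sub>1) < 1" "(1 - lam * (c / A\<^sub>1)) / (1 - lam) = c / B\<^sub>1"
    and "energy_n L H h lam (A\<^sub>1, A\<^sub>2) (B\<^sub>1, B\<^sub>2) n l =
      energy_hom L H h lam (A\<^sub>1, A\<^sub>2) (B\<^sub>1, B\<^sub>2) (layer_map L n lam (c / A\<^sub>1) l)"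
proof -
  define r where "r = lam / A\<^sub>1 + (1 - lam) / B\<^sub>1"
  have r: "0 < r" using lam C by (simp add: r_def add_pos_pos)
  have cr: "c = 1 / r" by (simp add: c C_hom_def r_def)
  show c0: "0 < c" using r cr by simp
  have split: "lam * (c / A\<^sub>1) + (1 - lam) * (c / B\<^sub>1) = 1"
  proof -
    have "lam * (c / A\<^sub>1) + (1 - lam) * (c / B\<^sub>1) = c * r" by (simp add: r_def algebra_simps)
    then show ?thesis using r cr by simp
  qed
  have pos: "0 < (1 - lam) * (c / B\<^sub>1)" using lam C c0 by simp
  show a: "lam * (c / A\<^sub>1) < 1" using split pos by linarith
  have "1 - lam * (c / A\<^sub>1) = (1 - lam) * (c / B\<^sub>1)" using split by linarith
  then show b: "(1 - lam * (c / A\<^sub>1)) / (1 - lam) = c / B\<^sub>1" using lam by simp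
  define q where "q = lam * A\<^sub>2 + (1 - lam) * B\<^sub>2"
  have hom: "C_hom lam (A\<^sub>1, A\<^sub>2) (B\<^sub>1, B\<^sub>2) = (c, q)" by (simp add: c C_hom_def q_def)
  have B2: "B\<^sub>2 = A\<^sub>1 * A\<^sub>2 / B\<^sub>1" using C by (simp add: field_simps)
  have "q = A\<^sub>1 * A\<^sub>2 * r" unfolding q_def r_def B2 using C by (simp add: field_simps)
  then have qc: "q * c = A\<^sub>1 * A\<^sub>2" using r cr by simp
  have a0: "0 < c / A\<^sub>1" using c0 C by simp
  let ?s = "layer_slope L n lam (c / A\<^sub>1)"
  let ?P = "\<lambda>t. \<exists>k<n. real k * L / real n < t \<and> t < (real k + lam) * L / real n"
  have "energies L H h (\<lambda>x. (c / ?s (fst x), q * ?s (fst x))) l =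
    energies L H h (\<lambda>x. (if ?P (fst x) then A\<^sub>1 else B\<^sub>1, if ?P (fst x) then A\<^sub>2 else B\<^sub>2)) l"
  proof (rule energies_cong[OF finite_interfaces[OF L lam]])
    fix t assume t: "0 < t" "t < L" "t \<notin> interfaces L lam n"
    have P: "?P t \<longleftrightarrow> frac (real n / L * t) < lam"
      by (rule layer_index_open[OF L t lam])
    show "c / ?s t = (if ?P t then A\<^sub>1 else B\<^sub>1) \<and> q * ?s t = (if ?P t then A\<^sub>2 else B\<^sub>2)"
      unfolding P layer_slope_inside[OF L less_imp_le[OF t(1)] t(2)] b
      using C c0 qc by (auto simp: field_simps)
  qed (use measurable_layer_slope[OF L lam] in measurable)
  also have "(\<lambda>x::real\<times>real. (if ?P (fst x) then A\<^sub>1 else B\<^sub>1, if ?P (fst x) then A\<^sub>2 else B\<^sub>2)) = C_layer L lam (A\<^sub>1, A\<^sub>2) (B\<^sub>1, B\<^sub>2) n"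
    by (auto simp: C_layer_def fun_eq_iff)
  finally show "energy_n L H h lam (A\<^sub>1, A\<^sub>2) (B\<^sub>1, B\<^sub>2) n l =
      energy_hom L H h lam (A\<^sub>1, A\<^sub>2) (B\<^sub>1, B\<^sub>2) (layer_map L n lam (c / A\<^sub>1) l)"
    by (simp add: energy_n_def energy_hom_def min_energy_eq hom energies_layer_map[OF L lam a0 a])
qed

section \<open>The homogenized energy is continuously differentiable\<close>

lemma integrable_lebesgue_on_mono:
  fixes q :: "'a::euclidean_space \<Rightarrow> real"
  assumes q: "integrable (lebesgue_on U) q" and V: "V \<subseteq> U" "U \<in> sets lebesgue" "V \<in> sets lebesgue"
  shows "integrable (lebesgue_on V) q"
    and "(\<And>x. 0 \<le> q x) \<Longrightarrow> (\<integral>x. q x \<partial>lebesgue_on V) \<le> (\<integral>x. q x \<partial>lebesgue_on U)"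
proof -
  have iU: "integrable lebesgue (\<lambda>x. indicator U x *\<^sub>R q x)"
    using q V by (simp add: integrable_restrict_space)
  have "integrable lebesgue (\<lambda>x. indicator V x *\<^sub>R (indicator U x *\<^sub>R q x))"
    using integrable_mult_indicator[OF V(3) iU] .
  moreover have e: "indicator V x *\<^sub>R (indicator U x *\<^sub>R q x) = indicator V x *\<^sub>R q x" for x
    using V(1) by (auto simp: indicator_def)
  ultimately have iV: "integrable lebesgue (\<lambda>x. indicator V x *\<^sub>R q x)" by (simp only:)
  then show "integrable (lebesgue_on V) q" using V by (simp add: integrable_restrict_space)
  assume "\<And>x. 0 \<le> q x"
  then have "(\<integral>x. indicator V x *\<^sub>R q x \<partial>lebesgue) \<le> (\<integral>x. indicator U x *\<^sub>R q x \<partial>lebesgue)"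
    using V(1) by (intro integral_mono iU iV) (auto simp: indicator_def)
  then show "(\<integral>x. q x \<partial>lebesgue_on V) \<le> (\<integral>x. q x \<partial>lebesgue_on U)"
    using V by (simp add: integral_restrict_space)
qed

lemma L2_on_mono:
  assumes "L2_on U q" "V \<subseteq> U" "U \<in> sets lebesgue" "V \<in> sets lebesgue"
  shows "L2_on V q"
  using assms integrable_lebesgue_on_mono[of U "\<lambda>x. (norm (q x))\<^sup>2" V]
  by (auto simp: L2_on_def intro: measurable_restrict_mono)

lemma weak_gradient_mono:
  assumes uG: "weak_gradient U u G" and V: "V \<subseteq> U" "U \<in> sets lebesgue" "V \<in> sets lebesgue"
  shows "weak_gradient V u G"
proof -
  have "(\<integral>x. u x * partial_deriv b \<phi> x \<partial>lebesgue_on V) = - (\<integral>x. (G x \<bullet> b) * \<phi> x \<partial>lebesgue_on V)"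
    if \<phi>: "\<phi> \<in> test_functions V" and b: "b \<in> Basis" for \<phi> b
  proof -
    obtain K where K: "compact K" "K \<subseteq> V" "\<And>x. x \<notin> K \<Longrightarrow> \<phi> x = 0" and C: "\<And>k. C_k k \<phi>"
      using \<phi> by (auto simp: test_functions_def)
    have "\<phi> \<in> test_functions U" using \<phi> V(1) by (auto simp: test_functions_def)
    then have "(\<integral>x. u x * partial_deriv b \<phi> x \<partial>lebesgue_on U) = - (\<integral>x. (G x \<bullet> b) * \<phi> x \<partial>lebesgue_on U)"
      using uG b by (simp add: weak_gradient_def)
    moreover have "(\<integral>x. p x * q x \<partial>lebesgue_on U) = (\<integral>x. p x * q x \<partial>lebesgue_on V)"
      if "\<And>x. x \<notin> K \<Longrightarrow> q x = 0" for p q :: "'a \<Rightarrow> real"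
    proof -
      have eq: "indicator U x *\<^sub>R (p x * q x) = indicator V x *\<^sub>R (p x * q x)" for x
        using that[of x] K(2) V(1) by (auto simp: indicator_def)
      have on: "(\<integral>x. p x * q x \<partial>lebesgue_on W) = (\<integral>x. indicator W x *\<^sub>R (p x * q x) \<partial>lebesgue)"
        if "W \<in> sets lebesgue" for W
        using that by (simp add: integral_restrict_space)
      show ?thesis unfolding on[OF V(2)] on[OF V(3)] eq ..
    qed
    ultimately show ?thesis
      using K(3) test_function_zero[OF K(1,3)] by simp
  qed
  moreover have "L2_on V u" "L2_on V G"
    using uG unfolding weak_gradient_def by (blast intro: L2_on_mono[OF _ V])+
  ultimately show ?thesis by (simp add: weak_gradient_def)
qed

text \<open>A displacement admissible for the shorter crack, restricted to the complement of
  the longer crack, is admissible there and its energy does not increase.\<close>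

lemma min_energy_antimono:
  assumes "0 \<le> c" "0 \<le> q" and ne: "energies L H h (\<lambda>_. (c, q)) l \<noteq> {}" and l: "l \<le> l'"
  shows "min_energy L H h (\<lambda>_. (c, q)) l' \<le> min_energy L H h (\<lambda>_. (c, q)) l"
  unfolding min_energy_eq
proof (rule cInf_greatest[OF ne])
  let ?U = "\<lambda>l. Omega L H - crack l"
  fix e assume "e \<in> energies L H h (\<lambda>_. (c, q)) l"
  then obtain u G where e: "e = 1/2 * (\<integral>x. diag_form (c, q) (G x) \<partial>lebesgue_on (?U l))"
    and u: "u \<in> admissible L H h l" and G: "weak_gradient (?U l) u G"
    by (auto simp: energies_def)
  have sub: "?U l' \<subseteq> ?U l" using l by (auto simp: crack_def)
  have G': "weak_gradient (?U l') u G" by (rule weak_gradient_mono[OF G sub cracked_sets cracked_sets])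
  have u': "u \<in> admissible L H h l'" using u G' unfolding admissible_def H1_def by blast
  have nn: "0 \<le> diag_form (c, q) v" for v using assms(1,2) by (simp add: diag_form_def)
  have L2G: "L2_on (?U l) G" using G by (simp add: weak_gradient_def)
  have int: "integrable (lebesgue_on (?U l)) (\<lambda>x. diag_form (c, q) (G x))"
  proof -
    have "integrable (lebesgue_on (?U l)) (\<lambda>x. c * (indicator UNIV x * (G x \<bullet> (1, 0))\<^sup>2) + q * (indicator UNIV x * (G x \<bullet> (0, 1))\<^sup>2))"
      by (intro Bochner_Integration.integrable_add integrable_mult_right integrable_dirichlet_part[OF L2G]) auto
    then show ?thesis by (simp add: diag_form_def inner_prod_def)
  qed
  have "Inf (energies L H h (\<lambda>_. (c, q)) l') \<le> 1/2 * (\<integral>x. diag_form (c, q) (G x) \<partial>lebesgue_on (?U l'))"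
  proof (rule cInf_lower)
    show "1/2 * (\<integral>x. diag_form (c, q) (G x) \<partial>lebesgue_on (?U l')) \<in> energies L H h (\<lambda>_. (c, q)) l'"
      using u' G' unfolding energies_def by blast
    show "bdd_below (energies L H h (\<lambda>_. (c, q)) l')"
    proof (rule bdd_belowI)
      fix e assume "e \<in> energies L H h (\<lambda>_. (c, q)) l'"
      then obtain G where e: "e = 1/2 * (\<integral>x. diag_form (c, q) (G x) \<partial>lebesgue_on (?U l'))"
        unfolding energies_def by blast
      have "0 \<le> (\<integral>x. diag_form (c, q) (G x) \<partial>lebesgue_on (?U l'))"
        by (rule Bochner_Integration.integral_nonneg) (rule nn)
      then show "0 \<le> e" unfolding e by simp
    qed
  qed
  also have "\<dots> \<le> e"
    unfolding e using integrable_lebesgue_on_mono(2)[OF int sub cracked_sets cracked_sets nn] by simp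
  finally show "Inf (energies L H h (\<lambda>_. (c, q)) l') \<le> e" .
qed

text \<open>The coefficients of the energy at crack length \<open>t\<close> after the stretch with slopes
  \<open>t / l\<close> and \<open>(L - t) / (L - l)\<close>, which pulls the tip back to \<open>l\<close>.\<close>

definition tip_coefficients :: "real \<Rightarrow> real \<Rightarrow> real \<Rightarrow> real \<Rightarrow> real \<Rightarrow> (real \<times> real) \<times> (real \<times> real)" where
  "tip_coefficients L l c q t = ((c * l * inverse t, q / l * t), (c * (L - l) * inverse (L - t), q / (L - l) * (L - t)))"

text \<open>A single layer period of length \<open>L\<close> with its interface at \<open>l\<close> provides the stretch
  that moves the tip from \<open>l\<close> to \<open>t\<close>.\<close>

lemma energies_moved_tip:
  assumes l: "0 < l" "l < L" and t: "0 < t" "t < L"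
  shows "energies L H h (\<lambda>_. (c, q)) t = (\<lambda>p. tip_coefficients L l c q t \<bullet> p) ` dirichlet_set L H h l"
proof -
  let ?lam = "l / L" and ?a = "t / l"
  have L: "0 < L" "0 < (1::nat)" using l by simp_all
  have lam: "0 < ?lam" "?lam < 1" and a: "0 < ?a" "?lam * ?a < 1" using l t by simp_all
  have "frac (l / L) = l / L" using lam by (simp add: frac_eq)
  moreover have "\<lfloor>l / L\<rfloor> = 0" using lam by (intro floor_unique) auto
  ultimately have tip: "layer_map L 1 ?lam ?a l = t"
    using l t by (simp add: layer_map_def cell_map_def)
  have b: "(1 - ?lam * ?a) / (1 - ?lam) = (L - t) / (L - l)" using l t by (simp add: field_simps)
  let ?c1 = "\<lambda>x. if x < l then c * l * inverse t else c * (L - l) * inverse (L - t)"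
  let ?c2 = "\<lambda>x. if x < l then q / l * t else q / (L - l) * (L - t)"
  have "energies L H h (\<lambda>_. (c, q)) t =
      energies L H h (\<lambda>x. (c / layer_slope L 1 ?lam ?a (fst x), q * layer_slope L 1 ?lam ?a (fst x))) l"
    using energies_layer_map[OF L lam a, of H h c q l] unfolding tip .
  also have "\<dots> = energies L H h (\<lambda>x. (?c1 (fst x), ?c2 (fst x))) l"
  proof (rule energies_cong[of "{}"])
    fix x assume x: "0 < x" "x < L"
    have "frac (real 1 / L * x) = x / L" using x by (simp add: frac_eq)
    then have "frac (real 1 / L * x) < ?lam \<longleftrightarrow> x < l" using L by (simp add: divide_less_cancel)
    then have s: "layer_slope L 1 ?lam ?a x = (if x < l then ?a else (L - t) / (L - l))"
      unfolding layer_slope_inside[OF L less_imp_le[OF x(1)] x(2)] b by simp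
    show "c / layer_slope L 1 ?lam ?a x = ?c1 x \<and> q * layer_slope L 1 ?lam ?a x = ?c2 x"
      unfolding s by (simp add: divide_inverse ac_simps)
  qed (use measurable_layer_slope[OF L lam] in measurable)
  also have "\<dots> = (\<lambda>p. tip_coefficients L l c q t \<bullet> p) ` dirichlet_set L H h l"
    unfolding tip_coefficients_def by (rule energies_step)
  finally show ?thesis .
qed

lemma min_energy_C1:
  assumes l: "0 < l" "l < L" and c: "0 < c" "0 < q" and ne: "dirichlet_set L H h l \<noteq> {}"
  obtains D where "continuous_on {0<..<L} D"
    "\<And>t. t \<in> {0<..<L} \<Longrightarrow> ((\<lambda>t. min_energy L H h (\<lambda>_. (c, q)) t) has_real_derivative D t) (at t)"
proof -
  let ?S = "dirichlet_set L H h l" and ?C = "tip_coefficients L l c q"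
  let ?C' = "\<lambda>t. ((- (c * l * inverse (t\<^sup>2)), q / l), (c * (L - l) * inverse ((L - t)\<^sup>2), - (q / (L - l))))"
  have L: "0 < L" using l by simp
  have pos: "0 < ?C t \<bullet> i" if "t \<in> {0<..<L}" "i \<in> Basis" for t i
    using that l c by (auto simp: tip_coefficients_def Basis_real4)
  have orth: "?C t \<in> orthant" if "t \<in> {0<..<L}" for t
    using pos[OF that] by (auto simp: orthant_def intro: less_imp_le)
  have val: "min_energy L H h (\<lambda>_. (c, q)) t = min_value (closure ?S) (?C t)" if "t \<in> {0<..<L}" for t
    using that min_value_closure[OF ne dirichlet_set_orthant orth[OF that]] energies_moved_tip[OF l, of t H h c q]
    by (simp add: min_energy_eq min_value_def)
  obtain D where D: "continuous_on {0<..<L} D"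
    "\<And>t. t \<in> {0<..<L} \<Longrightarrow> ((\<lambda>t. min_value (closure ?S) (?C t)) has_real_derivative D t) (at t)"
  proof (rule min_value_C1)
    show "closed (closure ?S)" by simp
    show "closure ?S \<noteq> {}" using ne by simp
    show "closure ?S \<subseteq> orthant" using dirichlet_set_orthant closed_orthant by (rule closure_minimal)
    show "open {0<..<L}" by simp
    show "continuous_on {0<..<L} ?C'"
      using l by (intro continuous_intros) auto
    show "(?C has_vector_derivative ?C' t) (at t)" if "t \<in> {0<..<L}" for t
    proof -
      have d: "((\<lambda>t. c * l * inverse t) has_real_derivative - (c * l * inverse (t\<^sup>2))) (at t)"
        "((\<lambda>t. q / l * t) has_real_derivative q / l) (at t)"
        "((\<lambda>t. c * (L - l) * inverse (L - t)) has_real_derivative c * (L - l) * inverse ((L - t)\<^sup>2)) (at t)"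
        "((\<lambda>t. q / (L - l) * (L - t)) has_real_derivative - (q / (L - l))) (at t)"
        using that l by (auto intro!: derivative_eq_intros simp: power2_eq_square)
      show ?thesis unfolding tip_coefficients_def[abs_def]
        by (intro has_vector_derivative_Pair d[unfolded has_real_derivative_iff_has_vector_derivative])
    qed
    show "p = p'" if "t \<in> {0<..<L}" "p \<in> closure ?S" "p' \<in> closure ?S"
      "?C t \<bullet> p = min_value (closure ?S) (?C t)" "?C t \<bullet> p' = min_value (closure ?S) (?C t)" for t p p'
      using midpoint_convex_unique_minimizer[OF dirichlet_set_orthant midpoint_convex_dirichlet_set[OF L] pos[OF that(1)]
          that(2,4,3,5)] .
  qed (use pos in auto)
  show thesis
  proof (rule that[OF D(1)])
    fix t assume t: "t \<in> {0<..<L}"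
    show "((\<lambda>t. min_energy L H h (\<lambda>_. (c, q)) t) has_real_derivative D t) (at t)"
      by (rule has_field_derivative_transform_within_open[OF D(2)[OF t] _ t]) (simp_all add: val)
  qed
qed

text \<open>Admissible displacements exist for all crack lengths or for none, and in the latter
  case the energy would be the constant \<open>Inf {}\<close>.\<close>

lemma dirichlet_set_nonempty_if_release:
  assumes l: "0 < l" "l < L" and nz: "deriv (min_energy L H h (\<lambda>_. (c, q))) l \<noteq> 0"
  shows "dirichlet_set L H h l \<noteq> {}"
proof
  assume "dirichlet_set L H h l = {}"
  then have "min_energy L H h (\<lambda>_. (c, q)) t = Inf {}" if "t \<in> {0<..<L}" for t
    using energies_moved_tip[OF l, of t H h c q] that by (simp add: min_energy_eq)
  then have "(min_energy L H h (\<lambda>_. (c, q)) has_real_derivative 0) (at l)"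
    using l by (intro has_field_derivative_transform_within_open[OF DERIV_const[of "Inf {}"], where S = "{0<..<L}"]) auto
  then show False using nz DERIV_imp_deriv by blast
qed

lemma antimono_deriv_nonpos:
  fixes E :: "real \<Rightarrow> real"
  assumes "(E has_real_derivative D) (at l)" and "l \<in> I" "open I" and "\<And>t. t \<in> I \<Longrightarrow> l \<le> t \<Longrightarrow> E t \<le> E l"
  shows "D \<le> 0"
proof (rule ccontr)
  assume "\<not> D \<le> 0"
  then obtain d where d: "d > 0" "\<And>x. 0 < x \<Longrightarrow> x < d \<Longrightarrow> E l < E (l + x)"
    using DERIV_pos_inc_right[OF assms(1)] by auto
  obtain e where e: "e > 0" "ball l e \<subseteq> I" using assms(2,3) open_contains_ball by blast
  let ?x = "min d e / 2"
  have "E l < E (l + ?x)" using d(1) e(1) by (intro d(2)) auto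
  moreover have "E (l + ?x) \<le> E l" using d(1) e by (intro assms(4) subsetD[OF e(2)]) (auto simp: dist_real_def)
  ultimately show False by simp
qed

section \<open>Energy release of the layered bodies and the effective toughness\<close>

text \<open>At an interface the slope is constant immediately to the right and \<open>G\<close> is
  continuous, so the lower limit is a limit.\<close>

lemma release_n_eq:
  fixes G :: "real \<Rightarrow> real"
  assumes L: "0 < L" "0 < n" and lam: "0 < lam" "lam < 1" and a: "0 < a" "lam * a < 1"
    and E: "\<And>t. t \<in> {0<..<L} \<Longrightarrow> (E has_real_derivative - G t) (at t)" and G: "continuous_on {0<..<L} G"
    and En: "energy_n L H h lam C\<^sub>A C\<^sub>B n = (\<lambda>s. E (layer_map L n lam a s))"
    and s: "0 < s" "s < L"
  shows "release_n L H h lam C\<^sub>A C\<^sub>B n s = ereal (G (layer_map L n lam a s) * layer_slope L n lam a s)"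
proof -
  let ?f = "layer_map L n lam a" and ?f' = "layer_slope L n lam a"
  have inside: "?f t \<in> {0<..<L}" if "t \<in> {0<..<L}" for t
    using strict_mono_less[OF strict_mono_layer_map[OF L lam a]] layer_map_fixed[OF L lam] that
    by (metis greaterThanLessThan_iff)
  have d: "- deriv (energy_n L H h lam C\<^sub>A C\<^sub>B n) t = G (?f t) * ?f' t"
    if t: "t \<in> {0<..<L}" "t \<notin> interfaces L lam n" for t
  proof -
    have "((\<lambda>s. E (?f s)) has_real_derivative - G (?f t) * ?f' t) (at t)"
      by (rule DERIV_chain2[OF E[OF inside[OF t(1)]] smooth_approxD(2)[OF smooth_approx_layer_map[OF L lam] t(2)]])
    then show ?thesis unfolding En by (simp add: DERIV_imp_deriv)
  qed
  show ?thesis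
  proof (cases "s \<in> interfaces L lam n")
    case False
    then show ?thesis using d[of s] s by (simp add: release_n_def)
  next
    case True
    have "isCont ?f s"
      using continuous_layer_map[OF L lam] by (simp add: continuous_on_eq_continuous_at)
    moreover have "isCont G (?f s)"
      using G inside[of s] s by (simp add: continuous_on_eq_continuous_at)
    ultimately have "isCont (\<lambda>t. G (?f t)) s" by (rule isCont_o2)
    then have "((\<lambda>t. G (?f t)) \<longlongrightarrow> G (?f s)) (at_right s)"
      by (simp add: isCont_def filterlim_at_split)
    then have "((\<lambda>t. ereal (G (?f t) * ?f' s)) \<longlongrightarrow> ereal (G (?f s) * ?f' s)) (at_right s)"
      by (intro tendsto_intros)
    moreover have "\<forall>\<^sub>F t in at_right s. ereal (G (?f t) * ?f' s) = ereal (- deriv (energy_n L H h lam C\<^sub>A C\<^sub>B n) t)"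
    proof -
      have "\<forall>\<^sub>F t in at s. t \<notin> interfaces L lam n"
        using islimpt_finite[OF finite_interfaces[OF L lam], of s] by (simp add: islimpt_iff_eventually)
      then have "\<forall>\<^sub>F t in at_right s. t \<notin> interfaces L lam n"
        by (simp add: eventually_at_split)
      moreover have "\<forall>\<^sub>F t in at_right s. t < L" by (rule order_tendstoD(2)[OF tendsto_ident_at s(2)])
      moreover have "\<forall>\<^sub>F t in at_right s. s < t" by (rule eventually_at_right_less)
      ultimately show ?thesis using layer_slope_eventually_right[OF L lam, of a s]
        by eventually_elim (use d s in auto)
    qed
    ultimately have "((\<lambda>t. ereal (- deriv (energy_n L H h lam C\<^sub>A C\<^sub>B n) t)) \<longlongrightarrow> ereal (G (?f s) * ?f' s)) (at_right s)"
      by (rule Lim_transform_eventually)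
    then have "Liminf (at_right s) (\<lambda>t. ereal (- deriv (energy_n L H h lam C\<^sub>A C\<^sub>B n) t)) = ereal (G (?f s) * ?f' s)"
      by (rule lim_imp_Liminf[OF trivial_limit_at_right_real])
    then show ?thesis using True s by (simp add: release_n_def)
  qed
qed

text \<open>For the upper bound the tip is placed, in the period containing \<open>l\<close>, at the
  beginning of the layer with the smaller quotient of slope and toughness.\<close>

lemma gamma_liminf_ratio_eq:
  fixes G :: "real \<Rightarrow> real"
  assumes L: "0 < L" and lam: "0 < lam" "lam < 1" and a: "0 < a" "lam * a < 1"
    and b: "(1 - lam * a) / (1 - lam) = b" and Gc: "0 < Gc\<^sub>A" "0 < Gc\<^sub>B"
    and E: "\<And>t. t \<in> {0<..<L} \<Longrightarrow> (E has_real_derivative - G t) (at t)" and G: "continuous_on {0<..<L} G"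
    and En: "\<And>n. 0 < n \<Longrightarrow> energy_n L H h lam C\<^sub>A C\<^sub>B n = (\<lambda>s. E (layer_map L n lam a s))"
    and l: "0 < l" "l < L" and pos: "0 < G l"
  shows "gamma_liminf_ratio L H h lam C\<^sub>A C\<^sub>B Gc\<^sub>A Gc\<^sub>B l = ereal (G l * min (a / Gc\<^sub>A) (b / Gc\<^sub>B))"
proof -
  let ?f = "\<lambda>n. layer_map L n lam a"
  let ?ratio = "\<lambda>n s. release_n L H h lam C\<^sub>A C\<^sub>B n s / ereal (toughness L lam Gc\<^sub>A Gc\<^sub>B n s)"
  let ?m = "min (a / Gc\<^sub>A) (b / Gc\<^sub>B)"
  have ratio: "?ratio n s = ereal (G (?f n s) * (if frac (real n / L * s) < lam then a / Gc\<^sub>A else b / Gc\<^sub>B))"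
    if n: "0 < n" and s: "0 < s" "s < L" for n s
  proof -
    have "release_n L H h lam C\<^sub>A C\<^sub>B n s = ereal (G (?f n s) * layer_slope L n lam a s)"
      by (rule release_n_eq[OF L n lam a _ G En[OF n] s]) (rule E)
    then show ?thesis
      unfolding toughness_inside[OF L n less_imp_le[OF s(1)] s(2) lam]
        layer_slope_inside[OF L n less_imp_le[OF s(1)] s(2)] b
      using Gc by simp
  qed
  have L0: "(\<lambda>n. L / real n) \<longlonglongrightarrow> 0" by (rule lim_const_over_n)
  have Gf: "(\<lambda>n. G (?f n (s n))) \<longlonglongrightarrow> G l" if s: "s \<longlonglongrightarrow> l" for s
  proof -
    have "(\<lambda>n. ?f n (s n) - s n) \<longlonglongrightarrow> 0"
      using L0
    proof (rule Lim_null_comparison[rotated])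
      show "\<forall>\<^sub>F n in sequentially. norm (?f n (s n) - s n) \<le> L / real n"
        using eventually_gt_at_top[of 0] by eventually_elim (simp add: layer_map_close[OF L _ lam a])
    qed
    from tendsto_add[OF this s] have "(\<lambda>n. ?f n (s n)) \<longlonglongrightarrow> l" by simp
    moreover have "isCont G l" using G l by (simp add: continuous_on_eq_continuous_at)
    ultimately show ?thesis by (rule isCont_tendsto_compose[rotated])
  qed
  have in_L: "\<forall>\<^sub>F n in sequentially. 0 < n \<and> 0 < s n \<and> s n < L" if "s \<longlonglongrightarrow> l" for s :: "nat \<Rightarrow> real"
    using eventually_gt_at_top[of 0] order_tendstoD(1)[OF that l(1)] order_tendstoD(2)[OF that l(2)]
    by eventually_elim simp
  have lower: "ereal (G l * ?m) \<le> liminf (\<lambda>n. ?ratio n (s n))" if s: "s \<longlonglongrightarrow> l" for s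
  proof -
    have "(\<lambda>n. ereal (G (?f n (s n)) * ?m)) \<longlonglongrightarrow> ereal (G l * ?m)"
      by (intro tendsto_intros Gf s)
    then have "ereal (G l * ?m) = liminf (\<lambda>n. ereal (G (?f n (s n)) * ?m))"
      by (rule lim_imp_Liminf[OF trivial_limit_sequentially, symmetric])
    also have "\<dots> \<le> liminf (\<lambda>n. ?ratio n (s n))"
    proof (rule Liminf_mono)
      show "\<forall>\<^sub>F n in sequentially. ereal (G (?f n (s n)) * ?m) \<le> ?ratio n (s n)"
        using in_L[OF s] order_tendstoD(1)[OF Gf[OF s] pos]
      proof eventually_elim
        case (elim n)
        then show ?case unfolding ratio[OF conjunct1[OF elim(1)] conjunct1[OF conjunct2[OF elim(1)]] conjunct2[OF conjunct2[OF elim(1)]]]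
          by (auto intro!: mult_left_mono)
      qed
    qed
    finally show ?thesis .
  qed
  \<comment> \<open>the relative position within a period: \<open>0\<close> starts a layer of A, \<open>lam\<close> one of B\<close>
  have "\<exists>\<theta>. 0 \<le> \<theta> \<and> \<theta> < 1 \<and> (if \<theta> < lam then a / Gc\<^sub>A else b / Gc\<^sub>B) = ?m"
    using lam by (cases "a / Gc\<^sub>A \<le> b / Gc\<^sub>B") (auto intro: exI[of _ 0] exI[of _ lam] simp: min_def)
  then obtain \<theta> where \<theta>: "0 \<le> \<theta>" "\<theta> < 1" "(if \<theta> < lam then a / Gc\<^sub>A else b / Gc\<^sub>B) = ?m" by blast
  define s where "s n = (of_int \<lfloor>real n / L * l\<rfloor> + \<theta>) * (L / real n)" for n :: nat
  have scaled: "real n / L * s n = of_int \<lfloor>real n / L * l\<rfloor> + \<theta>" if "0 < n" for n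
    using that L by (simp add: s_def)
  have frac_s: "frac (real n / L * s n) = \<theta>" if "0 < n" for n
  proof -
    have "\<lfloor>of_int \<lfloor>real n / L * l\<rfloor> + \<theta>\<rfloor> = \<lfloor>real n / L * l\<rfloor>" using \<theta> by (intro floor_unique) auto
    then show ?thesis unfolding scaled[OF that] frac_def by simp
  qed
  have s_range: "s n \<in> {0..L}" for n
  \<comment> \<open>for \<open>n = 0\<close> the sequence takes the value 0, a division by zero\<close>
  proof (cases "n = 0")
    case False
    then have n: "0 < n" by simp
    have "0 \<le> real n / L * l" "real n / L * l < real n" using n L l by (simp_all add: field_simps)
    then have "0 \<le> \<lfloor>real n / L * l\<rfloor>" "\<lfloor>real n / L * l\<rfloor> + 1 \<le> int n" by (simp_all add: floor_less_iff zless_iff_Suc_zadd[symmetric] add1_zle_eq)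
    then have "0 \<le> (of_int \<lfloor>real n / L * l\<rfloor> :: real)" "of_int \<lfloor>real n / L * l\<rfloor> + 1 \<le> real n" by linarith+
    then have "0 \<le> real n / L * s n" "real n / L * s n \<le> real n" unfolding scaled[OF n] using \<theta> by linarith+
    then show ?thesis using n L by (simp add: field_simps zero_le_mult_iff)
  qed (use L in \<open>simp add: s_def\<close>)
  have s_lim: "s \<longlonglongrightarrow> l"
  proof (rule LIM_zero_cancel, rule Lim_null_comparison[OF _ L0])
    show "\<forall>\<^sub>F n in sequentially. norm (s n - l) \<le> L / real n"
      using eventually_gt_at_top[of 0]
    proof eventually_elim
      case (elim n)
      have p: "0 < real n / L" using elim L by simp
      have "\<bar>real n / L * s n - real n / L * l\<bar> \<le> 1"
        unfolding scaled[OF elim] using \<theta> floor_correct[of "real n / L * l"] by linarith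
      then have "real n / L * \<bar>s n - l\<bar> \<le> 1"
        using p by (simp only: right_diff_distrib[symmetric] abs_mult abs_of_pos)
      then have "\<bar>s n - l\<bar> \<le> 1 / (real n / L)"
        using p by (simp only: pos_le_divide_eq mult.commute)
      then show ?case by simp
    qed
  qed
  have "(\<lambda>n. ?ratio n (s n)) \<longlonglongrightarrow> ereal (G l * ?m)"
  proof (rule Lim_transform_eventually)
    show "(\<lambda>n. ereal (G (?f n (s n)) * ?m)) \<longlonglongrightarrow> ereal (G l * ?m)"
      by (intro tendsto_intros Gf s_lim)
    show "\<forall>\<^sub>F n in sequentially. ereal (G (?f n (s n)) * ?m) = ?ratio n (s n)"
      using in_L[OF s_lim] by eventually_elim (simp only: ratio frac_s \<theta>(3))
  qed
  then have attained: "liminf (\<lambda>n. ?ratio n (s n)) = ereal (G l * ?m)"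
    by (rule lim_imp_Liminf[OF trivial_limit_sequentially])
  show ?thesis unfolding gamma_liminf_ratio_def
  proof (rule antisym)
    show "Inf {liminf (\<lambda>n. ?ratio n (s n)) | s. (\<forall>n::nat. s n \<in> {0..L}) \<and> s \<longlonglongrightarrow> l} \<le> ereal (G l * ?m)"
      using s_range s_lim attained[symmetric] by (intro Inf_lower) blast
    show "ereal (G l * ?m) \<le> Inf {liminf (\<lambda>n. ?ratio n (s n)) | s. (\<forall>n::nat. s n \<in> {0..L}) \<and> s \<longlonglongrightarrow> l}"
      using lower by (intro Inf_greatest) blast
  qed
qed

theorem mainTheorem3:
  fixes L H lam \<mu>\<^sub>A\<^sub>1 \<mu>\<^sub>A\<^sub>2 \<mu>\<^sub>B\<^sub>1 \<mu>\<^sub>B\<^sub>2 Gc\<^sub>A Gc\<^sub>B l :: real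
    and g :: "real \<times> real \<Rightarrow> real"
  assumes "L > 0" and "H > 0" and "0 < lam" and "lam < 1"
    and "\<mu>\<^sub>A\<^sub>1 > 0" and "\<mu>\<^sub>A\<^sub>2 > 0" and "\<mu>\<^sub>B\<^sub>1 > 0" and "\<mu>\<^sub>B\<^sub>2 > 0"
    and "Gc\<^sub>A > 0" and "Gc\<^sub>B > 0"
    and "boundary_datum L H g"
    and "\<mu>\<^sub>B\<^sub>1 * \<mu>\<^sub>B\<^sub>2 = \<mu>\<^sub>A\<^sub>1 * \<mu>\<^sub>A\<^sub>2"
    and "0 < l" and "l < L"
    and "release_hom L H g lam (\<mu>\<^sub>A\<^sub>1, \<mu>\<^sub>A\<^sub>2) (\<mu>\<^sub>B\<^sub>1, \<mu>\<^sub>B\<^sub>2) l \<noteq> 0"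
  shows "effective_toughness L H g lam (\<mu>\<^sub>A\<^sub>1, \<mu>\<^sub>A\<^sub>2) (\<mu>\<^sub>B\<^sub>1, \<mu>\<^sub>B\<^sub>2) Gc\<^sub>A Gc\<^sub>B l
    = ereal (lam * max Gc\<^sub>A (Gc\<^sub>B * \<mu>\<^sub>B\<^sub>1 / \<mu>\<^sub>A\<^sub>1) + (1 - lam) * max (Gc\<^sub>A * \<mu>\<^sub>A\<^sub>1 / \<mu>\<^sub>B\<^sub>1) Gc\<^sub>B)"
proof -
  let ?A = "(\<mu>\<^sub>A\<^sub>1, \<mu>\<^sub>A\<^sub>2)" and ?B = "(\<mu>\<^sub>B\<^sub>1, \<mu>\<^sub>B\<^sub>2)"
  define c where "c = fst (C_hom lam ?A ?B)"
  define q where "q = snd (C_hom lam ?A ?B)"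
  define E where "E = energy_hom L H g lam ?A ?B"
  define G where "G t = - deriv E t" for t
  have E: "E = min_energy L H g (\<lambda>_. (c, q))"
    by (simp add: E_def energy_hom_def[abs_def] c_def q_def)
  note rescale = energy_n_eq[OF \<open>L > 0\<close> _ \<open>0 < lam\<close> \<open>lam < 1\<close> \<open>\<mu>\<^sub>A\<^sub>1 > 0\<close> \<open>\<mu>\<^sub>B\<^sub>1 > 0\<close>
      \<open>\<mu>\<^sub>B\<^sub>1 * \<mu>\<^sub>B\<^sub>2 = \<mu>\<^sub>A\<^sub>1 * \<mu>\<^sub>A\<^sub>2\<close> c_def]
  have c: "0 < c" and a: "lam * (c / \<mu>\<^sub>A\<^sub>1) < 1" and b: "(1 - lam * (c / \<mu>\<^sub>A\<^sub>1)) / (1 - lam) = c / \<mu>\<^sub>B\<^sub>1"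
    using rescale(1-3)[of 1] by simp_all
  have q: "0 < q" using assms by (simp add: q_def C_hom_def add_pos_pos)
  have Gl: "G l \<noteq> 0" using assms(15) by (simp add: G_def E_def release_hom_def)
  then have ne: "dirichlet_set L H g l \<noteq> {}"
    using dirichlet_set_nonempty_if_release[OF \<open>0 < l\<close> \<open>l < L\<close>] by (simp add: G_def E)
  obtain D where D: "continuous_on {0<..<L} D"
    "\<And>t. t \<in> {0<..<L} \<Longrightarrow> ((\<lambda>t. min_energy L H g (\<lambda>_. (c, q)) t) has_real_derivative D t) (at t)"
    by (rule min_energy_C1[OF \<open>0 < l\<close> \<open>l < L\<close> c q ne], rule that)
  note D = D(1) D(2)[folded E]
  have GD: "G t = - D t" if "t \<in> {0<..<L}" for t
    using D(2)[OF that] by (simp add: G_def DERIV_imp_deriv)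
  have E': "(E has_real_derivative - G t) (at t)" if "t \<in> {0<..<L}" for t
    using D(2)[OF that] GD[OF that] by simp
  have contG: "continuous_on {0<..<L} G"
    using continuous_on_minus[OF D(1)] by (rule continuous_on_cong[THEN iffD1, rotated -1]) (auto simp: GD)
  have "energies L H g (\<lambda>_. (c, q)) l \<noteq> {}"
    using energies_moved_tip[OF \<open>0 < l\<close> \<open>l < L\<close> \<open>0 < l\<close> \<open>l < L\<close>] ne by simp
  then have "- G l \<le> 0"
    using min_energy_antimono[of c q L H g l] c q \<open>0 < l\<close> \<open>l < L\<close>
    by (intro antimono_deriv_nonpos[OF E'[of l], of "{0<..<L}"]) (auto simp: E)
  with Gl have pos: "0 < G l" by simp
  let ?m = "min (c / \<mu>\<^sub>A\<^sub>1 / Gc\<^sub>A) (c / \<mu>\<^sub>B\<^sub>1 / Gc\<^sub>B)"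
  have \<gamma>: "gamma_liminf_ratio L H g lam ?A ?B Gc\<^sub>A Gc\<^sub>B l = ereal (G l * ?m)"
  proof (rule gamma_liminf_ratio_eq[where E = E])
    show "0 < c / \<mu>\<^sub>A\<^sub>1" using c assms by simp
    show "energy_n L H g lam ?A ?B n = (\<lambda>s. E (layer_map L n lam (c / \<mu>\<^sub>A\<^sub>1) s))" if "0 < n" for n
      unfolding E_def by (rule ext) (rule rescale(4)[OF that])
  qed (use assms a b E' contG pos in auto)
  have m: "0 < ?m" using c assms by simp
  have "effective_toughness L H g lam ?A ?B Gc\<^sub>A Gc\<^sub>B l = ereal (1 / ?m)"
  proof -
    have "(if ereal (x * k) = 0 then \<infinity> else ereal x / ereal (x * k)) = ereal (1 / k)" if "0 < x" "0 < k" for x k :: real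
      using that by simp
    from this[OF pos m] show ?thesis
      by (simp only: effective_toughness_def Let_def \<gamma> release_hom_def G_def E_def)
  qed
  also have "1 / ?m = max (Gc\<^sub>A * \<mu>\<^sub>A\<^sub>1) (Gc\<^sub>B * \<mu>\<^sub>B\<^sub>1) / c"
    using c assms by (auto simp: min_def max_def field_simps)
  also have "\<dots> = max (Gc\<^sub>A * \<mu>\<^sub>A\<^sub>1) (Gc\<^sub>B * \<mu>\<^sub>B\<^sub>1) * (lam / \<mu>\<^sub>A\<^sub>1 + (1 - lam) / \<mu>\<^sub>B\<^sub>1)"
    by (simp add: c_def C_hom_def)
  also have "\<dots> = lam * (max (Gc\<^sub>A * \<mu>\<^sub>A\<^sub>1) (Gc\<^sub>B * \<mu>\<^sub>B\<^sub>1) / \<mu>\<^sub>A\<^sub>1) +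
      (1 - lam) * (max (Gc\<^sub>A * \<mu>\<^sub>A\<^sub>1) (Gc\<^sub>B * \<mu>\<^sub>B\<^sub>1) / \<mu>\<^sub>B\<^sub>1)"
    by (simp add: algebra_simps)
  also have "max (Gc\<^sub>A * \<mu>\<^sub>A\<^sub>1) (Gc\<^sub>B * \<mu>\<^sub>B\<^sub>1) / \<mu>\<^sub>A\<^sub>1 = max Gc\<^sub>A (Gc\<^sub>B * \<mu>\<^sub>B\<^sub>1 / \<mu>\<^sub>A\<^sub>1)"
    using assms(5) by (auto simp: max_def field_simps)
  also have "max (Gc\<^sub>A * \<mu>\<^sub>A\<^sub>1) (Gc\<^sub>B * \<mu>\<^sub>B\<^sub>1) / \<mu>\<^sub>B\<^sub>1 = max (Gc\<^sub>A * \<mu>\<^sub>A\<^sub>1 / \<mu>\<^sub>B\<^sub>1) Gc\<^sub>B"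
    using assms(7) by (auto simp: max_def field_simps)
  finally show ?thesis .
qed

end
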